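(* Let $H$ be an infinite dimensional real separable Hilbert space. i) Let $Q(X)=(A_QX)\cdot X$ be a quadratic form on $H^2$ with $A_Q\in\mathcal L(H^2)$ selfadjoint, nonnegative and trace class. For every $F\in S(H^2,Q)$ and every $h>0$, there exists a unique bounded operator $B_h$ in $\mathcal F_s(H_{\mathbf C})$ such that $\sigma_h^{wick}(B_h)=F$. Setting $B_h=Op_h^{wick}(F)$, one has $$\|Op_h^{wick}(F)\|\le e^{(h/2)\mathrm{Tr}A_Q}\|F\|_Q,$$ where the norm on the left is that of $\mathcal L(\mathcal F_s(H_{\mathbf C}))$. ii) For every polynomial function $F$ on $H^2$ of degree $m$ and every $h>0$, there exists an unbounded operator $B_h$, closable, with initial domain $D(\mathcal N^m)$, satisfying $\sigma_h^{wick}(B_h)=F$ (one then sets $B_h=Op_h^{wick}(F)$). In particular, the Wick symbol of the Segal field $\Phi_S(A)$ associated with $A\in H^2$ is the function $H^2\ni X\mapsto h^{-1/2}A\cdot X$, where $A\cdot X$ is the real scalar product on $H^2$. iii) For every quadratic form $F$ on $H^2$ written as $F(q,p)=(Aq)\cdot q+(Ap)\cdot p$, where $A\in\mathcal L(H)$ is selfadjoint, and every $h>0$, the operator $B_h=2h\,\mathrm d\Gamma(A)$ satisfies $\sigma_h^{wick}(B_h)=F$.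
   Context: $H_{\mathbf C}$ is the complexification of $H$, $H^2\simeq H_{\mathbf C}$ via $(q,p)\leftrightarrow q+ip$; $\mathcal F_s(H_{\mathbf C})$ is the symmetric Fock space; $\Phi_S(V)=(a(V)+a^\star(V))/\sqrt2$ is the Segal field; $\mathrm d\Gamma$ is the usual second quantization (operators on $H$ being extended complex-linearly to $H_{\mathbf C}$); $\mathcal N=\mathrm d\Gamma(I)$ is the number operator. Coherent states: for $X=(a,b)\in H^2$, $h>0$, $\Psi_{X,h}=e^{-|X|^2/4h}\sum_{n\ge0}\frac{(a+ib)^{\otimes n}}{(2h)^{n/2}\sqrt{n!}}$; they belong to $D(\mathcal N^m)$ for all $m\ge1$. The Wick symbol of a bounded operator $A$ in $\mathcal F_s(H_{\mathbf C})$, or of an unbounded one whose domain contains the coherent states, is $\sigma_h^{wick}(A)(X)=\langle A\Psi_{X,h},\Psi_{X,h}\rangle$, $X\in H^2$. For a nonnegative quadratic form $Q$ on $H^2$, $S(H^2,Q)$ is the set of $f\in C^\infty(H^2)$ for which there is $C(f)>0$ such that for all integers $m\ge0$ and all $X,V_1,\dots,V_m\in H^2$, $|(d^mf)(X)(V_1,\dots,V_m)|\le C(f)\prod_{j=1}^mQ(V_j)^{1/2}$; the smallest such $C(f)$ is $\|f\|_Q$. A polynomial function on $H^2$ is a finite linear combination of finite products of functions $(q,p)\mapsto e_j\cdot q$ and $(q,p)\mapsto e_j\cdot p$, where $(e_j)$ is a Hilbert basis of $H$. *)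

theory Defs
  imports "HOL-Analysis.Analysis"
begin

section \<open>Real Hilbert spaces: bases, trace class operators\<close>

definition hilbert_basis :: "'a::real_inner set \<Rightarrow> bool" where
  "hilbert_basis E \<longleftrightarrow>
     (\<forall>e\<in>E. norm e = 1) \<and> pairwise orthogonal E \<and> closure (span E) = UNIV"

text \<open>A fixed Hilbert basis of the whole space; the quantities defined below with its help
  (trace, trace class, inner product of the Fock space) do not depend on this choice.\<close>

definition some_basis :: "'a::real_inner set" where
  "some_basis = (SOME E. hilbert_basis E)"

definition selfadjoint_op :: "('a::real_inner \<Rightarrow> 'a) \<Rightarrow> bool" where
  "selfadjoint_op T \<longleftrightarrow> bounded_linear T \<and> (\<forall>x y. T x \<bullet> y = x \<bullet> T y)"

definition nonneg_op :: "('a::real_inner \<Rightarrow> 'a) \<Rightarrow> bool" where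
  "nonneg_op T \<longleftrightarrow> (\<forall>x. 0 \<le> T x \<bullet> x)"

text \<open>In the following definition \<open>P\<close> is the absolute value of \<open>T\<close>: the condition on
  \<open>P x \<bullet> P y\<close> says that the square of \<open>P\<close> is the adjoint of \<open>T\<close> composed with \<open>T\<close>.\<close>

definition trace_class :: "('a::real_inner \<Rightarrow> 'a) \<Rightarrow> bool" where
  "trace_class T \<longleftrightarrow> bounded_linear T \<and>
     (\<exists>P. selfadjoint_op P \<and> nonneg_op P \<and> (\<forall>x y. P x \<bullet> P y = T x \<bullet> T y) \<and>
          (\<lambda>e. P e \<bullet> e) summable_on some_basis)"

definition trace_op :: "('a::real_inner \<Rightarrow> 'a) \<Rightarrow> real" where
  "trace_op T = (\<Sum>\<^sub>\<infinity>e\<in>some_basis. T e \<bullet> e)"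


section \<open>Smooth functions and the symbol classes\<close>

text \<open>\<open>nderiv f [V1, ..., Vm] X\<close> is the value at \<open>(V1, ..., Vm)\<close> of the \<open>m\<close>-th
  Frechet differential of \<open>f\<close> at \<open>X\<close>.\<close>

primrec nderiv :: "('b::real_normed_vector \<Rightarrow> 'c::real_normed_vector) \<Rightarrow> 'b list \<Rightarrow> 'b \<Rightarrow> 'c" where
  "nderiv f [] = f"
| "nderiv f (V # Vs) = (\<lambda>X. frechet_derivative (nderiv f Vs) (at X) V)"

text \<open>Infinitely Frechet differentiable: for each \<open>m\<close>, the \<open>m\<close>-th differential is a map into
  the bounded \<open>m\<close>-linear maps which is differentiable for the operator norm (the estimate
  of the remainder is uniform in the arguments \<open>Vs\<close>).\<close>

definition smooth :: "('b::real_normed_vector \<Rightarrow> 'c::real_normed_vector) \<Rightarrow> bool" where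
  "smooth f \<longleftrightarrow> (\<forall>m X.
     (\<exists>C. \<forall>Vs. length Vs = m \<longrightarrow> norm (nderiv f Vs X) \<le> C * prod_list (map norm Vs)) \<and>
     (\<forall>Vs. length Vs = m \<longrightarrow> nderiv f Vs differentiable (at X)) \<and>
     (\<forall>\<epsilon>>0. \<exists>\<delta>>0. \<forall>Y. norm (Y - X) < \<delta> \<longrightarrow> (\<forall>Vs. length Vs = m \<longrightarrow>
        norm (nderiv f Vs Y - nderiv f Vs X - nderiv f ((Y - X) # Vs) X)
          \<le> \<epsilon> * norm (Y - X) * prod_list (map norm Vs))))"

definition S_bound :: "('b::real_normed_vector \<Rightarrow> real) \<Rightarrow> ('b \<Rightarrow> complex) \<Rightarrow> real \<Rightarrow> bool" where
  "S_bound Q f C \<longleftrightarrow>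
     (\<forall>X Vs. cmod (nderiv f Vs X) \<le> C * prod_list (map (\<lambda>V. sqrt (Q V)) Vs))"

definition S_class :: "('b::real_normed_vector \<Rightarrow> real) \<Rightarrow> ('b \<Rightarrow> complex) set" where
  "S_class Q = {f. smooth f \<and> (\<exists>C>0. S_bound Q f C)}"

definition S_norm :: "('b::real_normed_vector \<Rightarrow> real) \<Rightarrow> ('b \<Rightarrow> complex) \<Rightarrow> real" where
  "S_norm Q f = Inf {C. C > 0 \<and> S_bound Q f C}"


section \<open>Polynomial functions\<close>

definition coord_funs :: "'a::real_inner set \<Rightarrow> ('a \<times> 'a \<Rightarrow> real) set" where
  "coord_funs E = (\<Union>e\<in>E. {\<lambda>(q, p). e \<bullet> q, \<lambda>(q, p). e \<bullet> p})"

text \<open>Linear combinations of products of at most \<open>m\<close> coordinate functions.\<close>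

definition polys_upto :: "'a::real_inner set \<Rightarrow> nat \<Rightarrow> ('a \<times> 'a \<Rightarrow> complex) set" where
  "polys_upto E m = {F. \<exists>ts :: (complex \<times> ('a \<times> 'a \<Rightarrow> real) list) list.
     (\<forall>(c, ls)\<in>set ts. set ls \<subseteq> coord_funs E \<and> length ls \<le> m) \<and>
     F = (\<lambda>X. \<Sum>(c, ls)\<leftarrow>ts. c * of_real (\<Prod>l\<leftarrow>ls. l X))}"

definition polynomial_fun :: "'a::real_inner set \<Rightarrow> ('a \<times> 'a \<Rightarrow> complex) \<Rightarrow> bool" where
  "polynomial_fun E F \<longleftrightarrow> (\<exists>m. F \<in> polys_upto E m)"

definition poly_fun_degree :: "'a::real_inner set \<Rightarrow> ('a \<times> 'a \<Rightarrow> complex) \<Rightarrow> nat" where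
  "poly_fun_degree E F = (LEAST m. F \<in> polys_upto E m)"


section \<open>The complexification\<close>

text \<open>The pair \<open>(q, p)\<close> stands for \<open>q + \<i> p\<close>. The Hermitian product is linear in the first and
  antilinear in the second argument; its real part is the inner product \<open>\<bullet>\<close> of the type \<open>'a \<times> 'a\<close>.\<close>

definition cscale :: "complex \<Rightarrow> 'a::real_inner \<times> 'a \<Rightarrow> 'a \<times> 'a" where
  "cscale c V = (Re c *\<^sub>R fst V - Im c *\<^sub>R snd V, Re c *\<^sub>R snd V + Im c *\<^sub>R fst V)"

definition cinner :: "'a::real_inner \<times> 'a \<Rightarrow> 'a \<times> 'a \<Rightarrow> complex" where
  "cinner V W = Complex (fst V \<bullet> fst W + snd V \<bullet> snd W) (snd V \<bullet> fst W - fst V \<bullet> snd W)"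

definition cextend :: "('a::real_inner \<Rightarrow> 'a) \<Rightarrow> 'a \<times> 'a \<Rightarrow> 'a \<times> 'a" where
  "cextend A V = (A (fst V), A (snd V))"


section \<open>The symmetric Fock space\<close>

text \<open>The \<open>n\<close>-th Hilbert tensor power of the complexification is realized, as usual, as the space
  of bounded \<open>n\<close>-antilinear forms with finite Hilbert-Schmidt norm: an element \<open>T\<close> is identified
  with the form \<open>(V1, ..., Vn) \<mapsto> \<langle>T, V1 \<otimes> ... \<otimes> Vn\<rangle>\<close>, so that \<open>U1 \<otimes> ... \<otimes> Un\<close> is the
  form \<open>(V1, ..., Vn) \<mapsto> \<langle>U1, V1\<rangle> ... \<langle>Un, Vn\<rangle>\<close>. An element of the Fock space is the sequence of
  its components, encoded as one function on lists: its \<open>n\<close>-th component is the restriction to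
  lists of length \<open>n\<close>.\<close>

type_synonym 'a fvec = "('a \<times> 'a) list \<Rightarrow> complex"

text \<open>A Hilbert basis of the real space is, via \<open>e \<mapsto> (e, 0)\<close>, a complex Hilbert basis of
  the complexification. The lists over it index the Hilbert basis
  \<open>e1 \<otimes> ... \<otimes> en\<close>, \<open>n \<ge> 0\<close>, of the full Fock space.\<close>

definition basis_words :: "('a::real_inner \<times> 'a) list set" where
  "basis_words = lists ((\<lambda>e. (e, 0)) ` some_basis)"

definition fock :: "'a::real_inner fvec set" where
  "fock = {\<Psi>.
     (\<forall>us V W ws. \<Psi> (us @ (V + W) # ws) = \<Psi> (us @ V # ws) + \<Psi> (us @ W # ws)) \<and>
     (\<forall>us c V ws. \<Psi> (us @ cscale c V # ws) = cnj c * \<Psi> (us @ V # ws)) \<and>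
     (\<forall>n. \<exists>C. \<forall>Vs. length Vs = n \<longrightarrow> cmod (\<Psi> Vs) \<le> C * prod_list (map norm Vs)) \<and>
     (\<forall>Vs Ws. mset Vs = mset Ws \<longrightarrow> \<Psi> Vs = \<Psi> Ws) \<and>
     (\<lambda>w. (cmod (\<Psi> w))\<^sup>2) summable_on basis_words}"

definition fock_inner :: "'a::real_inner fvec \<Rightarrow> 'a fvec \<Rightarrow> complex" where
  "fock_inner \<Phi> \<Psi> = (\<Sum>\<^sub>\<infinity>w\<in>basis_words. \<Phi> w * cnj (\<Psi> w))"

definition fock_norm :: "'a::real_inner fvec \<Rightarrow> real" where
  "fock_norm \<Psi> = sqrt (Re (fock_inner \<Psi> \<Psi>))"

text \<open>An operator with domain \<open>D\<close> is given by the pair of \<open>D\<close> and a function \<open>B\<close> of which only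
  the restriction to \<open>D\<close> matters.\<close>

definition linear_operator_on :: "'a::real_inner fvec set \<Rightarrow> ('a fvec \<Rightarrow> 'a fvec) \<Rightarrow> bool" where
  "linear_operator_on D B \<longleftrightarrow>
     D \<subseteq> fock \<and> (\<lambda>_. 0) \<in> D \<and> B ` D \<subseteq> fock \<and>
     (\<forall>\<Phi>\<in>D. \<forall>\<Psi>\<in>D. \<forall>c. (\<lambda>w. c * \<Phi> w + \<Psi> w) \<in> D \<and>
        B (\<lambda>w. c * \<Phi> w + \<Psi> w) = (\<lambda>w. c * B \<Phi> w + B \<Psi> w))"

definition closable :: "'a::real_inner fvec set \<Rightarrow> ('a fvec \<Rightarrow> 'a fvec) \<Rightarrow> bool" where
  "closable D B \<longleftrightarrow>
     (\<forall>u \<Phi>. (\<forall>k::nat. u k \<in> D) \<and> \<Phi> \<in> fock \<and>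
        (\<lambda>k. fock_norm (u k)) \<longlonglongrightarrow> 0 \<and>
        (\<lambda>k. fock_norm (\<lambda>w. B (u k) w - \<Phi> w)) \<longlonglongrightarrow> 0
        \<longrightarrow> \<Phi> = (\<lambda>_. 0))"

text \<open>Extensionality makes two bounded operators equal in HOL as soon as they agree
  on the Fock space.\<close>

definition bounded_operator :: "('a::real_inner fvec \<Rightarrow> 'a fvec) \<Rightarrow> bool" where
  "bounded_operator B \<longleftrightarrow> B \<in> extensional fock \<and> linear_operator_on fock B \<and>
     (\<exists>C. \<forall>\<Psi>\<in>fock. fock_norm (B \<Psi>) \<le> C * fock_norm \<Psi>)"

definition operator_norm :: "('a::real_inner fvec \<Rightarrow> 'a fvec) \<Rightarrow> real" where
  "operator_norm B = (SUP \<Psi>\<in>fock. fock_norm (B \<Psi>) / fock_norm \<Psi>)"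


section \<open>Second quantization and Segal field\<close>

text \<open>On \<open>n\<close> particles, the sum over \<open>j\<close> of \<open>I \<otimes> ... \<otimes> A \<otimes> ... \<otimes> I\<close>, with \<open>A\<close> in position \<open>j\<close>.
  Since forms are evaluated by pairing with \<open>W1 \<otimes> ... \<otimes> Wn\<close>, the adjoint of \<open>A\<close> acts on \<open>Wj\<close>.\<close>

definition dGamma :: "('a::real_inner \<Rightarrow> 'a) \<Rightarrow> 'a fvec \<Rightarrow> 'a fvec" where
  "dGamma A \<Psi> = (\<lambda>Ws. \<Sum>j<length Ws. \<Psi> (Ws[j := cextend (adjoint A) (Ws ! j)]))"

definition dGamma_dom :: "('a::real_inner \<Rightarrow> 'a) \<Rightarrow> 'a fvec set" where
  "dGamma_dom A = {\<Psi>\<in>fock. dGamma A \<Psi> \<in> fock}"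

definition number_op :: "'a::real_inner fvec \<Rightarrow> 'a fvec" where
  "number_op = dGamma (\<lambda>x. x)"

definition number_power_dom :: "nat \<Rightarrow> 'a::real_inner fvec set" where
  "number_power_dom m = {\<Psi>. \<forall>k\<le>m. (number_op ^^ k) \<Psi> \<in> fock}"

text \<open>Normalization: \<open>annihilation V\<close> maps the power \<open>X \<otimes> ... \<otimes> X\<close> with \<open>n + 1\<close> factors to
  \<open>sqrt (n + 1) \<langle>X, V\<rangle>\<close> times the one with \<open>n\<close> factors, and \<open>creation V\<close> maps a symmetric tensor
  \<open>u\<close> of order \<open>n - 1\<close> to \<open>sqrt n\<close> times the symmetrization of \<open>V \<otimes> u\<close>.\<close>

definition annihilation :: "'a::real_inner \<times> 'a \<Rightarrow> 'a fvec \<Rightarrow> 'a fvec" where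
  "annihilation V \<Psi> = (\<lambda>Ws. of_real (sqrt (real (length Ws + 1))) * \<Psi> (V # Ws))"

definition creation :: "'a::real_inner \<times> 'a \<Rightarrow> 'a fvec \<Rightarrow> 'a fvec" where
  "creation V \<Psi> = (\<lambda>Ws. of_real (1 / sqrt (real (length Ws))) *
     (\<Sum>j<length Ws. cinner V (Ws ! j) * \<Psi> (take j Ws @ drop (Suc j) Ws)))"

definition segal :: "'a::real_inner \<times> 'a \<Rightarrow> 'a fvec \<Rightarrow> 'a fvec" where
  "segal V \<Psi> = (\<lambda>Ws. (annihilation V \<Psi> Ws + creation V \<Psi> Ws) / of_real (sqrt 2))"

definition segal_dom :: "'a::real_inner \<times> 'a \<Rightarrow> 'a fvec set" where
  "segal_dom V = {\<Psi>\<in>fock. annihilation V \<Psi> \<in> fock \<and> creation V \<Psi> \<in> fock}"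


section \<open>Coherent states and Wick symbols\<close>

definition coherent :: "real \<Rightarrow> 'a::real_inner \<times> 'a \<Rightarrow> 'a fvec" where
  "coherent h X = (\<lambda>Vs.
     of_real (exp (- (norm X)\<^sup>2 / (4 * h)) /
       ((2 * h) powr (real (length Vs) / 2) * sqrt (fact (length Vs)))) *
     (\<Prod>V\<leftarrow>Vs. cinner X V))"

definition wick_symbol :: "real \<Rightarrow> ('a::real_inner fvec \<Rightarrow> 'a fvec) \<Rightarrow> 'a \<times> 'a \<Rightarrow> complex" where
  "wick_symbol h B X = fock_inner (B (coherent h X)) (coherent h X)"

text \<open>The operator with domain \<open>D\<close> given by \<open>B\<close> has a Wick symbol, and it is \<open>F\<close>.\<close>

definition has_wick_symbol ::
  "real \<Rightarrow> 'a::real_inner fvec set \<Rightarrow> ('a fvec \<Rightarrow> 'a fvec) \<Rightarrow> ('a \<times> 'a \<Rightarrow> complex) \<Rightarrow> bool" where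
  "has_wick_symbol h D B F \<longleftrightarrow> (\<forall>X. coherent h X \<in> D) \<and> wick_symbol h B = F"

definition op_wick :: "real \<Rightarrow> ('a::real_inner \<times> 'a \<Rightarrow> complex) \<Rightarrow> 'a fvec \<Rightarrow> 'a fvec" where
  "op_wick h F = (THE B. bounded_operator B \<and> has_wick_symbol h fock B F)"

end

theory Submission
  imports Defs "HOL-Probability.Probability" "HOL-Complex_Analysis.Complex_Analysis"
begin

text \<open>
A bounded operator is determined by its Wick symbol because the sesquilinear form
\<open>\<langle>B e\<^sub>X, e\<^sub>Y\<rangle>\<close> on unnormalized coherent states is antiholomorphic in \<open>Y\<close> and holomorphic in \<open>X\<close>, hence
determined by its diagonal, and because the coherent states are total.

For existence, the Wick symbol of the anti-Wick quantization of \<open>G\<close> is the heat evolution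
\<open>exp ((h/2) \<Delta>) G\<close>, and the anti-Wick quantization has norm at most \<open>sup \<bar>G\<bar>\<close>; so one quantizes
\<open>G = exp (- (h/2) \<Delta>) F\<close>. The power series of this operator converges on \<open>S(H\<^sup>2, Q)\<close>, with
\<open>sup \<bar>G\<bar> \<le> \<parallel>F\<parallel> exp ((h/2) \<Sigma> Q(e\<^sub>j))\<close>. To avoid measures on an infinite dimensional space, \<open>F\<close> is
first composed with projections onto finite dimensional complex subspaces \<open>V\<close>, for which the sum
is a partial trace of \<open>A\<^sub>Q\<close>, and the resulting forms, which are uniformly bounded, have a cluster
point along the directed set of the \<open>V\<close>.

For polynomial symbols, Wick ordering works since coherent states are eigenvectors of the
annihilation operators. Convergence in the Fock space implies pointwise convergence of the forms,
for which creation and annihilation are continuous; hence the operators are closable.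
\<close>

section \<open>Hilbert bases and traces\<close>

text \<open>The obstacle is a bound that does not see the dimension. On a complex subspace V the
  unnormalized coherent vectors, integrated against the Gaussian of variance h, satisfy a Bessel
  inequality, because the density cancels their squared norm \<open>exp (|Z|^2/(2h))\<close>; so
  anti-Wick quantization costs only the supremum of its symbol. Inverting the heat flow costs
  \<open>exp ((h/2) Q(e))\<close> per direction, as each pair of derivatives along e is bounded by
  Q(e), and over a real orthonormal basis of V this multiplies up to the exponential of h/2 times a
  partial trace. For fixed V the diagonal on unnormalized coherent vectors is
  \<open>exp (|PX|^2/(2h)) F(PX)\<close>, with P the projection onto V, so it is correct only in the
  limit. Nothing is known about convergence off the diagonal; compactness supplies a limit form,
  whose diagonal is then forced. The trace class condition speaks of an absolute value of A_Q.
  Diagonal sums of A_Q itself become available once the two are identified, which is the uniqueness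
  of nonnegative square roots.\<close>

lemma has_sum_finite_sum:
  fixes f :: "'i \<Rightarrow> 'x \<Rightarrow> 'b::{topological_comm_monoid_add, t2_space}"
  assumes "\<And>i. i \<in> I \<Longrightarrow> (f i has_sum s i) A"
  shows "((\<lambda>x. \<Sum>i\<in>I. f i x) has_sum (\<Sum>i\<in>I. s i)) A"
  using assms by (induction I rule: infinite_finite_induct) (auto intro: has_sum_add)

lemma has_sum_diff:
  fixes f g :: "'i \<Rightarrow> 'b::real_normed_vector"
  assumes "(f has_sum a) A" "(g has_sum b) A"
  shows "((\<lambda>x. f x - g x) has_sum a - b) A"
proof -
  have "((\<lambda>x. - g x) has_sum - b) A" using assms(2) by (simp add: has_sum_uminus)
  from has_sum_add[OF assms(1) this] show ?thesis by simp
qed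

section \<open>Orthonormal sets and expansions in a Hilbert basis\<close>

definition orthonormal :: "'a::real_inner set \<Rightarrow> bool" where
  "orthonormal S \<longleftrightarrow> (\<forall>e\<in>S. norm e = 1) \<and> pairwise orthogonal S"

lemma orthonormal_inner:
  assumes "orthonormal S" "d \<in> S" "e \<in> S"
  shows "d \<bullet> e = (if d = e then 1 else 0)"
  using assms by (auto simp: orthonormal_def pairwise_def orthogonal_def norm_eq_1)

lemma orthonormal_sum_inner:
  assumes "orthonormal S" "finite T" "T \<subseteq> S" "d \<in> S"
  shows "(\<Sum>e\<in>T. r e *\<^sub>R e) \<bullet> d = (if d \<in> T then r d else 0)"
proof -
  have "(\<Sum>e\<in>T. r e *\<^sub>R e) \<bullet> d = (\<Sum>e\<in>T. if e = d then r e else 0)"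
    unfolding inner_sum_left
    by (rule sum.cong) (use assms orthonormal_inner[OF assms(1)] in \<open>auto simp: subset_iff\<close>)
  then show ?thesis using assms by simp
qed

lemma orthonormal_extend:
  fixes S :: "'a::real_inner set"
  assumes "finite S" "orthonormal S"
  shows "\<exists>T. finite T \<and> S \<subseteq> T \<and> orthonormal T \<and> x \<in> span T"
proof (cases "x \<in> span S")
  case True
  then show ?thesis using assms by blast
next
  case False
  define p where "p = (\<Sum>e\<in>S. (x \<bullet> e) *\<^sub>R e)"
  define y where "y = x - p"
  have p: "p \<in> span S"
    unfolding p_def by (intro span_sum span_scale span_base)
  have y0: "y \<noteq> 0" using False p y_def by auto
  have orth: "y \<bullet> e = 0" if "e \<in> S" for e
    using orthonormal_sum_inner[OF assms(2,1) subset_refl that, of "\<lambda>e. x \<bullet> e"] that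
    by (simp add: y_def p_def inner_diff_left)
  define T where "T = insert (y /\<^sub>R norm y) S"
  have "orthonormal T"
    using assms(2) y0 orth unfolding orthonormal_def T_def
    by (auto simp: pairwise_insert orthogonal_def inner_commute)
  moreover have "x \<in> span T"
  proof -
    have "y /\<^sub>R norm y \<in> span T" unfolding T_def by (simp add: span_base)
    then have "norm y *\<^sub>R (y /\<^sub>R norm y) \<in> span T" by (rule span_scale)
    then have "y \<in> span T" using y0 by simp
    moreover have "p \<in> span T" using p span_mono[of S T] by (auto simp: T_def)
    ultimately have "y + p \<in> span T" by (rule span_add)
    then show ?thesis by (simp add: y_def)
  qed
  ultimately show ?thesis using assms(1) by (intro exI[of _ T]) (auto simp: T_def)
qed

text \<open>Gram-Schmidt along a dense sequence. The finite orthonormal sets increase, so any two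
  vectors of the union lie in a common one, and the span of the union contains the dense
  set.\<close>

lemma hilbert_basis_exists:
  "\<exists>E :: 'a::{real_inner, second_countable_topology} set. hilbert_basis E"
proof -
  obtain D :: "'a set" where D: "countable D" "\<And>X. open X \<Longrightarrow> X \<noteq> {} \<Longrightarrow> \<exists>d\<in>D. d \<in> X"
    using countable_dense_exists by blast
  then have D0: "D \<noteq> {}" by (metis UNIV_not_empty empty_iff open_UNIV)
  define d where "d = from_nat_into D"
  have "\<exists>T. \<forall>n. (finite (T n) \<and> orthonormal (T n)) \<and> (T n \<subseteq> T (Suc n) \<and> d n \<in> span (T (Suc n)))"
  proof (rule dependent_nat_choice)
    show "\<exists>T::'a set. finite T \<and> orthonormal T"
      by (rule exI[of _ "{}"]) (simp add: orthonormal_def)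
  qed (use orthonormal_extend in blast)
  then obtain T where T: "\<And>n. finite (T n)" "\<And>n. orthonormal (T n)" "\<And>n. T n \<subseteq> T (Suc n)"
    "\<And>n. d n \<in> span (T (Suc n))" by blast
  define E where "E = (\<Union>n. T n)"
  have mono: "T m \<subseteq> T n" if "m \<le> n" for m n
    using lift_Suc_mono_le[of T] T(3) that by blast
  have "orthonormal E"
    unfolding orthonormal_def
  proof
    show "\<forall>e\<in>E. norm e = 1" using T(2) by (auto simp: E_def orthonormal_def)
    show "pairwise orthogonal E"
      unfolding pairwise_def
    proof (intro ballI impI)
      fix x y assume "x \<in> E" "y \<in> E" "x \<noteq> y"
      then obtain m n where "x \<in> T m" "y \<in> T n" by (auto simp: E_def)
      then have "x \<in> T (max m n)" "y \<in> T (max m n)"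
        using mono[of m "max m n"] mono[of n "max m n"] by auto
      then show "orthogonal x y" using T(2)[of "max m n"] \<open>x \<noteq> y\<close>
        by (auto simp: orthonormal_def pairwise_def)
    qed
  qed
  moreover have "closure (span E) = UNIV"
  proof -
    have "D \<subseteq> span E"
    proof
      fix x assume "x \<in> D"
      then obtain n where "x = d n" using from_nat_into_surj[OF D(1)] d_def by metis
      then show "x \<in> span E" using T(4)[of n] span_mono[of "T (Suc n)" E] by (auto simp: E_def)
    qed
    moreover have "closure D = UNIV"
      by (rule ccontr) (metis Compl_eq_Diff_UNIV D(2) Diff_eq_empty_iff closed_closure closure_subset
          ComplD in_mono open_Compl top.extremum_unique)
    ultimately show ?thesis by (metis closure_mono top.extremum_unique)
  qed
  ultimately show ?thesis by (auto simp: hilbert_basis_def orthonormal_def)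
qed

lemma hilbert_basis_some:
  "hilbert_basis (some_basis :: 'a::{real_inner, second_countable_topology} set)"
  unfolding some_basis_def by (rule someI_ex) (rule hilbert_basis_exists)

lemma hilbert_basis_orthonormal: "hilbert_basis E \<Longrightarrow> orthonormal E"
  by (simp add: hilbert_basis_def orthonormal_def)

text \<open>The partial sum over \<open>Y\<close> is the orthogonal projection of \<open>x\<close>
  onto the span of \<open>Y\<close>. By Pythagoras it is at least as close to \<open>x\<close> as
  any approximant \<open>y\<close> whose support \<open>t\<close> is contained in
  \<open>Y\<close>.\<close>

lemma hilbert_basis_expansion:
  assumes "hilbert_basis E"
  shows "((\<lambda>e. (x \<bullet> e) *\<^sub>R e) has_sum x) E"
  unfolding has_sum_def
proof (rule tendstoI)
  fix \<epsilon> :: real assume "\<epsilon> > 0"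
  have on: "orthonormal E" using assms by (rule hilbert_basis_orthonormal)
  obtain y where y: "y \<in> span E" "dist y x < \<epsilon>"
    using assms \<open>\<epsilon> > 0\<close> unfolding hilbert_basis_def
    by (metis UNIV_I closure_approachable)
  obtain t r where t: "finite t" "t \<subseteq> E" "y = (\<Sum>a\<in>t. r a *\<^sub>R a)"
    using y(1) unfolding span_explicit by blast
  have "dist (\<Sum>e\<in>Y. (x \<bullet> e) *\<^sub>R e) x < \<epsilon>" if Y: "finite Y" "t \<subseteq> Y" "Y \<subseteq> E" for Y
  proof -
    define p where "p = (\<Sum>e\<in>Y. (x \<bullet> e) *\<^sub>R e)"
    define r' where "r' = (\<lambda>a. if a \<in> t then r a else 0)"
    have "y = (\<Sum>a\<in>Y. r' a *\<^sub>R a)"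
      unfolding t(3) r'_def by (rule sum.mono_neutral_cong_left) (use Y in auto)
    then have v: "p - y = (\<Sum>a\<in>Y. (x \<bullet> a - r' a) *\<^sub>R a)"
      by (simp add: p_def sum_subtractf scaleR_left_diff_distrib)
    have "(x - p) \<bullet> a = 0" if "a \<in> Y" for a
      using orthonormal_sum_inner[OF on Y(1,3), of a "\<lambda>e. x \<bullet> e"] that Y(3)
      by (auto simp: p_def inner_diff_left)
    then have "(x - p) \<bullet> (p - y) = 0"
      unfolding v inner_sum_right by simp
    then have "(norm (x - p))\<^sup>2 \<le> (norm ((x - p) + (p - y)))\<^sup>2"
      by (subst norm_add_Pythagorean) (simp_all add: orthogonal_def)
    then have "norm (x - p) \<le> norm (x - y)"
      by (metis abs_le_square_iff abs_norm_cancel diff_add_cancel add.commute add_diff_eq)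
    then show ?thesis using y(2) by (simp add: dist_norm norm_minus_commute p_def)
  qed
  then show "\<forall>\<^sub>F Y in finite_subsets_at_top E. dist (\<Sum>e\<in>Y. (x \<bullet> e) *\<^sub>R e) x < \<epsilon>"
    unfolding eventually_finite_subsets_at_top using t(1,2) by blast
qed

lemma hilbert_basis_parseval:
  assumes "hilbert_basis E"
  shows "((\<lambda>e. (x \<bullet> e) * (y \<bullet> e)) has_sum x \<bullet> y) E"
  using has_sum_bounded_linear[OF bounded_linear_inner_left[of y] hilbert_basis_expansion[OF assms, of x]]
  by (simp add: o_def inner_commute)

text \<open>Cyclicity of the trace in disguise: for the projection \<open>\<Pi>\<close> onto the span of \<open>F\<close>, the
  sum over the basis of \<open>2 A \<Pi> e \<bullet> e - A \<Pi> e \<bullet> \<Pi> e\<close> is the trace of \<open>A\<close> over \<open>F\<close>, and each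
  summand is at most \<open>A e \<bullet> e\<close>.\<close>

lemma trace_orthonormal_le:
  assumes E: "hilbert_basis E" and A: "selfadjoint_op A" "nonneg_op A"
    and summable: "(\<lambda>e. A e \<bullet> e) summable_on E"
    and F: "finite F" "orthonormal F"
  shows "(\<Sum>f\<in>F. A f \<bullet> f) \<le> (\<Sum>\<^sub>\<infinity>e\<in>E. A e \<bullet> e)"
proof -
  interpret A: bounded_linear A using A(1) by (simp add: selfadjoint_op_def)
  have sym: "A x \<bullet> y = x \<bullet> A y" for x y using A(1) by (simp add: selfadjoint_op_def)
  define p where "p x = (\<Sum>f\<in>F. (x \<bullet> f) *\<^sub>R f)" for x
  have Ap: "A (p e) = (\<Sum>f\<in>F. (e \<bullet> f) *\<^sub>R A f)" for e
    by (simp add: p_def A.sum A.scaleR)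
  have "((\<lambda>e. \<Sum>f\<in>F. (f \<bullet> e) * (A f \<bullet> e)) has_sum (\<Sum>f\<in>F. f \<bullet> A f)) E"
    by (intro has_sum_finite_sum hilbert_basis_parseval[OF E])
  then have s1: "((\<lambda>e. A (p e) \<bullet> e) has_sum (\<Sum>f\<in>F. A f \<bullet> f)) E"
    unfolding Ap inner_sum_left inner_scaleR_left by (simp add: inner_commute)
  have "((\<lambda>e. \<Sum>f\<in>F. \<Sum>g\<in>F. ((f \<bullet> e) * (g \<bullet> e)) * (A f \<bullet> g)) has_sum
      (\<Sum>f\<in>F. \<Sum>g\<in>F. (f \<bullet> g) * (A f \<bullet> g))) E"
    by (intro has_sum_finite_sum has_sum_cmult_left hilbert_basis_parseval[OF E])
  moreover have "(\<Sum>g\<in>F. (f \<bullet> g) * (A f \<bullet> g)) = A f \<bullet> f" if "f \<in> F" for f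
  proof -
    have "(\<Sum>g\<in>F. (f \<bullet> g) * (A f \<bullet> g)) = (\<Sum>g\<in>F. if f = g then A f \<bullet> g else 0)"
      by (rule sum.cong) (use orthonormal_inner[OF F(2)] that in auto)
    then show ?thesis using that F(1) by simp
  qed
  ultimately have s2: "((\<lambda>e. A (p e) \<bullet> p e) has_sum (\<Sum>f\<in>F. A f \<bullet> f)) E"
    unfolding Ap by (simp add: p_def inner_sum_left inner_sum_right inner_commute mult_ac sum_distrib_left)
  have s3: "((\<lambda>e. 2 * (A (p e) \<bullet> e) - A (p e) \<bullet> p e) has_sum
     (2 * (\<Sum>f\<in>F. A f \<bullet> f) - (\<Sum>f\<in>F. A f \<bullet> f))) E"
    by (intro has_sum_diff has_sum_cmult_right s1 s2)
  have le: "2 * (A (p e) \<bullet> e) - A (p e) \<bullet> p e \<le> A e \<bullet> e" for e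
  proof -
    have "0 \<le> A (e - p e) \<bullet> (e - p e)" using A(2) by (simp add: nonneg_op_def)
    then show ?thesis
      using sym[of e "p e"] by (simp add: A.diff inner_diff_left inner_diff_right inner_commute)
  qed
  show ?thesis
    using has_sum_mono[OF s3 has_sum_infsum[OF summable]] le by simp
qed

text \<open>With \<open>D = A - P\<close> and \<open>S = A + P\<close>, equality of the squares gives \<open>D x \<bullet> S x = 0\<close>. On an
  approximate eigenvector \<open>v\<close> of \<open>D\<close> for the extreme value \<open>\<mu>\<close> of its quadratic form this makes
  \<open>\<mu> (S v \<bullet> v)\<close> small, although \<open>S v \<bullet> v \<ge> \<bar>D v \<bullet> v\<bar>\<close>.\<close>

lemma nonneg_square_root_unique:
  assumes A: "selfadjoint_op A" "nonneg_op A" and P: "selfadjoint_op P" "nonneg_op P"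
    and AP: "\<And>x y. P x \<bullet> P y = A x \<bullet> A y"
  shows "A = P"
proof (rule ccontr)
  assume ne: "A \<noteq> P"
  have blA: "bounded_linear A" and blP: "bounded_linear P"
    using A P by (auto simp: selfadjoint_op_def)
  define D where "D x = A x - P x" for x
  define S where "S x = A x + P x" for x
  have blD: "bounded_linear D" and blS: "bounded_linear S"
    unfolding D_def S_def by (auto intro: bounded_linear_sub bounded_linear_add blA blP)
  interpret D: bounded_linear D by fact
  interpret S: bounded_linear S by fact
  have Dsym: "D x \<bullet> y = x \<bullet> D y" for x y
    using A(1) P(1) by (simp add: selfadjoint_op_def D_def inner_diff_left inner_diff_right)
  have DS: "D x \<bullet> S x = 0" for x
    using AP[of x x] by (simp add: D_def S_def inner_diff_left inner_diff_right inner_add_right inner_commute)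
  have dom: "\<bar>D x \<bullet> x\<bar> \<le> S x \<bullet> x" for x
    using A(2) P(2) by (simp add: nonneg_op_def D_def S_def inner_diff_left inner_add_left abs_le_iff)
  \<comment> \<open>Polarization for the symmetric \<open>D\<close>: a vanishing quadratic form
    forces \<open>D = 0\<close>, and the norm of \<open>D\<close> is controlled by the extreme value
    \<open>M\<close> of the form.\<close>
  have four: "4 * (D x \<bullet> y) = D (x + y) \<bullet> (x + y) - D (x - y) \<bullet> (x - y)" for x y
    using Dsym[of x y] by (simp add: D.add D.diff algebra_simps inner_diff_left inner_diff_right
        inner_add_left inner_add_right inner_commute)
  have "\<exists>x. D x \<bullet> x \<noteq> 0"
  proof (rule ccontr)
    assume "\<not> (\<exists>x. D x \<bullet> x \<noteq> 0)"
    then have "D x \<bullet> D x = 0" for x using four[of x "D x"] by simp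
    then show False using ne by (auto simp: D_def fun_eq_iff)
  qed
  then obtain x0 where x0: "D x0 \<bullet> x0 \<noteq> 0" by blast
  then have x00: "x0 \<noteq> 0" by auto
  define M where "M = (SUP x\<in>sphere 0 1. \<bar>D x \<bullet> x\<bar>)"
  obtain K where K: "\<And>x. norm (D x) \<le> norm x * K" using D.bounded by blast
  obtain L where L: "\<And>x. norm (S x) \<le> norm x * L" using S.bounded by blast
  have bdd: "bdd_above ((\<lambda>x. \<bar>D x \<bullet> x\<bar>) ` sphere 0 1)"
  proof (rule bdd_aboveI2)
    fix x :: 'a assume "x \<in> sphere 0 1"
    then have "\<bar>D x \<bullet> x\<bar> \<le> norm (D x)" using Cauchy_Schwarz_ineq2[of "D x" x] by simp
    also have "\<dots> \<le> K" using K[of x] \<open>x \<in> sphere 0 1\<close> by simp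
    finally show "\<bar>D x \<bullet> x\<bar> \<le> K" .
  qed
  have MD: "\<bar>D x \<bullet> x\<bar> \<le> M * (norm x)\<^sup>2" for x
  proof (cases "x = 0")
    case False
    have "\<bar>D (x /\<^sub>R norm x) \<bullet> (x /\<^sub>R norm x)\<bar> \<le> M"
      unfolding M_def by (rule cSUP_upper[OF _ bdd]) (use False in simp)
    then have "\<bar>D x \<bullet> x\<bar> / (norm x)\<^sup>2 \<le> M"
      by (simp add: D.scaleR abs_mult power2_eq_square field_simps)
    then show ?thesis using False by (simp add: field_simps)
  qed (simp add: D.zero)
  have Mpos: "M > 0"
  proof -
    have "0 < \<bar>D x0 \<bullet> x0\<bar>" using x0 by simp
    also have "\<dots> \<le> M * (norm x0)\<^sup>2" by (rule MD)
    finally show ?thesis using x00 by (simp add: zero_less_mult_iff)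
  qed
  have DM: "norm (D x) \<le> M * norm x" for x
  proof (cases "D x = 0 \<or> x = 0")
    case False
    \<comment> \<open>In the direction of \<open>D x\<close>, so that \<open>D x \<bullet> y\<close>
      is the product of the norms, and of the same length as \<open>x\<close>, so that the
      parallelogram law bounds the polarized form by \<open>4 M |x|^2\<close>.\<close>
    define y where "y = (norm x / norm (D x)) *\<^sub>R D x"
    have ny: "norm y = norm x" using False by (simp add: y_def)
    have "4 * (D x \<bullet> y) \<le> M * (norm (x + y))\<^sup>2 + M * (norm (x - y))\<^sup>2"
      using MD[of "x + y"] MD[of "x - y"] unfolding four by linarith
    also have "\<dots> = M * (2 * (norm x)\<^sup>2 + 2 * (norm y)\<^sup>2)"
      by (simp add: power2_norm_eq_inner algebra_simps inner_diff_left inner_diff_right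
        inner_add_left inner_add_right inner_commute)
    finally have "D x \<bullet> y \<le> M * (norm x)\<^sup>2" by (simp add: ny algebra_simps)
    moreover have "D x \<bullet> y = norm x * norm (D x)"
      using False by (simp add: y_def power2_norm_eq_inner[symmetric] power2_eq_square)
    ultimately show ?thesis using False by (simp add: power2_eq_square)
  qed (use Mpos in \<open>auto simp: D.zero\<close>)
  \<comment> \<open>The first bound keeps \<open>M - \<epsilon>\<close> above \<open>M / 2\<close>;
    the second makes \<open>2 M \<epsilon> L^2\<close> smaller than \<open>M^4 / 4\<close>, the
    square of \<open>M (M / 2)\<close>, which is the final contradiction.\<close>
  define \<epsilon> where "\<epsilon> = min (M / 2) (M ^ 3 / (8 * L\<^sup>2 + 8))"
  have e: "\<epsilon> > 0" "\<epsilon> \<le> M / 2" "\<epsilon> \<le> M ^ 3 / (8 * L\<^sup>2 + 8)"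
    using Mpos by (simp_all only: \<epsilon>_def min.cobounded1 min.cobounded2)
      (simp add: add_nonneg_pos)
  have "\<exists>v\<in>sphere 0 1. M - \<epsilon> < \<bar>D v \<bullet> v\<bar>"
  proof -
    have "(x0 /\<^sub>R norm x0) \<in> sphere 0 1" using x00 by simp
    then have "sphere (0::'a) 1 \<noteq> {}" by blast
    then show ?thesis using less_cSUP_iff[OF _ bdd, of "M - \<epsilon>"] e Mpos by (simp add: M_def[symmetric])
  qed
  then obtain v where v: "norm v = 1" "M - \<epsilon> < \<bar>D v \<bullet> v\<bar>" by auto
  define \<mu> where "\<mu> = (if D v \<bullet> v \<ge> 0 then M else - M)"
  have l: "\<mu> * (D v \<bullet> v) = M * \<bar>D v \<bullet> v\<bar>" "\<mu>\<^sup>2 = M\<^sup>2" "\<bar>\<mu>\<bar> = M"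
    using Mpos by (auto simp: \<mu>_def)
  have "(norm (D v - \<mu> *\<^sub>R v))\<^sup>2 = (norm (D v))\<^sup>2 - 2 * (\<mu> * (D v \<bullet> v)) + \<mu>\<^sup>2 * (norm v)\<^sup>2"
    unfolding power2_norm_eq_inner
    by (simp add: inner_diff_left inner_diff_right inner_commute power2_eq_square algebra_simps)
  also have "\<dots> \<le> M\<^sup>2 - 2 * (M * \<bar>D v \<bullet> v\<bar>) + M\<^sup>2"
    using DM[of v] power_mono[of "norm (D v)" M 2] v(1) l by simp
  also have "\<dots> \<le> 2 * M * \<epsilon>"
    using mult_left_mono[of "M - \<epsilon>" "\<bar>D v \<bullet> v\<bar>" "2 * M"] v(2) Mpos
    by (simp add: power2_eq_square algebra_simps)
  finally have sq: "(norm (D v - \<mu> *\<^sub>R v))\<^sup>2 \<le> 2 * M * \<epsilon>" .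
  have "\<mu> * (v \<bullet> S v) = - ((D v - \<mu> *\<^sub>R v) \<bullet> S v)"
    using DS[of v] by (simp add: inner_diff_left)
  then have "M * \<bar>v \<bullet> S v\<bar> = \<bar>(D v - \<mu> *\<^sub>R v) \<bullet> S v\<bar>"
    using l(3) by (metis abs_minus_cancel abs_mult)
  also have "\<dots> \<le> norm (D v - \<mu> *\<^sub>R v) * L"
    using Cauchy_Schwarz_ineq2[of "D v - \<mu> *\<^sub>R v" "S v"] L[of v] v(1)
      mult_left_mono[of "norm (S v)" L "norm (D v - \<mu> *\<^sub>R v)"] by simp
  finally have "M * \<bar>v \<bullet> S v\<bar> \<le> norm (D v - \<mu> *\<^sub>R v) * L" .
  moreover have "M - \<epsilon> \<le> \<bar>v \<bullet> S v\<bar>"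
    using dom[of v] v(2) inner_commute[of v "S v"] by linarith
  ultimately have "M * (M - \<epsilon>) \<le> norm (D v - \<mu> *\<^sub>R v) * L"
    using mult_left_mono[of "M - \<epsilon>" "\<bar>v \<bullet> S v\<bar>" M] Mpos by linarith
  then have "M * (M / 2) \<le> norm (D v - \<mu> *\<^sub>R v) * L"
    using e(2) Mpos mult_left_mono[of "M / 2" "M - \<epsilon>" M] by linarith
  then have "(M * (M / 2))\<^sup>2 \<le> (norm (D v - \<mu> *\<^sub>R v) * L)\<^sup>2"
    using Mpos by (intro power_mono) auto
  also have "\<dots> \<le> (2 * M * \<epsilon>) * L\<^sup>2"
    unfolding power_mult_distrib by (intro mult_right_mono sq) auto
  also have "\<dots> \<le> (2 * M * (M ^ 3 / (8 * L\<^sup>2 + 8))) * L\<^sup>2"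
    using e(3) Mpos by (intro mult_right_mono mult_left_mono) auto
  also have "\<dots> = M ^ 4 / 4 * (L\<^sup>2 / (L\<^sup>2 + 1))"
    by (simp add: field_simps power_numeral_reduce add_nonneg_eq_0_iff)
  also have "\<dots> < M ^ 4 / 4 * 1"
    using Mpos by (intro mult_strict_left_mono) (auto simp: divide_less_eq_1 add_nonneg_pos)
  finally show False by (simp add: power_numeral_reduce)
qed

text \<open>The definition sums the diagonal of an absolute value \<open>P\<close>; a nonnegative
  selfadjoint \<open>A\<close> is its own absolute value.\<close>

lemma trace_class_summable:
  assumes "selfadjoint_op A" "nonneg_op A" "trace_class A"
  shows "(\<lambda>e. A e \<bullet> e) summable_on some_basis"
proof -
  obtain P where P: "selfadjoint_op P" "nonneg_op P" "\<forall>x y. P x \<bullet> P y = A x \<bullet> A y"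
    "(\<lambda>e. P e \<bullet> e) summable_on some_basis"
    using assms(3) unfolding trace_class_def by blast
  then have "A = P" using nonneg_square_root_unique assms by blast
  with P(4) show ?thesis by simp
qed

section \<open>The complexification\<close>

lemma cinner_simps:
  "cinner (U + V) W = cinner U W + cinner V W"
  "cinner W (U + V) = cinner W U + cinner W V"
  "cinner (cscale c V) W = c * cinner V W"
  "cinner V (cscale c W) = cnj c * cinner V W"
  by (auto simp: cinner_def cscale_def complex_eq_iff inner_add_left inner_add_right
      inner_diff_left inner_diff_right algebra_simps)

lemma cinner_commute: "cinner V W = cnj (cinner W V)"
  by (auto simp: cinner_def complex_eq_iff inner_commute)

lemma Re_cinner: "Re (cinner V W) = V \<bullet> W"
  by (simp add: cinner_def inner_prod_def)

lemma cinner_self: "cinner V V = of_real ((norm V)\<^sup>2)"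
  by (simp add: cinner_def complex_eq_iff power2_norm_eq_inner inner_prod_def inner_commute)

lemma norm_cscale: "norm (cscale c V) = cmod c * norm V"
proof -
  have "of_real ((norm (cscale c V))\<^sup>2) = (of_real ((cmod c * norm V)\<^sup>2) :: complex)"
    unfolding cinner_self[symmetric] cinner_simps
    by (simp only: cinner_self power_mult_distrib of_real_mult complex_norm_square mult_ac)
  then have "(norm (cscale c V))\<^sup>2 = (cmod c * norm V)\<^sup>2" using of_real_eq_iff by blast
  then show ?thesis by simp
qed

lemma scaleR_eq_cscale: "r *\<^sub>R V = cscale (of_real r) V"
  by (simp add: cscale_def prod_eq_iff)

text \<open>Rotating \<open>V\<close> by the unit scalar \<open>u\<close> makes the product real and
  nonnegative, and the real Cauchy-Schwarz inequality applies.\<close>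

lemma norm_cinner_le: "cmod (cinner V W) \<le> norm V * norm W"
proof (cases "cinner V W = 0")
  case False
  define u where "u = cnj (sgn (cinner V W))"
  have u: "cmod u = 1" using False by (simp add: u_def norm_sgn)
  have "u * cinner V W = of_real (cmod (cinner V W))"
    using False by (simp add: u_def sgn_eq field_simps complex_norm_square[symmetric] power2_eq_square)
  then have "cmod (cinner V W) = Re (cinner (cscale u V) W)" by (simp add: cinner_simps)
  also have "\<dots> \<le> norm (cscale u V) * norm W" unfolding Re_cinner by (rule norm_cauchy_schwarz)
  finally show ?thesis by (simp add: norm_cscale u)
qed simp

lemma cinner_expansion:
  fixes V :: "'a::{real_inner, second_countable_topology} \<times> 'a"
  shows "((\<lambda>e. cscale (cinner V (e, 0)) (e, 0)) has_sum V) some_basis"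
proof -
  have l: "bounded_linear (\<lambda>x::'a. (x, 0::'a))" "bounded_linear (\<lambda>x::'a. (0::'a, x))"
    by (intro bounded_linear_Pair bounded_linear_ident bounded_linear_zero)+
  have "((\<lambda>e. ((fst V \<bullet> e) *\<^sub>R e, 0) + (0, (snd V \<bullet> e) *\<^sub>R e)) has_sum ((fst V, 0) + (0, snd V))) some_basis"
    using has_sum_add[OF
        has_sum_bounded_linear[OF l(1) hilbert_basis_expansion[OF hilbert_basis_some, of "fst V"]]
        has_sum_bounded_linear[OF l(2) hilbert_basis_expansion[OF hilbert_basis_some, of "snd V"]]]
    by (simp add: o_def)
  then show ?thesis by (simp add: cscale_def cinner_def)
qed

text \<open>Formulated for antilinear functions because the elements of the Fock space are
  antilinear in every slot. The choice \<open>f = cinner V\<close> gives Parseval's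
  identity.\<close>

lemma antilinear_expansion:
  fixes f :: "'a::{real_inner, second_countable_topology} \<times> 'a \<Rightarrow> complex"
  assumes add: "\<And>V W. f (V + W) = f V + f W" and scale: "\<And>c V. f (cscale c V) = cnj c * f V"
    and bound: "\<And>V. cmod (f V) \<le> C * norm V"
  shows "((\<lambda>e. cnj (cinner V (e, 0)) * f (e, 0)) has_sum f V) some_basis"
proof -
  have "bounded_linear f"
    by (rule bounded_linear_intro[where K = C])
      (use add scale bound in \<open>auto simp: scaleR_eq_cscale scaleR_conv_of_real mult.commute\<close>)
  from has_sum_bounded_linear[OF this cinner_expansion[of V]] show ?thesis
    by (simp add: o_def scale)
qed

lemma cinner_parseval:
  fixes V :: "'a::{real_inner, second_countable_topology} \<times> 'a"
  shows "((\<lambda>e. (cmod (cinner V (e, 0)))\<^sup>2) has_sum (norm V)\<^sup>2) some_basis"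
proof -
  have "((\<lambda>e. cnj (cinner V (e, 0)) * cinner V (e, 0)) has_sum cinner V V) some_basis"
    by (rule antilinear_expansion[where C = "norm V"]) (auto simp: cinner_simps norm_cinner_le)
  then have "((\<lambda>e. complex_of_real ((cmod (cinner V (e, 0)))\<^sup>2)) has_sum of_real ((norm V)\<^sup>2)) some_basis"
    by (simp only: cinner_self complex_norm_square mult.commute)
  then show ?thesis unfolding has_sum_of_real_iff .
qed

section \<open>Square summable families\<close>

lemma sq_summable_product:
  fixes f g :: "'i \<Rightarrow> complex"
  assumes "(\<lambda>i. (cmod (f i))\<^sup>2) summable_on I" "(\<lambda>i. (cmod (g i))\<^sup>2) summable_on I"
  shows "(\<lambda>i. cmod (f i * g i)) summable_on I"
  by (rule Infinite_Sum.abs_summable_product) (use assms in \<open>simp_all add: norm_mult norm_power power2_eq_square[symmetric]\<close>)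

lemma sq_summable_Cauchy_Schwarz:
  fixes f g :: "'i \<Rightarrow> complex"
  assumes "(\<lambda>i. (cmod (f i))\<^sup>2) summable_on I" "(\<lambda>i. (cmod (g i))\<^sup>2) summable_on I"
  shows "(cmod (\<Sum>\<^sub>\<infinity>i\<in>I. f i * g i))\<^sup>2 \<le> (\<Sum>\<^sub>\<infinity>i\<in>I. (cmod (f i))\<^sup>2) * (\<Sum>\<^sub>\<infinity>i\<in>I. (cmod (g i))\<^sup>2)"
    (is "_ \<le> ?a * ?b")
proof -
  have s: "(\<lambda>i. cmod (f i * g i)) summable_on I" by (rule sq_summable_product[OF assms])
  have "cmod (\<Sum>\<^sub>\<infinity>i\<in>I. f i * g i) \<le> (\<Sum>\<^sub>\<infinity>i\<in>I. cmod (f i * g i))"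
    by (rule norm_infsum_bound[OF s])
  also have "\<dots> \<le> sqrt (?a * ?b)"
  proof (rule infsum_le_finite_sums[OF s])
    fix F assume F: "finite F" "F \<subseteq> I"
    have "(\<Sum>i\<in>F. cmod (f i * g i))\<^sup>2 \<le> (\<Sum>i\<in>F. (cmod (f i))\<^sup>2) * (\<Sum>i\<in>F. (cmod (g i))\<^sup>2)"
      unfolding norm_mult by (rule Cauchy_Schwarz_ineq_sum)
    also have "\<dots> \<le> ?a * ?b"
      by (intro mult_mono finite_sum_le_infsum assms F infsum_nonneg sum_nonneg) auto
    finally show "(\<Sum>i\<in>F. cmod (f i * g i)) \<le> sqrt (?a * ?b)" by (rule real_le_rsqrt)
  qed
  finally have le: "cmod (\<Sum>\<^sub>\<infinity>i\<in>I. f i * g i) \<le> sqrt (?a * ?b)" .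
  have "?a * ?b \<ge> 0" by (intro mult_nonneg_nonneg infsum_nonneg) auto
  with power_mono[OF le, of 2] show ?thesis by simp
qed

lemma has_sum_product:
  fixes a :: "'i \<Rightarrow> 'c::{real_normed_field, banach}" and b :: "'j \<Rightarrow> 'c"
  assumes "(a has_sum s) A" "(b has_sum t) B" "(\<lambda>x. norm (a x)) summable_on A" "(\<lambda>y. norm (b y)) summable_on B"
  shows "((\<lambda>(x, y). a x * b y) has_sum s * t) (A \<times> B)"
    "(\<lambda>p. norm (case p of (x, y) \<Rightarrow> a x * b y)) summable_on A \<times> B"
proof -
  show 1: "(\<lambda>p. norm (case p of (x, y) \<Rightarrow> a x * b y)) summable_on A \<times> B"
    by (subst Infinite_Sum.abs_summable_on_Sigma_iff)
      (use assms(3,4) in \<open>auto simp: norm_mult abs_mult infsum_cmult_right' intro!: summable_on_cmult_right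
        summable_on_cmult_left\<close>)
  then have su: "(\<lambda>(x, y). a x * b y) summable_on A \<times> B" by (rule abs_summable_summable)
  have "infsum (\<lambda>(x, y). a x * b y) (A \<times> B) = (\<Sum>\<^sub>\<infinity>x\<in>A. \<Sum>\<^sub>\<infinity>y\<in>B. a x * b y)"
    using infsum_Sigma'_banach[OF su] by simp
  also have "\<dots> = s * t"
    using assms(1,2) by (simp add: infsum_cmult_right' infsum_cmult_left' has_sum_iff)
  finally show "((\<lambda>(x, y). a x * b y) has_sum s * t) (A \<times> B)"
    using su by (simp add: has_sum_iff)
qed

section \<open>Symmetric forms, creation and annihilation\<close>

abbreviation remove_nth :: "nat \<Rightarrow> 'b list \<Rightarrow> 'b list" where
  "remove_nth j ws \<equiv> take j ws @ drop (Suc j) ws"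

lemma mset_remove_nth:
  assumes "j < length ws"
  shows "mset (remove_nth j ws) = mset ws - {#ws ! j#}"
proof -
  have "mset ws = mset (take j ws @ ws ! j # drop (Suc j) ws)"
    using id_take_nth_drop[OF assms] by simp
  then show ?thesis by simp
qed

section \<open>Decomposition into particle numbers\<close>

definition words :: "nat \<Rightarrow> ('a::real_inner \<times> 'a) list set" where
  "words n = {w \<in> basis_words. length w = n}"

definition level :: "'a::real_inner fvec \<Rightarrow> nat \<Rightarrow> real" where
  "level \<Psi> n = (\<Sum>\<^sub>\<infinity>w\<in>words n. (cmod (\<Psi> w))\<^sup>2)"

definition level_inner :: "'a::real_inner fvec \<Rightarrow> 'a fvec \<Rightarrow> nat \<Rightarrow> complex" where
  "level_inner \<Phi> \<Psi> n = (\<Sum>\<^sub>\<infinity>w\<in>words n. \<Phi> w * cnj (\<Psi> w))"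

text \<open>Linearity is asked only in the first slot, as symmetry moves any slot there, and square
  summability only on each level. In this form creation and annihilation preserve the predicate even
  on vectors whose images leave \<open>fock\<close>.\<close>

definition fock_form :: "'a::real_inner fvec \<Rightarrow> bool" where
  "fock_form \<Psi> \<longleftrightarrow>
     (\<forall>V W ws. \<Psi> ((V + W) # ws) = \<Psi> (V # ws) + \<Psi> (W # ws)) \<and>
     (\<forall>c V ws. \<Psi> (cscale c V # ws) = cnj c * \<Psi> (V # ws)) \<and>
     (\<forall>n. \<exists>C. \<forall>Vs. length Vs = n \<longrightarrow> cmod (\<Psi> Vs) \<le> C * prod_list (map norm Vs)) \<and>
     (\<forall>Vs Ws. mset Vs = mset Ws \<longrightarrow> \<Psi> Vs = \<Psi> Ws) \<and>
     (\<forall>n. (\<lambda>w. (cmod (\<Psi> w))\<^sup>2) summable_on words n)"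

lemma fock_form_add: "fock_form \<Psi> \<Longrightarrow> \<Psi> ((V + W) # ws) = \<Psi> (V # ws) + \<Psi> (W # ws)"
  and fock_form_cscale: "fock_form \<Psi> \<Longrightarrow> \<Psi> (cscale c V # ws) = cnj c * \<Psi> (V # ws)"
  and fock_form_bound: "fock_form \<Psi> \<Longrightarrow> \<exists>C. \<forall>Vs. length Vs = n \<longrightarrow> cmod (\<Psi> Vs) \<le> C * prod_list (map norm Vs)"
  and fock_form_sym: "fock_form \<Psi> \<Longrightarrow> mset Vs = mset Ws \<Longrightarrow> \<Psi> Vs = \<Psi> Ws"
  and fock_form_summable: "fock_form \<Psi> \<Longrightarrow> (\<lambda>w. (cmod (\<Psi> w))\<^sup>2) summable_on words n"
  unfolding fock_form_def by blast+

lemma level_nonneg: "level \<Psi> n \<ge> 0"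
  unfolding level_def by (intro infsum_nonneg) simp

lemma level_summable_iff:
  "(\<lambda>w. (cmod (\<Psi> w))\<^sup>2) summable_on basis_words \<longleftrightarrow>
    (\<forall>n. (\<lambda>w. (cmod (\<Psi> w))\<^sup>2) summable_on words n) \<and> summable (level \<Psi>)"
proof -
  have b: "bij_betw snd (Sigma UNIV words) (basis_words :: ('a \<times> 'a) list set)"
    by (rule bij_betw_byWitness[where f' = "\<lambda>w. (length w, w)"]) (auto simp: words_def)
  have "(\<lambda>w. (cmod (\<Psi> w))\<^sup>2) summable_on basis_words \<longleftrightarrow>
      (\<lambda>p. (cmod (\<Psi> (snd p)))\<^sup>2) summable_on (Sigma UNIV words)"
    by (rule summable_on_reindex_bij_betw[OF b, symmetric])
  also have "\<dots> \<longleftrightarrow> (\<lambda>p. norm ((cmod (\<Psi> (snd p)))\<^sup>2)) summable_on (Sigma UNIV words)" by simp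
  also have "\<dots> \<longleftrightarrow> (\<forall>n. (\<lambda>w. (cmod (\<Psi> w))\<^sup>2) summable_on words n) \<and> level \<Psi> summable_on UNIV"
    by (subst Infinite_Sum.abs_summable_on_Sigma_iff) (simp add: level_def[abs_def] level_nonneg[unfolded level_def])
  also have "level \<Psi> summable_on UNIV \<longleftrightarrow> summable (level \<Psi>)"
    by (rule summable_on_UNIV_nonneg_real_iff) (rule level_nonneg)
  finally show ?thesis .
qed

lemma fock_iff: "\<Psi> \<in> fock \<longleftrightarrow> fock_form \<Psi> \<and> summable (level \<Psi>)"
proof
  assume "\<Psi> \<in> fock"
  then have f: "\<And>us V W ws. \<Psi> (us @ (V + W) # ws) = \<Psi> (us @ V # ws) + \<Psi> (us @ W # ws)"
    "\<And>us c V ws. \<Psi> (us @ cscale c V # ws) = cnj c * \<Psi> (us @ V # ws)"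
    "\<And>n. \<exists>C. \<forall>Vs. length Vs = n \<longrightarrow> cmod (\<Psi> Vs) \<le> C * prod_list (map norm Vs)"
    "\<And>Vs Ws. mset Vs = mset Ws \<Longrightarrow> \<Psi> Vs = \<Psi> Ws"
    "(\<lambda>w. (cmod (\<Psi> w))\<^sup>2) summable_on basis_words"
    unfolding fock_def mem_Collect_eq by blast+
  note f12 = f(1)[of "[]", unfolded append_Nil] f(2)[of "[]", unfolded append_Nil]
  have "\<forall>n. (\<lambda>w. (cmod (\<Psi> w))\<^sup>2) summable_on words n" "summable (level \<Psi>)"
    using f(5) unfolding level_summable_iff by blast+
  then show "fock_form \<Psi> \<and> summable (level \<Psi>)"
    unfolding fock_form_def
  proof (intro conjI)
    show "\<forall>V W ws. \<Psi> ((V + W) # ws) = \<Psi> (V # ws) + \<Psi> (W # ws)" by (intro allI f12(1))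
    show "\<forall>c V ws. \<Psi> (cscale c V # ws) = cnj c * \<Psi> (V # ws)" by (intro allI f12(2))
    show "\<forall>n. \<exists>C. \<forall>Vs. length Vs = n \<longrightarrow> cmod (\<Psi> Vs) \<le> C * prod_list (map norm Vs)"
      by (intro allI f(3))
    show "\<forall>Vs Ws. mset Vs = mset Ws \<longrightarrow> \<Psi> Vs = \<Psi> Ws" by (intro allI impI f(4))
  qed
next
  assume a: "fock_form \<Psi> \<and> summable (level \<Psi>)"
  then have F: "fock_form \<Psi>" by blast
  have mv: "\<Psi> (us @ V # ws) = \<Psi> (V # us @ ws)" for us V ws
    by (rule fock_form_sym[OF F]) simp
  have s: "(\<lambda>w. (cmod (\<Psi> w))\<^sup>2) summable_on basis_words"
    unfolding level_summable_iff using a fock_form_summable[OF F] by blast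
  show "\<Psi> \<in> fock"
    unfolding fock_def mem_Collect_eq mv
  proof (intro conjI)
    show "\<forall>us V W ws. \<Psi> ((V + W) # us @ ws) = \<Psi> (V # us @ ws) + \<Psi> (W # us @ ws)"
      by (intro allI fock_form_add[OF F])
    show "\<forall>us c V ws. \<Psi> (cscale c V # us @ ws) = cnj c * \<Psi> (V # us @ ws)"
      by (intro allI fock_form_cscale[OF F])
    show "\<forall>n. \<exists>C. \<forall>Vs. length Vs = n \<longrightarrow> cmod (\<Psi> Vs) \<le> C * prod_list (map norm Vs)"
      by (intro allI fock_form_bound[OF F])
    show "\<forall>Vs Ws. mset Vs = mset Ws \<longrightarrow> \<Psi> Vs = \<Psi> Ws"
      by (intro allI impI fock_form_sym[OF F])
  qed (rule s)
qed

lemma fock_summable: "\<Psi> \<in> fock \<Longrightarrow> (\<lambda>w. (cmod (\<Psi> w))\<^sup>2) summable_on basis_words"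
  unfolding fock_def by (drule CollectD) (drule conjunct2, drule conjunct2, drule conjunct2, drule conjunct2)

lemma level_inner_sums:
  assumes "\<Phi> \<in> fock" "\<Psi> \<in> fock"
  shows "level_inner \<Phi> \<Psi> sums fock_inner \<Phi> \<Psi>"
proof -
  have b: "bij_betw snd (Sigma UNIV words) (basis_words :: ('a \<times> 'a) list set)"
    by (rule bij_betw_byWitness[where f' = "\<lambda>w. (length w, w)"]) (auto simp: words_def)
  have "(\<lambda>w. cmod (\<Phi> w * cnj (\<Psi> w))) summable_on basis_words"
    by (rule sq_summable_product) (use assms in \<open>simp_all add: fock_summable\<close>)
  then have "(\<lambda>w. \<Phi> w * cnj (\<Psi> w)) summable_on basis_words"
    by (rule abs_summable_summable)
  then have h: "((\<lambda>w. \<Phi> w * cnj (\<Psi> w)) has_sum fock_inner \<Phi> \<Psi>) basis_words"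
    by (simp add: fock_inner_def)
  then have h2: "((\<lambda>p. \<Phi> (snd p) * cnj (\<Psi> (snd p))) has_sum fock_inner \<Phi> \<Psi>) (Sigma UNIV words)"
    by (subst has_sum_reindex_bij_betw[OF b])
  then have su: "(\<lambda>(n, w). \<Phi> w * cnj (\<Psi> w)) summable_on (Sigma UNIV words)"
    by (simp add: case_prod_unfold has_sum_imp_summable)
  have "level_inner \<Phi> \<Psi> summable_on UNIV"
    unfolding level_inner_def[abs_def] using summable_on_Sigma_banach[OF su] .
  moreover have "infsum (level_inner \<Phi> \<Psi>) UNIV = fock_inner \<Phi> \<Psi>"
    using infsum_Sigma'_banach[OF su] h2
    by (simp add: level_inner_def[abs_def] has_sum_iff case_prod_unfold)
  ultimately show ?thesis
    by (intro has_sum_imp_sums) (simp add: has_sum_iff)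
qed

text \<open>Insertion at an arbitrary position is needed: the \<open>j\<close>-th term of
  \<open>creation\<close> pairs \<open>V\<close> with letter \<open>j\<close> and evaluates the form
  on the other letters.\<close>

lemma words_insert_bij:
  assumes "j \<le> n"
  shows "bij_betw (\<lambda>(w, e). take j w @ (e, 0) # drop j w) (words n \<times> some_basis)
    (words (Suc n) :: ('a::real_inner \<times> 'a) list set)"
proof (rule bij_betw_byWitness[where f' = "\<lambda>w. (remove_nth j w, fst (w ! j))"])
  show "\<forall>a\<in>(words n :: ('a \<times> 'a) list set) \<times> some_basis. (\<lambda>w. (remove_nth j w, fst (w ! j)))
      ((\<lambda>(w, e). take j w @ (e, 0) # drop j w) a) = a"
    using assms by (auto simp: words_def nth_append min_def)
  show "\<forall>a'\<in>(words (Suc n) :: ('a \<times> 'a) list set). (\<lambda>(w, e). take j w @ (e, 0) # drop j w) (remove_nth j a', fst (a' ! j)) = a'"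
  proof
    fix w :: "('a \<times> 'a) list" assume w: "w \<in> words (Suc n)"
    then have l: "j < length w" using assms by (simp add: words_def)
    then have "w ! j \<in> (\<lambda>e. (e, 0)) ` some_basis"
      using w by (auto simp: words_def basis_words_def lists_eq_set)
    then have "(fst (w ! j), 0) = w ! j" by auto
    then show "(\<lambda>(w, e). take j w @ (e, 0) # drop j w) (remove_nth j w, fst (w ! j)) = w"
      using l by (simp add: id_take_nth_drop[symmetric] min_def)
  qed
  have sub: "set (take k w @ drop l w) \<subseteq> set w" for k l :: nat and w :: "('a \<times> 'a) list"
    using set_take_subset set_drop_subset by fastforce
  show "(\<lambda>(w, e). take j w @ (e, 0) # drop j w) ` (words n \<times> some_basis) \<subseteq> (words (Suc n) :: ('a \<times> 'a) list set)"
    using assms by (auto simp: words_def basis_words_def lists_eq_set dest!: in_set_takeD in_set_dropD)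
  have "fst (w ! j) \<in> some_basis" "remove_nth j w \<in> words n" if w: "w \<in> words (Suc n)" for w :: "('a \<times> 'a) list"
  proof -
    have l: "j < length w" using w assms by (simp add: words_def)
    then have "w ! j \<in> set w" by simp
    then show "fst (w ! j) \<in> some_basis"
      using w by (fastforce simp: words_def basis_words_def lists_eq_set)
    show "remove_nth j w \<in> words n"
      using w l sub[of j w "Suc j"] by (auto simp: words_def basis_words_def lists_eq_set)
  qed
  then show "(\<lambda>w. (remove_nth j w, fst (w ! j))) ` (words (Suc n) :: ('a \<times> 'a) list set) \<subseteq> words n \<times> some_basis"
    by (intro image_subsetI SigmaI) auto
qed

lemma sum_nth_mset: "(\<Sum>j<length ws. F (ws ! j)) = (\<Sum>x\<in>#mset ws. F x)"
proof -
  have "(\<Sum>x\<in>#mset ws. F x) = sum_list (map F ws)"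
    by (simp add: sum_mset_sum_list flip: mset_map)
  also have "\<dots> = (\<Sum>j<length ws. F (ws ! j))"
    by (simp add: sum_list_sum_nth atLeast0LessThan)
  finally show ?thesis by simp
qed

lemma words_insert_has_sum:
  fixes f :: "('a::real_inner \<times> 'a) list \<Rightarrow> 'c::{comm_monoid_add, topological_space}"
  assumes "j \<le> n"
  shows "(f has_sum s) (words (Suc n)) \<longleftrightarrow>
    ((\<lambda>(w, e). f (take j w @ (e, 0) # drop j w)) has_sum s) (words n \<times> some_basis)"
  using has_sum_reindex_bij_betw[OF words_insert_bij[OF assms], of f s]
  by (simp add: case_prod_unfold)

lemma words_0 [simp]: "words 0 = {[]}"
  by (auto simp: words_def basis_words_def)

lemma fock_form_swap: "fock_form \<Psi> \<Longrightarrow> \<Psi> (V # W # ws) = \<Psi> (W # V # ws)"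
  by (rule fock_form_sym) auto

lemma fock_form_expansion:
  fixes \<Psi> :: "'a::{real_inner, second_countable_topology} fvec"
  assumes F: "fock_form \<Psi>"
  shows "((\<lambda>e. cnj (cinner V (e, 0)) * \<Psi> ((e, 0) # w)) has_sum \<Psi> (V # w)) some_basis"
proof -
  obtain C where C: "\<And>Vs. length Vs = Suc (length w) \<Longrightarrow> cmod (\<Psi> Vs) \<le> C * prod_list (map norm Vs)"
    using fock_form_bound[OF F, of "Suc (length w)"] by blast
  show ?thesis
  proof (rule antilinear_expansion[where C = "C * prod_list (map norm w)"])
    show "\<Psi> ((V + W) # w) = \<Psi> (V # w) + \<Psi> (W # w)" for V W by (rule fock_form_add[OF F])
    show "\<Psi> (cscale c V # w) = cnj c * \<Psi> (V # w)" for c V by (rule fock_form_cscale[OF F])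
    show "cmod (\<Psi> (V # w)) \<le> C * prod_list (map norm w) * norm V" for V
      using C[of "V # w"] by (simp add: mult_ac)
  qed
qed

lemma level_Suc_has_sum:
  fixes \<Psi> :: "'a::real_inner fvec"
  assumes F: "fock_form \<Psi>"
  shows "((\<lambda>(w, e). (cmod (\<Psi> ((e, 0) # w)))\<^sup>2) has_sum level \<Psi> (Suc n)) (words n \<times> some_basis)"
proof -
  have "((\<lambda>w. (cmod (\<Psi> w))\<^sup>2) has_sum level \<Psi> (Suc n)) (words (Suc n))"
    using fock_form_summable[OF F] by (simp add: level_def)
  then show ?thesis by (subst (asm) words_insert_has_sum[of 0]) simp_all
qed

lemma fock_form_summable_head:
  fixes \<Psi> :: "'a::real_inner fvec"
  assumes F: "fock_form \<Psi>" and w: "w \<in> words n"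
  shows "(\<lambda>e. (cmod (\<Psi> ((e, 0) # w)))\<^sup>2) summable_on some_basis"
proof -
  have "(\<lambda>p. norm (case p of (w, e) \<Rightarrow> (cmod (\<Psi> ((e, 0) # w)))\<^sup>2)) summable_on (words n \<times> some_basis)"
    using has_sum_imp_summable[OF level_Suc_has_sum[OF F, of n]] by (simp add: case_prod_unfold)
  then show ?thesis
    by (subst (asm) Infinite_Sum.abs_summable_on_Sigma_iff) (use w in simp)
qed

text \<open>Expanding \<open>V\<close> in the basis and applying Cauchy-Schwarz for each word
  \<open>w\<close> bounds the square by \<open>|V|^2\<close> times \<open>S w\<close>, the sum over
  all letters put in front of \<open>w\<close>. Summing \<open>S\<close> over \<open>w\<close> gives
  the next level.\<close>

lemma level_annihilation_aux:
  fixes \<Psi> :: "'a::{real_inner, second_countable_topology} fvec"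
  assumes F: "fock_form \<Psi>"
  shows "(\<lambda>w. (cmod (\<Psi> (V # w)))\<^sup>2) summable_on words n"
    "(\<Sum>\<^sub>\<infinity>w\<in>words n. (cmod (\<Psi> (V # w)))\<^sup>2) \<le> (norm V)\<^sup>2 * level \<Psi> (Suc n)"
proof -
  define S where "S w = (\<Sum>\<^sub>\<infinity>e\<in>some_basis. (cmod (\<Psi> ((e, 0) # w)))\<^sup>2)" for w
  note hs = level_Suc_has_sum[OF F, of n]
  have S: "(S has_sum level \<Psi> (Suc n)) (words n)"
  proof (rule has_sum_SigmaD[OF hs])
    fix w :: "('a \<times> 'a) list" assume "w \<in> words n"
    then show "((\<lambda>e. case (w, e) of (w, e) \<Rightarrow> (cmod (\<Psi> ((e, 0) # w)))\<^sup>2) has_sum S w) some_basis"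
      using fock_form_summable_head[OF F] by (simp add: S_def)
  qed
  have le: "(cmod (\<Psi> (V # w)))\<^sup>2 \<le> (norm V)\<^sup>2 * S w" if "w \<in> words n" for w
  proof -
    have "\<Psi> (V # w) = (\<Sum>\<^sub>\<infinity>e\<in>some_basis. cnj (cinner V (e, 0)) * \<Psi> ((e, 0) # w))"
      using fock_form_expansion[OF F, of V w] by (simp add: has_sum_iff)
    also have "(cmod \<dots>)\<^sup>2 \<le> (\<Sum>\<^sub>\<infinity>e\<in>some_basis. (cmod (cnj (cinner V (e, 0))))\<^sup>2) * S w"
      unfolding S_def using fock_form_summable_head[OF F that] cinner_parseval[of V]
      by (intro sq_summable_Cauchy_Schwarz) (simp_all add: has_sum_iff)
    finally show ?thesis using cinner_parseval[of V] by (simp add: has_sum_iff)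
  qed
  have SV: "((\<lambda>w. (norm V)\<^sup>2 * S w) has_sum (norm V)\<^sup>2 * level \<Psi> (Suc n)) (words n)"
    by (rule has_sum_cmult_right[OF S])
  show su: "(\<lambda>w. (cmod (\<Psi> (V # w)))\<^sup>2) summable_on words n"
    by (rule summable_on_comparison_test[OF has_sum_imp_summable[OF SV]]) (use le in auto)
  show "(\<Sum>\<^sub>\<infinity>w\<in>words n. (cmod (\<Psi> (V # w)))\<^sup>2) \<le> (norm V)\<^sup>2 * level \<Psi> (Suc n)"
    using has_sum_mono[OF has_sum_infsum[OF su] SV] le by simp
qed

lemma fock_form_annihilation:
  fixes \<Psi> :: "'a::{real_inner, second_countable_topology} fvec"
  assumes F: "fock_form \<Psi>"
  shows "fock_form (annihilation V \<Psi>)"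
  unfolding fock_form_def
proof (intro conjI)
  show "\<forall>U W ws. annihilation V \<Psi> ((U + W) # ws) = annihilation V \<Psi> (U # ws) + annihilation V \<Psi> (W # ws)"
    by (simp add: annihilation_def fock_form_swap[OF F, of V] fock_form_add[OF F] algebra_simps)
  show "\<forall>c U ws. annihilation V \<Psi> (cscale c U # ws) = cnj c * annihilation V \<Psi> (U # ws)"
    by (simp add: annihilation_def fock_form_swap[OF F, of V] fock_form_cscale[OF F])
  show "\<forall>n. \<exists>C. \<forall>Vs. length Vs = n \<longrightarrow> cmod (annihilation V \<Psi> Vs) \<le> C * prod_list (map norm Vs)"
  proof
    fix n
    obtain C where C: "\<And>Vs. length Vs = Suc n \<Longrightarrow> cmod (\<Psi> Vs) \<le> C * prod_list (map norm Vs)"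
      using fock_form_bound[OF F, of "Suc n"] by blast
    show "\<exists>C. \<forall>Vs. length Vs = n \<longrightarrow> cmod (annihilation V \<Psi> Vs) \<le> C * prod_list (map norm Vs)"
    proof (intro exI[of _ "sqrt (real (n + 1)) * (C * norm V)"] allI impI)
      fix Vs :: "('a \<times> 'a) list" assume "length Vs = n"
      then show "cmod (annihilation V \<Psi> Vs) \<le> sqrt (real (n + 1)) * (C * norm V) * prod_list (map norm Vs)"
        using C[of "V # Vs"] by (simp add: annihilation_def norm_mult mult.assoc mult_left_mono)
    qed
  qed
  show "\<forall>Vs Ws. mset Vs = mset Ws \<longrightarrow> annihilation V \<Psi> Vs = annihilation V \<Psi> Ws"
  proof (intro allI impI)
    fix Vs Ws :: "('a \<times> 'a) list" assume m: "mset Vs = mset Ws"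
    have "\<Psi> (V # Vs) = \<Psi> (V # Ws)" by (rule fock_form_sym[OF F]) (simp add: m)
    then show "annihilation V \<Psi> Vs = annihilation V \<Psi> Ws"
      using mset_eq_length[OF m] by (simp add: annihilation_def)
  qed
  show "\<forall>n. (\<lambda>w. (cmod (annihilation V \<Psi> w))\<^sup>2) summable_on words n"
  proof
    fix n
    have "(\<lambda>w. (real n + 1) * (cmod (\<Psi> (V # w)))\<^sup>2) summable_on words n"
      by (intro summable_on_cmult_right level_annihilation_aux F)
    then show "(\<lambda>w. (cmod (annihilation V \<Psi> w))\<^sup>2) summable_on words n"
      by (subst summable_on_cong[where g = "\<lambda>w. (real n + 1) * (cmod (\<Psi> (V # w)))\<^sup>2"])
        (auto simp: words_def annihilation_def norm_mult power_mult_distrib)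
  qed
qed

lemma level_annihilation:
  fixes \<Psi> :: "'a::{real_inner, second_countable_topology} fvec"
  assumes F: "fock_form \<Psi>"
  shows "level (annihilation V \<Psi>) n \<le> (real n + 1) * (norm V)\<^sup>2 * level \<Psi> (Suc n)"
proof -
  have "level (annihilation V \<Psi>) n = (\<Sum>\<^sub>\<infinity>w\<in>words n. (real n + 1) * (cmod (\<Psi> (V # w)))\<^sup>2)"
    unfolding level_def
    by (rule infsum_cong) (auto simp: words_def annihilation_def norm_mult power_mult_distrib)
  also have "\<dots> = (real n + 1) * (\<Sum>\<^sub>\<infinity>w\<in>words n. (cmod (\<Psi> (V # w)))\<^sup>2)"
    by (rule infsum_cmult_right')
  also have "\<dots> \<le> (real n + 1) * ((norm V)\<^sup>2 * level \<Psi> (Suc n))"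
    by (intro mult_left_mono level_annihilation_aux F) auto
  finally show ?thesis by (simp add: mult.assoc)
qed

lemma creation_Nil [simp]: "creation V \<Psi> [] = 0"
  by (simp add: creation_def)

lemma creation_Cons:
  "creation V \<Psi> (A # ws) = of_real (1 / sqrt (real (Suc (length ws)))) *
     (cinner V A * \<Psi> ws + (\<Sum>j<length ws. cinner V (ws ! j) * \<Psi> (A # remove_nth j ws)))"
  unfolding creation_def by (simp add: sum.lessThan_Suc_shift del: sum.lessThan_Suc)

lemma creation_has_sum_term:
  fixes \<Psi> :: "'a::{real_inner, second_countable_topology} fvec"
  assumes F: "fock_form \<Psi>" and j: "j \<le> n"
  shows "((\<lambda>w. (cmod (cinner V (w ! j) * \<Psi> (remove_nth j w)))\<^sup>2) has_sum (norm V)\<^sup>2 * level \<Psi> n) (words (Suc n))"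
proof -
  have h: "((\<lambda>w. (cmod (\<Psi> w))\<^sup>2) has_sum level \<Psi> n) (words n)"
    using fock_form_summable[OF F] by (simp add: level_def)
  have "((\<lambda>(w, e). (cmod (\<Psi> w))\<^sup>2 * (cmod (cinner V (e, 0)))\<^sup>2) has_sum level \<Psi> n * (norm V)\<^sup>2) (words n \<times> some_basis)"
    using has_sum_imp_summable[OF h] has_sum_imp_summable[OF cinner_parseval[of V]]
    by (intro has_sum_product h cinner_parseval) (simp_all add: norm_power)
  also have "?this \<longleftrightarrow> ((\<lambda>(w, e). (cmod (cinner V ((take j w @ (e, 0) # drop j w) ! j) *
       \<Psi> (remove_nth j (take j w @ (e, 0) # drop j w))))\<^sup>2) has_sum (norm V)\<^sup>2 * level \<Psi> n) (words n \<times> some_basis)"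
    unfolding mult.commute[of "level \<Psi> n"]
    by (rule has_sum_cong)
      (use j in \<open>auto simp: words_def nth_append min_def norm_mult power_mult_distrib mult.commute\<close>)
  finally show ?thesis unfolding words_insert_has_sum[OF j] .
qed

text \<open>Each of the \<open>n + 1\<close> insertion terms has square sum
  \<open>|V|^2 * level \<Psi> n\<close>. The loss \<open>n + 1\<close> of Cauchy-Schwarz for their
  sum is cancelled by the squared normalization of \<open>creation\<close>, so the squares simply
  add up.\<close>

lemma level_creation_aux:
  fixes \<Psi> :: "'a::{real_inner, second_countable_topology} fvec"
  assumes F: "fock_form \<Psi>"
  shows "(\<lambda>w. (cmod (creation V \<Psi> w))\<^sup>2) summable_on words (Suc n)"
    "level (creation V \<Psi>) (Suc n) \<le> (real n + 1) * (norm V)\<^sup>2 * level \<Psi> n"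
proof -
  define a where "a j w = cinner V (w ! j) * \<Psi> (remove_nth j w)" for j w
  have "((\<lambda>w. \<Sum>j<Suc n. (cmod (a j w))\<^sup>2) has_sum (\<Sum>j<Suc n. (norm V)\<^sup>2 * level \<Psi> n)) (words (Suc n))"
    unfolding a_def by (intro has_sum_finite_sum creation_has_sum_term F) simp
  then have h: "((\<lambda>w. \<Sum>j<Suc n. (cmod (a j w))\<^sup>2) has_sum (real n + 1) * (norm V)\<^sup>2 * level \<Psi> n) (words (Suc n))"
    by (simp add: algebra_simps)
  have le: "(cmod (creation V \<Psi> w))\<^sup>2 \<le> (\<Sum>j<Suc n. (cmod (a j w))\<^sup>2)" if "w \<in> words (Suc n)" for w
  proof -
    have l: "length w = Suc n" using that by (simp add: words_def)
    have "(cmod (creation V \<Psi> w))\<^sup>2 = (cmod (\<Sum>j<Suc n. a j w))\<^sup>2 / (real n + 1)"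
      unfolding creation_def l a_def
      by (simp only: norm_mult power_mult_distrib norm_of_real) (simp add: power_divide)
    also have "\<dots> \<le> (\<Sum>j<Suc n. cmod (a j w))\<^sup>2 / (real n + 1)"
      by (intro divide_right_mono power_mono norm_sum) auto
    also have "\<dots> \<le> ((\<Sum>j<Suc n. (cmod (a j w))\<^sup>2) * card {..<Suc n}) / (real n + 1)"
      by (intro divide_right_mono sum_squared_le_sum_of_squares) auto
    also have "\<dots> = (\<Sum>j<Suc n. (cmod (a j w))\<^sup>2)"
      by (simp add: add.commute del: sum.lessThan_Suc)
    finally show ?thesis .
  qed
  show su: "(\<lambda>w. (cmod (creation V \<Psi> w))\<^sup>2) summable_on words (Suc n)"
    by (rule summable_on_comparison_test[OF has_sum_imp_summable[OF h]]) (use le in auto)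
  show "level (creation V \<Psi>) (Suc n) \<le> (real n + 1) * (norm V)\<^sup>2 * level \<Psi> n"
    unfolding level_def[of "creation V \<Psi>"]
    using has_sum_mono[OF has_sum_infsum[OF su] h] le by simp
qed

lemma prod_list_remove_nth:
  fixes f :: "'b \<Rightarrow> 'c::comm_monoid_mult"
  assumes "j < length ws"
  shows "f (ws ! j) * prod_list (map f (remove_nth j ws)) = prod_list (map f ws)"
proof -
  have "prod_list (map f ws) = prod_list (map f (take j ws @ ws ! j # drop (Suc j) ws))"
    using id_take_nth_drop[OF assms] by simp
  then show ?thesis by (simp add: mult_ac)
qed

lemma fock_form_creation:
  fixes \<Psi> :: "'a::{real_inner, second_countable_topology} fvec"
  assumes F: "fock_form \<Psi>"
  shows "fock_form (creation V \<Psi>)"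
  unfolding fock_form_def
proof (intro conjI)
  show "\<forall>U W ws. creation V \<Psi> ((U + W) # ws) = creation V \<Psi> (U # ws) + creation V \<Psi> (W # ws)"
    by (simp add: creation_Cons fock_form_add[OF F] cinner_simps algebra_simps sum.distrib)
  show "\<forall>c U ws. creation V \<Psi> (cscale c U # ws) = cnj c * creation V \<Psi> (U # ws)"
    by (simp add: creation_Cons fock_form_cscale[OF F] cinner_simps algebra_simps sum_distrib_left)
  show "\<forall>n. \<exists>C. \<forall>Vs. length Vs = n \<longrightarrow> cmod (creation V \<Psi> Vs) \<le> C * prod_list (map norm Vs)"
  proof
    fix n
    \<comment> \<open>For \<open>n = 0\<close> the value 0 of \<open>n - 1\<close> is harmless,
      since \<open>creation\<close> vanishes on the empty list.\<close>
    obtain C where C: "\<And>Vs. length Vs = n - 1 \<Longrightarrow> cmod (\<Psi> Vs) \<le> C * prod_list (map norm Vs)"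
      using fock_form_bound[OF F, of "n - 1"] by blast
    show "\<exists>C. \<forall>Vs. length Vs = n \<longrightarrow> cmod (creation V \<Psi> Vs) \<le> C * prod_list (map norm Vs)"
    proof (intro exI[of _ "1 / sqrt n * (n * (norm V * C))"] allI impI)
      fix Vs :: "('a \<times> 'a) list" assume l: "length Vs = n"
      have "cmod (\<Sum>j<n. cinner V (Vs ! j) * \<Psi> (remove_nth j Vs)) \<le>
          (\<Sum>j<n. norm V * C * prod_list (map norm Vs))"
      proof (rule order.trans[OF norm_sum sum_mono])
        fix j assume "j \<in> {..<n}"
        then have j: "j < length Vs" using l by simp
        have "cmod (cinner V (Vs ! j) * \<Psi> (remove_nth j Vs)) \<le>
            (norm V * norm (Vs ! j)) * (C * prod_list (map norm (remove_nth j Vs)))"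
          unfolding norm_mult by (intro mult_mono norm_cinner_le C) (use j l in auto)
        also have "\<dots> = norm V * C * (norm (Vs ! j) * prod_list (map norm (remove_nth j Vs)))"
          by (simp only: mult_ac)
        finally show "cmod (cinner V (Vs ! j) * \<Psi> (remove_nth j Vs)) \<le> norm V * C * prod_list (map norm Vs)"
          unfolding prod_list_remove_nth[OF j] .
      qed
      then have "1 / sqrt n * cmod (\<Sum>j<n. cinner V (Vs ! j) * \<Psi> (remove_nth j Vs)) \<le>
          1 / sqrt n * (n * (norm V * C * prod_list (map norm Vs)))"
        by (intro mult_left_mono) auto
      then show "cmod (creation V \<Psi> Vs) \<le> 1 / sqrt n * (n * (norm V * C)) * prod_list (map norm Vs)"
        by (simp add: creation_def l norm_mult mult_ac norm_divide)
    qed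
  qed
  show "\<forall>Vs Ws. mset Vs = mset Ws \<longrightarrow> creation V \<Psi> Vs = creation V \<Psi> Ws"
  proof (intro allI impI)
    fix Vs Ws :: "('a \<times> 'a) list" assume m: "mset Vs = mset Ws"
    \<comment> \<open>A symmetric form factors through \<open>mset\<close>; the sum over positions
      then becomes a sum over a multiset, in which the order of the arguments has
      disappeared.\<close>
    define \<psi> where "\<psi> M = \<Psi> (SOME xs. mset xs = M)" for M
    have psi: "\<Psi> xs = \<psi> (mset xs)" for xs
    proof -
      have "mset (SOME ys. mset ys = mset xs) = mset xs" by (rule someI[where x = xs]) simp
      then show ?thesis unfolding \<psi>_def by (intro fock_form_sym[OF F]) simp
    qed
    have c: "creation V \<Psi> xs = of_real (1 / sqrt (real (size (mset xs)))) *
        (\<Sum>x\<in>#mset xs. cinner V x * \<psi> (mset xs - {#x#}))" for xs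
    proof -
      have "(\<Sum>j<length xs. cinner V (xs ! j) * \<Psi> (remove_nth j xs)) =
          (\<Sum>j<length xs. cinner V (xs ! j) * \<psi> (mset xs - {#xs ! j#}))"
        by (rule sum.cong) (simp_all add: psi mset_remove_nth del: mset_append)
      then show ?thesis
        unfolding creation_def sum_nth_mset[of "\<lambda>x. cinner V x * \<psi> (mset xs - {#x#})" xs] by simp
    qed
    show "creation V \<Psi> Vs = creation V \<Psi> Ws" unfolding c m ..
  qed
  show "\<forall>n. (\<lambda>w. (cmod (creation V \<Psi> w))\<^sup>2) summable_on words n"
  proof
    fix n show "(\<lambda>w. (cmod (creation V \<Psi> w))\<^sup>2) summable_on words n"
      by (cases n) (use level_creation_aux(1)[OF F] in auto)
  qed
qed

lemma level_creation_0 [simp]: "level (creation V \<Psi>) 0 = 0"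
  by (simp add: level_def)

lemma level_creation_Suc:
  fixes \<Psi> :: "'a::{real_inner, second_countable_topology} fvec"
  assumes "fock_form \<Psi>"
  shows "level (creation V \<Psi>) (Suc n) \<le> (real n + 1) * (norm V)\<^sup>2 * level \<Psi> n"
  using level_creation_aux(2)[OF assms] .

lemma level_inner_creation_0 [simp]: "level_inner (creation V \<Phi>) \<Psi> 0 = 0"
  by (simp add: level_inner_def)

lemma level_inner_commute: "level_inner \<Phi> \<Psi> n = cnj (level_inner \<Psi> \<Phi> n)"
  unfolding level_inner_def infsum_cnj[symmetric] by (simp add: mult.commute)

text \<open>By the symmetry of \<open>\<Psi>\<close> all \<open>n + 1\<close> positions of the
  inserted letter contribute the same sum \<open>T\<close>. The normalization
  \<open>1 / sqrt (n + 1)\<close> of \<open>creation\<close> thus turns into the factor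
  \<open>sqrt (n + 1)\<close> of \<open>annihilation\<close>.\<close>

lemma level_inner_creation:
  fixes \<Psi> :: "'a::{real_inner, second_countable_topology} fvec"
  assumes F: "fock_form \<Phi>" and G: "fock_form \<Psi>"
  shows "level_inner (creation V \<Phi>) \<Psi> (Suc n) = level_inner \<Phi> (annihilation V \<Psi>) n"
proof -
  define T where "T = (\<Sum>\<^sub>\<infinity>w\<in>words n. \<Phi> w * cnj (\<Psi> (V # w)))"
  define g where "g = (\<lambda>(w, e). (\<Phi> w * cinner V (e, 0)) * cnj (\<Psi> ((e, 0) # w)))"
  have hF: "((\<lambda>w. (cmod (\<Phi> w))\<^sup>2) has_sum level \<Phi> n) (words n)"
    using fock_form_summable[OF F] by (simp add: level_def)
  have "((\<lambda>(w, e). (cmod (\<Phi> w))\<^sup>2 * (cmod (cinner V (e, 0)))\<^sup>2) has_sum level \<Phi> n * (norm V)\<^sup>2) (words n \<times> some_basis)"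
    using has_sum_imp_summable[OF hF] has_sum_imp_summable[OF cinner_parseval[of V]]
    by (intro has_sum_product hF cinner_parseval) (simp_all add: norm_power)
  then have 1: "(\<lambda>p. (cmod (\<Phi> (fst p) * cinner V (snd p, 0)))\<^sup>2) summable_on words n \<times> some_basis"
    by (simp add: has_sum_imp_summable case_prod_unfold norm_mult power_mult_distrib)
  have 2: "(\<lambda>p. (cmod (cnj (\<Psi> ((snd p, 0) # fst p))))\<^sup>2) summable_on words n \<times> some_basis"
    using has_sum_imp_summable[OF level_Suc_has_sum[OF G, of n]] by (simp add: case_prod_unfold)
  have gsu: "g summable_on words n \<times> some_basis"
    unfolding g_def case_prod_unfold
    by (rule abs_summable_summable) (rule sq_summable_product[OF 1 2])
  \<comment> \<open>Summing over the inserted letter first reassembles \<open>V\<close> from its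
    basis expansion.\<close>
  have gT: "(g has_sum T) (words n \<times> some_basis)"
  proof -
    have inner: "((\<lambda>e. g (w, e)) has_sum \<Phi> w * cnj (\<Psi> (V # w))) some_basis" for w
    proof -
      have "((\<lambda>e. cnj (cnj (cinner V (e, 0)) * \<Psi> ((e, 0) # w))) has_sum cnj (\<Psi> (V # w))) some_basis"
        unfolding has_sum_cnj_iff by (rule fock_form_expansion[OF G])
      from has_sum_cmult_right[OF this, of "\<Phi> w"] show ?thesis by (simp add: g_def mult_ac)
    qed
    have "((\<lambda>w. \<Phi> w * cnj (\<Psi> (V # w))) has_sum infsum g (words n \<times> some_basis)) (words n)"
      by (rule has_sum_SigmaD[OF has_sum_infsum[OF gsu] inner])
    then have "T = infsum g (words n \<times> some_basis)" unfolding T_def by (simp add: has_sum_iff)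
    then show ?thesis using gsu by simp
  qed
  have summand: "((\<lambda>w. cinner V (w ! j) * \<Phi> (remove_nth j w) * cnj (\<Psi> w)) has_sum T) (words (Suc n))"
    if j: "j \<le> n" for j
  proof -
    have sym: "\<Psi> (take j w @ (e, 0) # drop j w) = \<Psi> ((e, 0) # w)" for w e
    proof (rule fock_form_sym[OF G])
      have "mset (take j w) + mset (drop j w) = mset w"
        by (metis append_take_drop_id mset_append)
      then show "mset (take j w @ (e, 0) # drop j w) = mset ((e, 0) # w)" by simp
    qed
    show ?thesis
      unfolding words_insert_has_sum[OF j]
    proof (rule has_sum_cong[THEN iffD1, OF _ gT])
      fix p :: "('a \<times> 'a) list \<times> 'a" assume "p \<in> words n \<times> some_basis"
      then obtain w e where p: "p = (w, e)" "length w = n" by (auto simp: words_def)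
      then show "g p = (case p of (w, e) \<Rightarrow> cinner V ((take j w @ (e, 0) # drop j w) ! j) *
          \<Phi> (remove_nth j (take j w @ (e, 0) # drop j w)) * cnj (\<Psi> (take j w @ (e, 0) # drop j w)))"
        unfolding p(1) prod.case sym using j p(2) by (simp add: g_def nth_append min_def mult_ac)
    qed
  qed
  have "((\<lambda>w. of_real (1 / sqrt (real (Suc n))) * (\<Sum>j<Suc n. cinner V (w ! j) * \<Phi> (remove_nth j w) * cnj (\<Psi> w)))
      has_sum of_real (1 / sqrt (real (Suc n))) * (\<Sum>j<Suc n. T)) (words (Suc n))"
    by (intro has_sum_cmult_right has_sum_finite_sum summand) simp
  also have "?this \<longleftrightarrow> ((\<lambda>w. creation V \<Phi> w * cnj (\<Psi> w)) has_sum
      of_real (1 / sqrt (real (Suc n))) * (\<Sum>j<Suc n. T)) (words (Suc n))"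
    by (rule has_sum_cong) (simp add: words_def creation_def sum_distrib_right del: sum.lessThan_Suc)
  finally have "level_inner (creation V \<Phi>) \<Psi> (Suc n) = of_real (1 / sqrt (real (Suc n)) * real (Suc n)) * T"
    unfolding level_inner_def by (simp add: has_sum_iff)
  also have "1 / sqrt (real (Suc n)) * real (Suc n) = sqrt (real (Suc n))"
    by (simp add: real_div_sqrt)
  also have "of_real (sqrt (real (Suc n))) * T = level_inner \<Phi> (annihilation V \<Psi>) n"
    unfolding T_def level_inner_def infsum_cmult_right'[symmetric]
    by (rule infsum_cong) (simp add: words_def annihilation_def)
  finally show ?thesis .
qed

lemma level_inner_self:
  assumes "fock_form \<Psi>"
  shows "level_inner \<Psi> \<Psi> n = of_real (level \<Psi> n)"
proof -
  have "((\<lambda>w. complex_of_real ((cmod (\<Psi> w))\<^sup>2)) has_sum of_real (level \<Psi> n)) (words n)"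
    unfolding level_def by (intro has_sum_of_real has_sum_infsum fock_form_summable assms)
  then show ?thesis
    unfolding level_inner_def complex_norm_square by (simp add: has_sum_iff)
qed

lemma fock_form_lincomb:
  assumes F: "fock_form \<Phi>" and G: "fock_form \<Psi>"
  shows "fock_form (\<lambda>w. a * \<Phi> w + b * \<Psi> w)"
    "level (\<lambda>w. a * \<Phi> w + b * \<Psi> w) n \<le> 2 * (cmod a)\<^sup>2 * level \<Phi> n + 2 * (cmod b)\<^sup>2 * level \<Psi> n"
proof -
  have le: "(cmod (a * x + b * y))\<^sup>2 \<le> 2 * (cmod a)\<^sup>2 * (cmod x)\<^sup>2 + 2 * (cmod b)\<^sup>2 * (cmod y)\<^sup>2" for x y
  proof -
    have "(cmod (a * x + b * y))\<^sup>2 \<le> (cmod a * cmod x + cmod b * cmod y)\<^sup>2"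
      by (intro power_mono order.trans[OF norm_triangle_ineq]) (simp_all add: norm_mult)
    also have "\<dots> \<le> 2 * (cmod a * cmod x)\<^sup>2 + 2 * (cmod b * cmod y)\<^sup>2"
      using sum_squares_bound[of "cmod a * cmod x" "cmod b * cmod y"] by (simp add: power2_sum)
    finally show ?thesis by (simp add: power_mult_distrib)
  qed
  have h: "((\<lambda>w. 2 * (cmod a)\<^sup>2 * (cmod (\<Phi> w))\<^sup>2 + 2 * (cmod b)\<^sup>2 * (cmod (\<Psi> w))\<^sup>2) has_sum
      2 * (cmod a)\<^sup>2 * level \<Phi> n + 2 * (cmod b)\<^sup>2 * level \<Psi> n) (words n)" for n
    unfolding level_def
    by (intro has_sum_add has_sum_cmult_right has_sum_infsum fock_form_summable F G)
  have su: "(\<lambda>w. (cmod (a * \<Phi> w + b * \<Psi> w))\<^sup>2) summable_on words n" for n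
    by (rule summable_on_comparison_test[OF has_sum_imp_summable[OF h]]) (use le in auto)
  show "level (\<lambda>w. a * \<Phi> w + b * \<Psi> w) n \<le> 2 * (cmod a)\<^sup>2 * level \<Phi> n + 2 * (cmod b)\<^sup>2 * level \<Psi> n"
    unfolding level_def[of "\<lambda>w. a * \<Phi> w + b * \<Psi> w"]
    using has_sum_mono[OF has_sum_infsum[OF su] h] le by simp
  show "fock_form (\<lambda>w. a * \<Phi> w + b * \<Psi> w)"
    unfolding fock_form_def
  proof (intro conjI)
    show "\<forall>V W ws. a * \<Phi> ((V + W) # ws) + b * \<Psi> ((V + W) # ws) =
        a * \<Phi> (V # ws) + b * \<Psi> (V # ws) + (a * \<Phi> (W # ws) + b * \<Psi> (W # ws))"
      by (simp add: fock_form_add[OF F] fock_form_add[OF G] algebra_simps)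
    show "\<forall>c V ws. a * \<Phi> (cscale c V # ws) + b * \<Psi> (cscale c V # ws) = cnj c * (a * \<Phi> (V # ws) + b * \<Psi> (V # ws))"
      by (simp add: fock_form_cscale[OF F] fock_form_cscale[OF G] algebra_simps)
    show "\<forall>Vs Ws. mset Vs = mset Ws \<longrightarrow> a * \<Phi> Vs + b * \<Psi> Vs = a * \<Phi> Ws + b * \<Psi> Ws"
      using fock_form_sym[OF F] fock_form_sym[OF G] by metis
    show "\<forall>n. \<exists>C. \<forall>Vs. length Vs = n \<longrightarrow> cmod (a * \<Phi> Vs + b * \<Psi> Vs) \<le> C * prod_list (map norm Vs)"
    proof
      fix n
      obtain C where C: "\<And>Vs. length Vs = n \<Longrightarrow> cmod (\<Phi> Vs) \<le> C * prod_list (map norm Vs)"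
        using fock_form_bound[OF F, of n] by blast
      obtain D where D: "\<And>Vs. length Vs = n \<Longrightarrow> cmod (\<Psi> Vs) \<le> D * prod_list (map norm Vs)"
        using fock_form_bound[OF G, of n] by blast
      show "\<exists>C. \<forall>Vs. length Vs = n \<longrightarrow> cmod (a * \<Phi> Vs + b * \<Psi> Vs) \<le> C * prod_list (map norm Vs)"
      proof (intro exI[of _ "cmod a * C + cmod b * D"] allI impI)
        fix Vs :: "('a \<times> 'a) list" assume l: "length Vs = n"
        have "cmod (a * \<Phi> Vs + b * \<Psi> Vs) \<le> cmod a * cmod (\<Phi> Vs) + cmod b * cmod (\<Psi> Vs)"
          by (rule order.trans[OF norm_triangle_ineq]) (simp add: norm_mult)
        also have "\<dots> \<le> cmod a * (C * prod_list (map norm Vs)) + cmod b * (D * prod_list (map norm Vs))"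
          by (intro add_mono mult_left_mono C D l) auto
        finally show "cmod (a * \<Phi> Vs + b * \<Psi> Vs) \<le> (cmod a * C + cmod b * D) * prod_list (map norm Vs)"
          by (simp add: algebra_simps)
      qed
    qed
  qed (use su in blast)
qed

text \<open>The arguments are freed from the basis one at a time: \<open>annihilation\<close> fixes
  the first argument at \<open>V\<close> and lowers the length, and expanding \<open>V\<close> shows
  that the lowered form still vanishes on basis words.\<close>

lemma fock_form_eq_0:
  fixes \<Psi> :: "'a::{real_inner, second_countable_topology} fvec"
  assumes "fock_form \<Psi>" "\<And>w. w \<in> words (length Vs) \<Longrightarrow> \<Psi> w = 0"
  shows "\<Psi> Vs = 0"
  using assms
proof (induction Vs arbitrary: \<Psi>)
  case (Cons V Vs)
  have "annihilation V \<Psi> Vs = 0"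
  proof (rule Cons.IH)
    show "fock_form (annihilation V \<Psi>)" by (rule fock_form_annihilation) fact
    fix w :: "('a \<times> 'a) list" assume w: "w \<in> words (length Vs)"
    have "((\<lambda>e. cnj (cinner V (e, 0)) * \<Psi> ((e, 0) # w)) has_sum 0) some_basis"
      by (rule has_sum_0) (use Cons.prems(2) w in \<open>auto simp: words_def basis_words_def\<close>)
    with fock_form_expansion[OF Cons.prems(1), of V w] have "\<Psi> (V # w) = 0"
      using has_sum_unique by blast
    then show "annihilation V \<Psi> w = 0" by (simp add: annihilation_def)
  qed
  then show ?case by (simp add: annihilation_def del: of_real_add)
qed simp

section \<open>Weighted domains\<close>

text \<open>The domain of the power \<open>p / 2\<close> of N + 1. One creation or annihilation
  operator costs one unit of \<open>p\<close>, so a product of m of them is defined on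
  \<open>weighted_dom m\<close>, which contains the domain of the m-th power of N.\<close>

definition weighted_dom :: "nat \<Rightarrow> 'a::real_inner fvec set" where
  "weighted_dom p = {\<Psi>. fock_form \<Psi> \<and> summable (\<lambda>n. (real n + 1) ^ p * level \<Psi> n)}"

lemma weighted_dom_0: "weighted_dom 0 = fock"
  by (auto simp: weighted_dom_def fock_iff)

lemma weighted_dom_antimono:
  assumes "p \<le> q" shows "weighted_dom q \<subseteq> weighted_dom p"
proof
  fix \<Psi> :: "'a fvec" assume "\<Psi> \<in> weighted_dom q"
  then have F: "fock_form \<Psi>" and s: "summable (\<lambda>n. (real n + 1) ^ q * level \<Psi> n)"
    by (auto simp: weighted_dom_def)
  have "summable (\<lambda>n. (real n + 1) ^ p * level \<Psi> n)"
  proof (rule summable_comparison_test_ev[OF _ s], intro always_eventually allI)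
    fix n
    have "(real n + 1) ^ p * level \<Psi> n \<le> (real n + 1) ^ q * level \<Psi> n"
      by (intro mult_right_mono power_increasing assms level_nonneg) simp
    then show "norm ((real n + 1) ^ p * level \<Psi> n) \<le> (real n + 1) ^ q * level \<Psi> n"
      by (simp add: abs_mult level_nonneg)
  qed
  with F show "\<Psi> \<in> weighted_dom p" by (simp add: weighted_dom_def)
qed

lemma weighted_dom_subset_fock: "weighted_dom p \<subseteq> fock"
  using weighted_dom_antimono[of 0 p] by (simp add: weighted_dom_0)

lemma weighted_dom_lincomb:
  assumes "\<Phi> \<in> weighted_dom p" "\<Psi> \<in> weighted_dom p"
  shows "(\<lambda>w. a * \<Phi> w + b * \<Psi> w) \<in> weighted_dom p"
proof -
  have F: "fock_form \<Phi>" "fock_form \<Psi>" using assms by (auto simp: weighted_dom_def)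
  have "summable (\<lambda>n. (2 * (cmod a)\<^sup>2) * ((real n + 1) ^ p * level \<Phi> n) + (2 * (cmod b)\<^sup>2) * ((real n + 1) ^ p * level \<Psi> n))"
    using assms by (intro summable_add summable_mult) (auto simp: weighted_dom_def)
  then have "summable (\<lambda>n. (real n + 1) ^ p * level (\<lambda>w. a * \<Phi> w + b * \<Psi> w) n)"
  proof (rule summable_comparison_test_ev[rotated], intro always_eventually allI)
    fix n
    have "(real n + 1) ^ p * level (\<lambda>w. a * \<Phi> w + b * \<Psi> w) n \<le>
        (real n + 1) ^ p * (2 * (cmod a)\<^sup>2 * level \<Phi> n + 2 * (cmod b)\<^sup>2 * level \<Psi> n)"
      by (intro mult_left_mono fock_form_lincomb F) auto
    then show "norm ((real n + 1) ^ p * level (\<lambda>w. a * \<Phi> w + b * \<Psi> w) n) \<le>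
        (2 * (cmod a)\<^sup>2) * ((real n + 1) ^ p * level \<Phi> n) + (2 * (cmod b)\<^sup>2) * ((real n + 1) ^ p * level \<Psi> n)"
      by (simp add: abs_mult level_nonneg algebra_simps)
  qed
  then show ?thesis using fock_form_lincomb[OF F] by (simp add: weighted_dom_def)
qed

lemma weighted_dom_cmult: "\<Psi> \<in> weighted_dom p \<Longrightarrow> (\<lambda>w. a * \<Psi> w) \<in> weighted_dom p"
  using weighted_dom_lincomb[of \<Psi> p \<Psi> a 0] by simp

lemma zero_in_weighted_dom: "(\<lambda>_. 0) \<in> weighted_dom p"
proof -
  have "\<exists>C. \<forall>Vs :: ('a \<times> 'a) list. length Vs = n \<longrightarrow> cmod 0 \<le> C * prod_list (map norm Vs)" for n
    by (rule exI[of _ 0]) simp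
  then show ?thesis by (simp add: weighted_dom_def fock_form_def level_def)
qed

lemma annihilation_weighted_dom:
  fixes \<Psi> :: "'a::{real_inner, second_countable_topology} fvec"
  assumes "\<Psi> \<in> weighted_dom (Suc p)"
  shows "annihilation V \<Psi> \<in> weighted_dom p"
proof -
  have F: "fock_form \<Psi>" and s: "summable (\<lambda>n. (real n + 1) ^ Suc p * level \<Psi> n)"
    using assms by (auto simp: weighted_dom_def)
  have s': "summable (\<lambda>n. (norm V)\<^sup>2 * ((real (Suc n) + 1) ^ Suc p * level \<Psi> (Suc n)))"
    using s by (intro summable_mult) (subst (asm) summable_Suc_iff[symmetric])
  have "summable (\<lambda>n. (real n + 1) ^ p * level (annihilation V \<Psi>) n)"
  proof (rule summable_comparison_test_ev[OF _ s'], intro always_eventually allI)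
    fix n
    have "(real n + 1) ^ p * level (annihilation V \<Psi>) n \<le> (real n + 1) ^ p * ((real n + 1) * (norm V)\<^sup>2 * level \<Psi> (Suc n))"
      by (intro mult_left_mono level_annihilation F) auto
    also have "\<dots> = (real n + 1) ^ Suc p * ((norm V)\<^sup>2 * level \<Psi> (Suc n))" by simp
    also have "\<dots> \<le> (real (Suc n) + 1) ^ Suc p * ((norm V)\<^sup>2 * level \<Psi> (Suc n))"
      by (intro mult_right_mono power_mono) (auto simp: level_nonneg)
    finally show "norm ((real n + 1) ^ p * level (annihilation V \<Psi>) n) \<le>
        (norm V)\<^sup>2 * ((real (Suc n) + 1) ^ Suc p * level \<Psi> (Suc n))"
      by (simp add: abs_mult level_nonneg mult_ac)
  qed
  then show ?thesis using fock_form_annihilation[OF F] by (simp add: weighted_dom_def)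
qed

lemma creation_weighted_dom:
  fixes \<Psi> :: "'a::{real_inner, second_countable_topology} fvec"
  assumes "\<Psi> \<in> weighted_dom (Suc p)"
  shows "creation V \<Psi> \<in> weighted_dom p"
proof -
  have F: "fock_form \<Psi>" and s: "summable (\<lambda>n. (real n + 1) ^ Suc p * level \<Psi> n)"
    using assms by (auto simp: weighted_dom_def)
  have "summable (\<lambda>n. (real (Suc n) + 1) ^ p * level (creation V \<Psi>) (Suc n))"
  proof (rule summable_comparison_test_ev[OF _ summable_mult[OF s]], intro always_eventually allI)
    fix n
    have "(real (Suc n) + 1) ^ p * level (creation V \<Psi>) (Suc n) \<le>
        (2 * (real n + 1)) ^ p * ((real n + 1) * (norm V)\<^sup>2 * level \<Psi> n)"
      by (intro mult_mono power_mono level_creation_Suc F) (auto simp: level_nonneg)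
    also have "\<dots> = (2 ^ p * (norm V)\<^sup>2) * ((real n + 1) ^ Suc p * level \<Psi> n)"
      unfolding power_mult_distrib by simp
    finally show "norm ((real (Suc n) + 1) ^ p * level (creation V \<Psi>) (Suc n)) \<le>
        (2 ^ p * (norm V)\<^sup>2) * ((real n + 1) ^ Suc p * level \<Psi> n)"
      by (simp add: abs_mult level_nonneg)
  qed
  then have "summable (\<lambda>n. (real n + 1) ^ p * level (creation V \<Psi>) n)"
    by (subst (asm) summable_Suc_iff)
  then show ?thesis using fock_form_creation[OF F] by (simp add: weighted_dom_def)
qed

lemma fock_inner_creation:
  fixes \<Psi> :: "'a::{real_inner, second_countable_topology} fvec"
  assumes "\<Phi> \<in> weighted_dom 1" "\<Psi> \<in> weighted_dom 1"
  shows "fock_inner (creation V \<Phi>) \<Psi> = fock_inner \<Phi> (annihilation V \<Psi>)"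
proof -
  have f: "\<Phi> \<in> fock" "\<Psi> \<in> fock" "creation V \<Phi> \<in> fock" "annihilation V \<Psi> \<in> fock"
    using assms weighted_dom_subset_fock[of 1] creation_weighted_dom[of \<Phi> 0]
      annihilation_weighted_dom[of \<Psi> 0] by (auto simp: weighted_dom_0)
  have "level_inner (creation V \<Phi>) \<Psi> sums fock_inner (creation V \<Phi>) \<Psi>"
    by (rule level_inner_sums) (use f in auto)
  then have "(\<lambda>n. level_inner (creation V \<Phi>) \<Psi> (Suc n)) sums fock_inner (creation V \<Phi>) \<Psi>"
    by (subst sums_Suc_iff) simp
  moreover have "(\<lambda>n. level_inner (creation V \<Phi>) \<Psi> (Suc n)) = level_inner \<Phi> (annihilation V \<Psi>)"
    using assms by (auto simp: level_inner_creation weighted_dom_def)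
  ultimately show ?thesis
    using level_inner_sums[OF f(1,4)] sums_unique2 by metis
qed

section \<open>Product vectors\<close>

text \<open>Creation operators applied to the vacuum: for n factors, \<open>sqrt (fact n)\<close>
  times the symmetrized tensor product.\<close>

primrec product_vec :: "('a::real_inner \<times> 'a) list \<Rightarrow> 'a fvec" where
  "product_vec [] = (\<lambda>Ws. if Ws = [] then 1 else 0)"
| "product_vec (V # Vs) = creation V (product_vec Vs)"

lemma fock_form_product_vec:
  "fock_form (product_vec Vs :: 'a::{real_inner, second_countable_topology} fvec)"
proof (induction Vs)
  case Nil
  have "\<exists>C. \<forall>Vs :: ('a \<times> 'a) list. length Vs = n \<longrightarrow> cmod (if Vs = [] then 1 else 0) \<le> C * prod_list (map norm Vs)" for n
    by (rule exI[of _ "if n = 0 then 1 else 0"]) auto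
  moreover have "(\<lambda>w. (cmod (if w = ([] :: ('a \<times> 'a) list) then 1 else 0))\<^sup>2) summable_on words n" for n
    by (cases n) (auto intro!: summable_on_0 simp: words_def)
  ultimately show ?case by (auto simp: fock_form_def)
qed (simp add: fock_form_creation)

lemma product_vec_length:
  "length Ws \<noteq> length Vs \<Longrightarrow> product_vec Vs Ws = 0"
proof (induction Vs arbitrary: Ws)
  case (Cons V Vs)
  have "product_vec Vs (remove_nth j Ws) = 0" if "j < length Ws" for j
    by (rule Cons.IH) (use Cons.prems that in \<open>auto simp: min_def\<close>)
  then show ?case by (simp add: creation_def)
qed auto

text \<open>Moving the creation operators to the other side one by one, as annihilation operators,
  fills the arguments of \<open>\<Phi>\<close>; each contributes one square root to
  \<open>sqrt (fact n)\<close>. So evaluation of a form at any list is an inner product, which later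
  gives its continuity and the Riesz representation.\<close>

lemma level_inner_product_vec:
  fixes \<Phi> :: "'a::{real_inner, second_countable_topology} fvec"
  assumes "fock_form \<Phi>"
  shows "level_inner \<Phi> (product_vec Vs) n = (if n = length Vs then of_real (sqrt (fact n)) * \<Phi> Vs else 0)"
  using assms
proof (induction Vs arbitrary: \<Phi> n)
  case Nil
  show ?case
  proof (cases n)
    case (Suc k)
    then show ?thesis by (auto simp: level_inner_def words_def intro!: infsum_0)
  qed (simp add: level_inner_def)
next
  case (Cons V Vs)
  show ?case
  proof (cases n)
    case 0
    then show ?thesis by (simp add: level_inner_def)
  next
    case (Suc k)
    have e: "sqrt (fact (Suc k)) = sqrt (fact k) * sqrt (real (k + 1))"
      by (simp add: real_sqrt_mult[symmetric] mult.commute)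
    have "level_inner \<Phi> (product_vec (V # Vs)) n = cnj (level_inner (creation V (product_vec Vs)) \<Phi> (Suc k))"
      using Suc by (subst level_inner_commute) simp
    also have "\<dots> = level_inner (annihilation V \<Phi>) (product_vec Vs) k"
      using level_inner_creation[OF fock_form_product_vec Cons.prems] by (subst (2) level_inner_commute) simp
    also have "\<dots> = (if k = length Vs then of_real (sqrt (fact k)) * annihilation V \<Phi> Vs else 0)"
      by (rule Cons.IH) (rule fock_form_annihilation[OF Cons.prems])
    finally show ?thesis
      unfolding Suc length_Cons nat.inject annihilation_def e of_real_mult
      by (simp only: mult.assoc cong: if_cong)
  qed
qed

lemma level_product_vec:
  fixes Vs :: "('a::{real_inner, second_countable_topology} \<times> 'a) list"
  shows "level (product_vec Vs) n \<le> (if n = length Vs then fact n * (prod_list (map norm Vs))\<^sup>2 else 0)"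
proof (induction Vs arbitrary: n)
  case Nil
  show ?case
  proof (cases n)
    case (Suc k)
    then have "level (product_vec [] :: 'a fvec) n = 0" by (auto simp: level_def words_def intro!: infsum_0)
    then show ?thesis using Suc by simp
  qed (simp add: level_def)
next
  case (Cons V Vs)
  show ?case
  proof (cases n)
    case (Suc k)
    have "level (product_vec (V # Vs)) n \<le> (real k + 1) * (norm V)\<^sup>2 * level (product_vec Vs) k"
      unfolding Suc using level_creation_Suc[OF fock_form_product_vec] by simp
    also have "\<dots> \<le> (real k + 1) * (norm V)\<^sup>2 * (if k = length Vs then fact k * (prod_list (map norm Vs))\<^sup>2 else 0)"
      by (intro mult_left_mono Cons.IH) auto
    finally show ?thesis
      using Suc by (cases "k = length Vs") (simp_all add: power_mult_distrib algebra_simps)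
  qed simp
qed

lemma product_vec_weighted_dom:
  "product_vec Vs \<in> (weighted_dom p :: 'a::{real_inner, second_countable_topology} fvec set)"
proof -
  have "summable (\<lambda>n. (real n + 1) ^ p * level (product_vec Vs) n)"
  proof (rule summable_finite[of "{length Vs}"])
    fix n assume "n \<notin> {length Vs}"
    then show "(real n + 1) ^ p * level (product_vec Vs) n = 0"
      using level_product_vec[of Vs n] level_nonneg[of "product_vec Vs" n] by simp
  qed simp
  then show ?thesis by (simp add: weighted_dom_def fock_form_product_vec)
qed

lemma product_vec_replicate:
  assumes "length Ws = n"
  shows "product_vec (replicate n X) Ws = of_real (sqrt (fact n)) * (\<Prod>W\<leftarrow>Ws. cinner X W)"
  using assms
proof (induction n arbitrary: Ws)
  case (Suc n)
  have "product_vec (replicate (Suc n) X) Ws = of_real (1 / sqrt (real (Suc n))) *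
     (\<Sum>j<Suc n. cinner X (Ws ! j) * product_vec (replicate n X) (remove_nth j Ws))"
    using Suc.prems by (simp add: creation_def)
  also have "(\<Sum>j<Suc n. cinner X (Ws ! j) * product_vec (replicate n X) (remove_nth j Ws)) =
      (\<Sum>j<Suc n. of_real (sqrt (fact n)) * (\<Prod>W\<leftarrow>Ws. cinner X W))"
  proof (rule sum.cong)
    fix j assume "j \<in> {..<Suc n}"
    then have j: "j < length Ws" using Suc.prems by simp
    have "product_vec (replicate n X) (remove_nth j Ws) = of_real (sqrt (fact n)) * (\<Prod>W\<leftarrow>remove_nth j Ws. cinner X W)"
      by (rule Suc.IH) (use j Suc.prems in simp)
    then show "cinner X (Ws ! j) * product_vec (replicate n X) (remove_nth j Ws) =
        of_real (sqrt (fact n)) * (\<Prod>W\<leftarrow>Ws. cinner X W)"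
      unfolding prod_list_remove_nth[OF j, of "cinner X", symmetric] by (simp only: mult_ac)
  qed simp
  also have "of_real (1 / sqrt (real (Suc n))) * \<dots> =
      of_real (1 / sqrt (real (Suc n)) * real (Suc n) * sqrt (fact n)) * (\<Prod>W\<leftarrow>Ws. cinner X W)"
    by simp
  also have "1 / sqrt (real (Suc n)) * real (Suc n) * sqrt (fact n) = sqrt (fact (Suc n))"
    by (simp add: real_div_sqrt real_sqrt_mult)
  finally show ?case .
qed simp

section \<open>Coherent vectors\<close>

text \<open>The coherent state without its Gaussian factor, which is not holomorphic. What remains
  is a power series in \<open>X\<close>, with inner products
  \<open>exp (cinner X Y / (2 h))\<close>.\<close>

definition coherent_vec :: "real \<Rightarrow> 'a::real_inner \<times> 'a \<Rightarrow> 'a fvec" where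
  "coherent_vec h X = (\<lambda>Vs. of_real (1 / (sqrt (2 * h) ^ length Vs * sqrt (fact (length Vs)))) * (\<Prod>V\<leftarrow>Vs. cinner X V))"

lemma coherent_eq:
  assumes "h > 0"
  shows "coherent h X = (\<lambda>Vs. of_real (exp (- (norm X)\<^sup>2 / (4 * h))) * coherent_vec h X Vs)"
proof -
  have "(2 * h) powr (real n / 2) = sqrt (2 * h) ^ n" for n
    using assms by (simp add: powr_half_sqrt[symmetric] powr_powr flip: powr_realpow)
  then show ?thesis by (simp add: coherent_def coherent_vec_def fun_eq_iff)
qed

lemma inverse_mult_sqrt: "f > 0 \<Longrightarrow> 1 / (a * sqrt f) = 1 / (a * f) * sqrt f"
  by (simp add: sqrt_divide_self_eq[symmetric] real_div_sqrt divide_inverse)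

lemma coherent_vec_product_vec:
  assumes "length w = n"
  shows "coherent_vec h X w = of_real (1 / (sqrt (2 * h) ^ n * fact n)) * product_vec (replicate n X) w"
proof -
  have "1 / (sqrt (2 * h) ^ n * sqrt (fact n)) = 1 / (sqrt (2 * h) ^ n * fact n) * sqrt (fact n)"
    by (rule inverse_mult_sqrt) simp
  then show ?thesis
    unfolding product_vec_replicate[OF assms] coherent_vec_def assms
    by (simp only: of_real_mult mult.assoc)
qed

lemma fock_form_coherent_vec:
  "fock_form (coherent_vec h X :: 'a::{real_inner, second_countable_topology} fvec)"
  unfolding fock_form_def
proof (intro conjI)
  show "\<forall>V W ws. coherent_vec h X ((V + W) # ws) = coherent_vec h X (V # ws) + coherent_vec h X (W # ws)"
    by (simp only: coherent_vec_def list.map prod_list.Cons cinner_simps length_Cons distrib_left distrib_right) simp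
  show "\<forall>c V ws. coherent_vec h X (cscale c V # ws) = cnj c * coherent_vec h X (V # ws)"
    by (simp only: coherent_vec_def list.map prod_list.Cons cinner_simps length_Cons mult_ac) simp
  show "\<forall>n. \<exists>C. \<forall>Vs. length Vs = n \<longrightarrow> cmod (coherent_vec h X Vs) \<le> C * prod_list (map norm Vs)"
  proof
    fix n
    have "cmod (\<Prod>V\<leftarrow>Vs. cinner X V) \<le> norm X ^ length Vs * prod_list (map norm Vs)" for Vs
    proof (induction Vs)
      case (Cons V Vs)
      have "cmod (\<Prod>V\<leftarrow>V # Vs. cinner X V) \<le> (norm X * norm V) * (norm X ^ length Vs * prod_list (map norm Vs))"
        unfolding list.map prod_list.Cons norm_mult by (intro mult_mono norm_cinner_le Cons.IH) auto
      then show ?case by (simp add: mult_ac)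
    qed simp
    then show "\<exists>C. \<forall>Vs. length Vs = n \<longrightarrow> cmod (coherent_vec h X Vs) \<le> C * prod_list (map norm Vs)"
      by (intro exI[of _ "\<bar>1 / (sqrt (2 * h) ^ n * sqrt (fact n))\<bar> * norm X ^ n"] allI impI)
        (simp only: coherent_vec_def norm_mult norm_of_real mult.assoc, intro mult_left_mono, auto)
  qed
  show "\<forall>Vs Ws. mset Vs = mset Ws \<longrightarrow> coherent_vec h X Vs = coherent_vec h X Ws"
  proof (intro allI impI)
    fix Vs Ws :: "('a \<times> 'a) list" assume m: "mset Vs = mset Ws"
    then have "(\<Prod>V\<leftarrow>Vs. cinner X V) = (\<Prod>V\<leftarrow>Ws. cinner X V)"
      by (metis mset_map prod_mset_prod_list)
    then show "coherent_vec h X Vs = coherent_vec h X Ws"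
      using mset_eq_length[OF m] by (simp add: coherent_vec_def)
  qed
  show "\<forall>n. (\<lambda>w. (cmod (coherent_vec h X w))\<^sup>2) summable_on words n"
  proof
    fix n
    define c where "c = complex_of_real (1 / (sqrt (2 * h) ^ n * fact n))"
    have cv: "coherent_vec h X w = c * product_vec (replicate n X) w" if "w \<in> words n" for w
      using that unfolding c_def words_def by (intro coherent_vec_product_vec) simp
    have "(\<lambda>w. (cmod c)\<^sup>2 * (cmod (product_vec (replicate n X) w))\<^sup>2) summable_on words n"
      by (intro summable_on_cmult_right fock_form_summable fock_form_product_vec)
    then show "(\<lambda>w. (cmod (coherent_vec h X w))\<^sup>2) summable_on words n"
      by (rule summable_on_cong[THEN iffD1, rotated])
        (simp add: cv norm_mult power_mult_distrib)
  qed
qed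

lemma level_inner_coherent_vec:
  fixes \<Phi> :: "'a::{real_inner, second_countable_topology} fvec"
  assumes "fock_form \<Phi>"
  shows "level_inner \<Phi> (coherent_vec h X) n = \<Phi> (replicate n X) / of_real (sqrt (2 * h) ^ n * sqrt (fact n))"
proof -
  define c where "c = complex_of_real (1 / (sqrt (2 * h) ^ n * fact n))"
  have cc: "cnj c = c" by (simp add: c_def)
  have cv: "coherent_vec h X w = c * product_vec (replicate n X) w" if "w \<in> words n" for w
    using that unfolding c_def words_def by (intro coherent_vec_product_vec) simp
  have "level_inner \<Phi> (coherent_vec h X) n = (\<Sum>\<^sub>\<infinity>w\<in>words n. c * (\<Phi> w * cnj (product_vec (replicate n X) w)))"
    unfolding level_inner_def
    by (rule infsum_cong) (simp add: cv cc mult_ac)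
  also have "\<dots> = c * level_inner \<Phi> (product_vec (replicate n X)) n"
    by (simp add: level_inner_def infsum_cmult_right')
  also have "\<dots> = of_real (1 / (sqrt (2 * h) ^ n * fact n) * sqrt (fact n)) * \<Phi> (replicate n X)"
    by (simp add: level_inner_product_vec[OF assms] c_def)
  also have "1 / (sqrt (2 * h) ^ n * fact n) * sqrt (fact n) = 1 / (sqrt (2 * h) ^ n * sqrt (fact n))"
    by (rule inverse_mult_sqrt[symmetric]) simp
  finally show ?thesis by simp
qed

lemma level_inner_coherent_vec_coherent_vec:
  fixes X Y :: "'a::{real_inner, second_countable_topology} \<times> 'a"
  assumes "h > 0"
  shows "level_inner (coherent_vec h X) (coherent_vec h Y) n = (cinner X Y / of_real (2 * h)) ^ n / fact n"
proof -
  define d where "d = sqrt (2 * h) ^ n * sqrt (fact n)"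
  have "d * d = (sqrt (2 * h) * sqrt (2 * h)) ^ n * (sqrt (fact n) * sqrt (fact n))"
    unfolding d_def by (simp only: power_mult_distrib mult_ac)
  also have "\<dots> = (2 * h) ^ n * fact n" using assms by simp
  finally have dd: "complex_of_real d * of_real d = of_real ((2 * h) ^ n * fact n)"
    by (simp only: of_real_mult[symmetric])
  have "coherent_vec h X (replicate n Y) = of_real (1 / d) * cinner X Y ^ n"
    by (simp add: coherent_vec_def d_def)
  then have "level_inner (coherent_vec h X) (coherent_vec h Y) n = cinner X Y ^ n / (of_real d * of_real d)"
    unfolding level_inner_coherent_vec[OF fock_form_coherent_vec] d_def[symmetric] by simp
  then show ?thesis unfolding dd by (simp add: power_divide)
qed

lemma level_coherent_vec:
  fixes X :: "'a::{real_inner, second_countable_topology} \<times> 'a"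
  assumes "h > 0"
  shows "level (coherent_vec h X) n = ((norm X)\<^sup>2 / (2 * h)) ^ n / fact n"
proof -
  have "complex_of_real (level (coherent_vec h X) n) = of_real (((norm X)\<^sup>2 / (2 * h)) ^ n / fact n)"
    using level_inner_coherent_vec_coherent_vec[OF assms, of X X n]
    by (simp add: level_inner_self fock_form_coherent_vec cinner_self)
  then show ?thesis using of_real_eq_iff by blast
qed

lemma coherent_vec_weighted_dom:
  assumes "h > 0"
  shows "coherent_vec h X \<in> (weighted_dom p :: 'a::{real_inner, second_countable_topology} fvec set)"
proof -
  define x where "x = (norm X)\<^sup>2 / (2 * h)"
  have x: "x \<ge> 0" using assms by (simp add: x_def)
  \<comment> \<open>A power is at most a factorial times the exponential series containing it; the
    resulting factor \<open>exp 1 ^ n\<close> is absorbed by the factorial in the n-th level of the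
    coherent vector.\<close>
  have e: "(real n + 1) ^ p \<le> fact p * exp (real n + 1)" for n
  proof -
    have "(\<Sum>k\<in>{p}. (real n + 1) ^ k /\<^sub>R fact k) \<le> (\<Sum>k. (real n + 1) ^ k /\<^sub>R fact k)"
      by (rule sum_le_suminf[OF summable_exp_generic]) simp_all
    then have "(real n + 1) ^ p /\<^sub>R fact p \<le> exp (real n + 1)" by (simp add: exp_def)
    then show ?thesis by (simp add: field_simps)
  qed
  have "summable (\<lambda>n. (fact p * exp 1) * ((exp 1 * x) ^ n /\<^sub>R fact n))"
    by (intro summable_mult summable_exp_generic)
  then have "summable (\<lambda>n. (real n + 1) ^ p * level (coherent_vec h X) n)"
  proof (rule summable_comparison_test_ev[rotated], intro always_eventually allI)
    fix n
    have "(real n + 1) ^ p * (x ^ n / fact n) \<le> (fact p * exp (real n + 1)) * (x ^ n / fact n)"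
      by (intro mult_right_mono e) (use x in auto)
    also have "exp (real n + 1) = exp 1 * exp 1 ^ n"
      using exp_of_nat_mult[of n "1::real"] by (simp add: exp_add)
    finally have "(real n + 1) ^ p * (x ^ n / fact n) \<le> (fact p * (exp 1 * exp 1 ^ n)) * (x ^ n / fact n)" .
    moreover have "norm ((real n + 1) ^ p * level (coherent_vec h X) n) = (real n + 1) ^ p * (x ^ n / fact n)"
      unfolding level_coherent_vec[OF assms] x_def[symmetric] real_norm_def
      by (rule abs_of_nonneg) (use x in simp)
    moreover have "(fact p * (exp 1 * exp 1 ^ n)) * (x ^ n / fact n) = (fact p * exp 1) * ((exp 1 * x) ^ n /\<^sub>R fact n)"
      unfolding power_mult_distrib real_scaleR_def divide_inverse by (simp only: mult_ac)
    ultimately show "norm ((real n + 1) ^ p * level (coherent_vec h X) n) \<le> (fact p * exp 1) * ((exp 1 * x) ^ n /\<^sub>R fact n)"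
      by (simp only:)
  qed
  then show ?thesis by (simp add: weighted_dom_def fock_form_coherent_vec)
qed

lemma coherent_vec_fock:
  "h > 0 \<Longrightarrow> coherent_vec h X \<in> (fock :: 'a::{real_inner, second_countable_topology} fvec set)"
  using coherent_vec_weighted_dom[of h X 0] by (simp add: weighted_dom_0)

lemma exp_sums_divide_fact: "(\<lambda>n. z ^ n / fact n) sums exp z" for z :: complex
proof -
  have "(\<lambda>n. z ^ n / fact n) = (\<lambda>n. z ^ n /\<^sub>R fact n)"
    by (rule ext) (simp add: scaleR_conv_of_real field_simps)
  then show ?thesis using exp_converges[of z] by (simp only:)
qed

lemma fock_inner_coherent_vec:
  fixes X Y :: "'a::{real_inner, second_countable_topology} \<times> 'a"
  assumes "h > 0"
  shows "fock_inner (coherent_vec h X) (coherent_vec h Y) = exp (cinner X Y / of_real (2 * h))"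
proof -
  have "(\<lambda>n. (cinner X Y / of_real (2 * h)) ^ n / fact n) sums fock_inner (coherent_vec h X) (coherent_vec h Y)"
    using level_inner_sums[OF coherent_vec_fock[OF assms] coherent_vec_fock[OF assms]]
    unfolding level_inner_coherent_vec_coherent_vec[OF assms, abs_def] .
  moreover have "(\<lambda>n. (cinner X Y / of_real (2 * h)) ^ n / fact n) sums exp (cinner X Y / of_real (2 * h))"
    by (rule exp_sums_divide_fact)
  ultimately show ?thesis by (rule sums_unique2)
qed

text \<open>Prefixing \<open>V\<close> to the list brings out one factor \<open>cinner X V\<close>
  and one factor \<open>1 / sqrt (2 h)\<close>; the square root in \<open>annihilation\<close>
  cancels the growth of the factorial.\<close>

lemma annihilation_coherent_vec:
  "annihilation V (coherent_vec h X) = (\<lambda>w. cinner X V / of_real (sqrt (2 * h)) * coherent_vec h X w)"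
proof
  fix w :: "('a \<times> 'a) list"
  have "sqrt (real (length w + 1)) * (1 / (sqrt (2 * h) ^ Suc (length w) * sqrt (fact (Suc (length w))))) =
      1 / sqrt (2 * h) * (1 / (sqrt (2 * h) ^ length w * sqrt (fact (length w))))"
    by (simp add: real_sqrt_mult)
  then have e: "complex_of_real (sqrt (real (length w + 1))) * of_real (1 / (sqrt (2 * h) ^ Suc (length w) * sqrt (fact (Suc (length w))))) =
      of_real (1 / sqrt (2 * h)) * of_real (1 / (sqrt (2 * h) ^ length w * sqrt (fact (length w))))"
    by (simp only: of_real_mult[symmetric])
  have "annihilation V (coherent_vec h X) w =
      (complex_of_real (sqrt (real (length w + 1))) *
       of_real (1 / (sqrt (2 * h) ^ Suc (length w) * sqrt (fact (Suc (length w)))))) *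
      (cinner X V * (\<Prod>V\<leftarrow>w. cinner X V))"
    by (simp only: annihilation_def coherent_vec_def list.map prod_list.Cons length_Cons mult.assoc)
  also have "\<dots> = cinner X V / of_real (sqrt (2 * h)) * coherent_vec h X w"
    unfolding e coherent_vec_def by simp
  finally show "annihilation V (coherent_vec h X) w = cinner X V / of_real (sqrt (2 * h)) * coherent_vec h X w" .
qed

section \<open>The Fock space as a real inner product space\<close>

lemma fock_lincomb:
  "\<Phi> \<in> fock \<Longrightarrow> \<Psi> \<in> fock \<Longrightarrow> (\<lambda>w. a * \<Phi> w + b * \<Psi> w) \<in> fock"
  using weighted_dom_lincomb[of \<Phi> 0 \<Psi> a b] by (simp add: weighted_dom_0)

lemma fock_inner_has_sum:
  assumes "\<Phi> \<in> fock" "\<Psi> \<in> fock"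
  shows "((\<lambda>w. \<Phi> w * cnj (\<Psi> w)) has_sum fock_inner \<Phi> \<Psi>) basis_words"
proof -
  have "(\<lambda>w. cmod (\<Phi> w * cnj (\<Psi> w))) summable_on basis_words"
    by (rule sq_summable_product) (use assms in \<open>simp_all add: fock_summable\<close>)
  then have "(\<lambda>w. \<Phi> w * cnj (\<Psi> w)) summable_on basis_words"
    by (rule abs_summable_summable)
  then show ?thesis by (simp add: fock_inner_def)
qed

lemma fock_inner_lincomb:
  assumes "\<Phi> \<in> fock" "\<Psi> \<in> fock" "\<Theta> \<in> fock"
  shows "fock_inner (\<lambda>w. a * \<Phi> w + b * \<Psi> w) \<Theta> = a * fock_inner \<Phi> \<Theta> + b * fock_inner \<Psi> \<Theta>"
proof -
  have "((\<lambda>w. a * (\<Phi> w * cnj (\<Theta> w)) + b * (\<Psi> w * cnj (\<Theta> w))) has_sum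
      a * fock_inner \<Phi> \<Theta> + b * fock_inner \<Psi> \<Theta>) basis_words"
    by (intro has_sum_add has_sum_cmult_right fock_inner_has_sum assms)
  then show ?thesis by (simp add: fock_inner_def has_sum_iff algebra_simps)
qed

lemma fock_inner_commute: "fock_inner \<Phi> \<Psi> = cnj (fock_inner \<Psi> \<Phi>)"
  unfolding fock_inner_def infsum_cnj[symmetric] by (simp add: mult.commute)

lemma fock_inner_self:
  assumes "\<Psi> \<in> fock"
  shows "fock_inner \<Psi> \<Psi> = of_real (\<Sum>\<^sub>\<infinity>w\<in>basis_words. (cmod (\<Psi> w))\<^sup>2)"
proof -
  have "((\<lambda>w. complex_of_real ((cmod (\<Psi> w))\<^sup>2)) has_sum of_real (\<Sum>\<^sub>\<infinity>w\<in>basis_words. (cmod (\<Psi> w))\<^sup>2)) basis_words"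
    by (intro has_sum_of_real has_sum_infsum fock_summable assms)
  then show ?thesis unfolding fock_inner_def complex_norm_square by (simp add: has_sum_iff)
qed

text \<open>The inner product sees only the values on basis words, but these determine the
  form.\<close>

lemma fock_inner_self_eq_0:
  fixes \<Psi> :: "'a::{real_inner, second_countable_topology} fvec"
  assumes "\<Psi> \<in> fock" "Re (fock_inner \<Psi> \<Psi>) = 0"
  shows "\<Psi> = (\<lambda>_. 0)"
proof
  fix Vs
  have z: "\<Psi> w = 0" if "w \<in> basis_words" for w
    using nonneg_infsum_le_0D[OF _ fock_summable[OF assms(1)], of w] assms(2) that
    by (simp add: fock_inner_self[OF assms(1)])
  show "\<Psi> Vs = 0"
    by (rule fock_form_eq_0) (use assms(1) z in \<open>auto simp: fock_iff words_def\<close>)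
qed

text \<open>As a type of class \<open>real_inner\<close> the Fock space inherits closures, limits
  and bounded linear maps. Its complex structure is carried by \<open>cmul\<close> and
  \<open>cip\<close>.\<close>

typedef (overloaded) 'a fk = "fock :: 'a::{real_inner, second_countable_topology} fvec set"
  morphisms fv Fk
  using zero_in_weighted_dom[of 0] by (auto simp: weighted_dom_0)

lemma fv_fock [simp]: "fv x \<in> fock" by (rule fv)

definition cmul :: "complex \<Rightarrow> 'a::{real_inner, second_countable_topology} fk \<Rightarrow> 'a fk" where
  "cmul c x = Fk (\<lambda>w. c * fv x w)"

definition cip :: "'a::{real_inner, second_countable_topology} fk \<Rightarrow> 'a fk \<Rightarrow> complex" where
  "cip x y = fock_inner (fv x) (fv y)"

lemma fv_cmul: "fv (cmul c x) = (\<lambda>w. c * fv x w)"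
  unfolding cmul_def using fock_lincomb[of "fv x" "fv x" c 0] by (simp add: Fk_inverse)

instantiation fk :: ("{real_inner, second_countable_topology}") real_inner
begin

definition "0 = Fk (\<lambda>_. 0)"
definition "x + y = Fk (\<lambda>w. fv x w + fv y w)"
definition "x - y = Fk (\<lambda>w. fv x w - fv y w)"
definition "- x = cmul (-1) x" for x :: "'a fk"
definition "r *\<^sub>R x = cmul (of_real r) x" for x :: "'a fk"
definition "inner x y = Re (cip x y)"
definition "norm x = sqrt (inner x x)" for x :: "'a fk"
definition "dist x y = norm (x - y)" for x y :: "'a fk"
definition "sgn x = cmul (of_real (inverse (norm x))) x" for x :: "'a fk"
definition "(uniformity :: ('a fk \<times> 'a fk) filter) = (INF e\<in>{0<..}. principal {(x, y). dist x y < e})"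
definition "open U = (\<forall>x\<in>U. eventually (\<lambda>(x', y). x' = x \<longrightarrow> y \<in> U) uniformity)" for U :: "'a fk set"

lemma fv_zero: "fv (0 :: 'a fk) = (\<lambda>_. 0)"
  unfolding zero_fk_def using zero_in_weighted_dom[where 'a = 'a, of 0] by (simp add: Fk_inverse weighted_dom_0)

lemma fv_plus: "fv (x + y :: 'a fk) = (\<lambda>w. fv x w + fv y w)"
  unfolding plus_fk_def using fock_lincomb[of "fv x" "fv y" 1 1] by (simp add: Fk_inverse)

lemma fv_minus: "fv (x - y :: 'a fk) = (\<lambda>w. fv x w - fv y w)"
  unfolding minus_fk_def using fock_lincomb[of "fv x" "fv y" 1 "-1"] by (simp add: Fk_inverse)

lemma fv_uminus: "fv (- x :: 'a fk) = (\<lambda>w. - fv x w)"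
  by (simp add: uminus_fk_def fv_cmul)

lemma fv_scaleR: "fv (r *\<^sub>R x :: 'a fk) = (\<lambda>w. of_real r * fv x w)"
  by (simp add: scaleR_fk_def fv_cmul)

lemma cip_add_left: "cip (x + y) (z :: 'a fk) = cip x z + cip y z"
  using fock_inner_lincomb[of "fv x" "fv y" "fv z" 1 1] by (simp add: cip_def fv_plus)

lemma cip_cmul_left: "cip (cmul c x) (z :: 'a fk) = c * cip x z"
  using fock_inner_lincomb[of "fv x" "fv x" "fv z" c 0] by (simp add: cip_def fv_cmul)

lemma cip_commute: "cip x (y :: 'a fk) = cnj (cip y x)"
  unfolding cip_def by (rule fock_inner_commute)

instance
proof
  fix x y z :: "'a fk" and a b :: real
  show "dist x y = norm (x - y)" by (simp add: dist_fk_def)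
  show "x + y + z = x + (y + z)" by (simp add: fv_inject[symmetric] fv_plus add.assoc)
  show "x + y = y + x" by (simp add: fv_inject[symmetric] fv_plus add.commute)
  show "0 + x = x" by (simp add: fv_inject[symmetric] fv_plus fv_zero)
  show "- x + x = 0" by (simp add: fv_inject[symmetric] fv_plus fv_zero fv_uminus)
  show "x - y = x + - y" by (simp add: fv_inject[symmetric] fv_plus fv_minus fv_uminus)
  show "a *\<^sub>R (x + y) = a *\<^sub>R x + a *\<^sub>R y" by (simp add: fv_inject[symmetric] fv_plus fv_scaleR algebra_simps)
  show "(a + b) *\<^sub>R x = a *\<^sub>R x + b *\<^sub>R x" by (simp add: fv_inject[symmetric] fv_plus fv_scaleR algebra_simps)
  show "a *\<^sub>R b *\<^sub>R x = (a * b) *\<^sub>R x" by (simp add: fv_inject[symmetric] fv_scaleR mult.assoc)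
  show "1 *\<^sub>R x = x" by (simp add: fv_inject[symmetric] fv_scaleR)
  show "sgn x = scaleR (inverse (norm x)) x" by (simp add: sgn_fk_def scaleR_fk_def)
  show "inner x y = inner y x" unfolding inner_fk_def by (subst cip_commute) simp
  show "inner (x + y) z = inner x z + inner y z" by (simp add: inner_fk_def cip_add_left)
  show "inner (a *\<^sub>R x) y = a * inner x y" by (simp add: inner_fk_def scaleR_fk_def cip_cmul_left)
  show "0 \<le> inner x x"
    unfolding inner_fk_def cip_def fock_inner_self[OF fv_fock] by (simp add: infsum_nonneg)
  show "inner x x = 0 \<longleftrightarrow> x = 0"
  proof
    assume "inner x x = 0"
    then have "fv x = (\<lambda>_. 0)" by (intro fock_inner_self_eq_0) (simp_all add: inner_fk_def cip_def)
    then show "x = 0" by (simp add: fv_inject[symmetric] fv_zero)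
  next
    assume "x = 0"
    then show "inner x x = 0" by (simp add: inner_fk_def cip_def fv_zero fock_inner_def)
  qed
  show "norm x = sqrt (inner x x)" by (simp add: norm_fk_def)
  show "uniformity = (INF e\<in>{0<..}. principal {(x :: 'a fk, y). dist x y < e})" by (rule uniformity_fk_def)
  show "open U = (\<forall>x\<in>U. eventually (\<lambda>(x', y). x' = x \<longrightarrow> y \<in> U) uniformity)" for U :: "'a fk set"
    by (rule open_fk_def)
qed

end

lemma cip_add_right: "cip z (x + y) = cip z x + cip z y"
  by (simp add: cip_commute[of z] cip_add_left)

lemma cip_cmul_right: "cip z (cmul c x) = cnj c * cip z x"
  by (simp add: cip_commute[of z] cip_cmul_left)

lemma Re_cip: "Re (cip x y) = inner x y"
  by (simp add: inner_fk_def)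

lemma cip_self: "cip x x = of_real ((norm x)\<^sup>2)"
proof -
  have "cip x x = of_real (\<Sum>\<^sub>\<infinity>w\<in>basis_words. (cmod (fv x w))\<^sup>2)"
    unfolding cip_def by (rule fock_inner_self) simp
  moreover from this have "(norm x)\<^sup>2 = (\<Sum>\<^sub>\<infinity>w\<in>basis_words. (cmod (fv x w))\<^sup>2)"
    unfolding power2_norm_eq_inner Re_cip[symmetric] by simp
  ultimately show ?thesis by simp
qed

lemma fock_norm_fv: "fock_norm (fv x) = norm x"
  unfolding fock_norm_def norm_eq_sqrt_inner Re_cip[symmetric] cip_def ..

lemma norm_cmul: "norm (cmul c x) = cmod c * norm x"
proof -
  have "complex_of_real ((norm (cmul c x))\<^sup>2) = of_real ((cmod c * norm x)\<^sup>2)"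
    unfolding cip_self[symmetric] cip_cmul_left cip_cmul_right power_mult_distrib of_real_mult
      complex_norm_square by (simp only: mult_ac)
  then have "(norm (cmul c x))\<^sup>2 = (cmod c * norm x)\<^sup>2" using of_real_eq_iff by blast
  then show ?thesis by simp
qed

lemma cmul_add: "cmul c (x + y) = cmul c x + cmul c y"
  and cmul_cmul: "cmul a (cmul b x) = cmul (a * b) x"
  and scaleR_cmul: "r *\<^sub>R x = cmul (of_real r) x"
  and cmul_one: "cmul 1 x = x"
  by (simp_all add: fv_inject[symmetric] fv_plus fv_cmul fv_scaleR algebra_simps)

lemma bounded_linear_cmul: "bounded_linear (cmul c)"
  by (rule bounded_linear_intro[where K = "cmod c"])
    (simp_all add: cmul_add scaleR_cmul cmul_cmul norm_cmul mult.commute)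

lemma norm_cip_le: "cmod (cip x y) \<le> norm x * norm y"
proof (cases "cip x y = 0")
  case False
  define u where "u = cnj (sgn (cip x y))"
  have u: "cmod u = 1" using False by (simp add: u_def norm_sgn)
  have "u * cip x y = of_real (cmod (cip x y))"
    using False by (simp add: u_def sgn_eq field_simps complex_norm_square[symmetric] power2_eq_square)
  then have "cmod (cip x y) = Re (cip (cmul u x) y)" by (simp add: cip_cmul_left)
  also have "\<dots> \<le> norm (cmul u x) * norm y" unfolding Re_cip by (rule norm_cauchy_schwarz)
  finally show ?thesis by (simp add: norm_cmul u)
qed simp

lemma bounded_linear_cip_left: "bounded_linear (\<lambda>x. cip x y)"
  by (rule bounded_linear_intro[where K = "norm y"])
    (simp_all add: cip_add_left scaleR_cmul cip_cmul_left scaleR_conv_of_real norm_cip_le)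

lemma bounded_linear_cip_right: "bounded_linear (cip x)"
  by (rule bounded_linear_intro[where K = "norm x"])
    (simp_all add: cip_add_right scaleR_cmul cip_cmul_right scaleR_conv_of_real norm_cip_le mult.commute[of "norm x"],
     metis mult.commute norm_cip_le)

lemma cip_extensionality:
  assumes "\<And>z. cip z x = cip z y" shows "x = y"
proof -
  have "cip (x - y) (x + cmul (-1) y) = 0"
    using assms[of "x - y"] by (simp add: cip_add_right cip_cmul_right)
  moreover have "x + cmul (-1) y = x - y"
    by (simp add: fv_inject[symmetric] fv_plus fv_minus fv_cmul)
  ultimately show ?thesis by (simp add: cip_self)
qed

lemma fv_sum: "fv (\<Sum>i\<in>I. f i) = (\<lambda>w. \<Sum>i\<in>I. fv (f i) w)"
  by (induction I rule: infinite_finite_induct) (simp_all add: fv_zero fv_plus)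

lemma fock_form_fv: "fock_form (fv x)"
  using fv_fock[of x] by (simp add: fock_iff)

lemma level_sums_norm: "level (fv x) sums (norm x)\<^sup>2"
proof -
  have "level_inner (fv x) (fv x) sums cip x x"
    unfolding cip_def by (rule level_inner_sums) simp_all
  then have "(\<lambda>n. level_inner (fv x) (fv x) n) sums cip x x" by simp
  then have "(\<lambda>n. complex_of_real (level (fv x) n)) sums of_real ((norm x)\<^sup>2)"
    using level_inner_self[OF fock_form_fv, of x] by (simp add: cip_self)
  then show ?thesis by (simp only: sums_of_real_iff)
qed

section \<open>Product vectors and coherent vectors as points of the inner product space\<close>

definition pvec :: "('a::{real_inner, second_countable_topology} \<times> 'a) list \<Rightarrow> 'a fk" where
  "pvec Vs = Fk (product_vec Vs)"

definition evec :: "real \<Rightarrow> 'a::{real_inner, second_countable_topology} \<times> 'a \<Rightarrow> 'a fk" where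
  "evec h X = Fk (coherent_vec h X)"

lemma fv_pvec: "fv (pvec Vs) = product_vec Vs"
  unfolding pvec_def using product_vec_weighted_dom[of Vs 0] by (simp add: Fk_inverse weighted_dom_0)

lemma fv_evec: "h > 0 \<Longrightarrow> fv (evec h X) = coherent_vec h X"
  unfolding evec_def by (simp add: Fk_inverse coherent_vec_fock)

lemma cip_evec: "h > 0 \<Longrightarrow> cip (evec h X) (evec h Y) = exp (cinner X Y / of_real (2 * h))"
  by (simp add: cip_def fv_evec fock_inner_coherent_vec)

lemma norm_evec:
  assumes "h > 0"
  shows "norm (evec h X) = exp ((norm X)\<^sup>2 / (4 * h))"
proof -
  have "complex_of_real ((norm (evec h X))\<^sup>2) = of_real (exp ((norm X)\<^sup>2 / (2 * h)))"
    unfolding cip_self[symmetric] cip_evec[OF assms] cinner_self by (simp flip: exp_of_real)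
  then have "(norm (evec h X))\<^sup>2 = exp ((norm X)\<^sup>2 / (2 * h))" using of_real_eq_iff by blast
  also have "\<dots> = (exp ((norm X)\<^sup>2 / (4 * h)))\<^sup>2"
    by (simp add: exp_double[symmetric])
  finally show ?thesis by simp
qed

lemma cip_pvec: "cip x (pvec Vs) = of_real (sqrt (fact (length Vs))) * fv x Vs"
proof -
  have "fock_form (fv x)" using fv_fock[of x] by (simp add: fock_iff)
  then have "level_inner (fv x) (fv (pvec Vs)) =
      (\<lambda>n. if n = length Vs then of_real (sqrt (fact n)) * fv x Vs else 0)"
    unfolding fv_pvec by (intro ext) (rule level_inner_product_vec)
  moreover have "level_inner (fv x) (fv (pvec Vs)) sums cip x (pvec Vs)"
    unfolding cip_def by (rule level_inner_sums) simp_all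
  ultimately have "(\<lambda>n. if n = length Vs then of_real (sqrt (fact n)) * fv x Vs else 0) sums cip x (pvec Vs)"
    by simp
  from sums_unique2[OF this sums_single] show ?thesis by simp
qed

lemma norm_pvec_le: "norm (pvec Vs) \<le> sqrt (fact (length Vs)) * prod_list (map norm Vs)"
proof -
  have nn: "prod_list (map norm Vs) \<ge> 0" by (induction Vs) auto
  have "(norm (pvec Vs))\<^sup>2 \<le> fact (length Vs) * (prod_list (map norm Vs))\<^sup>2"
    using sums_le[OF _ level_sums_norm[of "pvec Vs"] sums_single[of "length Vs" "\<lambda>n. fact n * (prod_list (map norm Vs))\<^sup>2"]]
      level_product_vec[of Vs] by (simp add: fv_pvec)
  also have "\<dots> = (sqrt (fact (length Vs)) * prod_list (map norm Vs))\<^sup>2"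
    by (simp add: power_mult_distrib)
  finally show ?thesis by (rule power2_le_imp_le) (use nn in simp)
qed

text \<open>The factor \<open>sqrt (fact n)\<close> occurs both in the pairing with the product
  vector and in the bound for its norm. It cancels, which leaves a constant independent of the
  length.\<close>

lemma fv_bound: "cmod (fv x Vs) \<le> norm x * prod_list (map norm Vs)"
proof -
  have "sqrt (fact (length Vs)) * cmod (fv x Vs) = cmod (cip x (pvec Vs))"
    unfolding cip_pvec by (simp add: norm_mult)
  also have "\<dots> \<le> norm x * (sqrt (fact (length Vs)) * prod_list (map norm Vs))"
    by (rule order.trans[OF norm_cip_le]) (intro mult_left_mono norm_pvec_le norm_ge_zero)
  also have "\<dots> = sqrt (fact (length Vs)) * (norm x * prod_list (map norm Vs))" by simp
  finally show ?thesis by (subst (asm) mult_le_cancel_left_pos) simp_all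
qed

lemma pvec_sym: "mset Vs = mset Ws \<Longrightarrow> pvec Vs = pvec Ws"
  using mset_eq_length[of Vs Ws] fock_form_sym[OF fock_form_fv, of Vs Ws]
  by (intro cip_extensionality) (simp add: cip_pvec)

lemma pvec_add: "pvec ((V + W) # Vs) = pvec (V # Vs) + pvec (W # Vs)"
  and pvec_cscale: "pvec (cscale c V # Vs) = cmul c (pvec (V # Vs))"
  by (simp_all add: fv_inject[symmetric] fv_pvec fv_plus fv_cmul creation_def cinner_simps
      fun_eq_iff distrib_left distrib_right sum.distrib sum_distrib_left mult_ac)

section \<open>Density of the coherent states\<close>

definition csubspace :: "'a::{real_inner, second_countable_topology} fk set \<Rightarrow> bool" where
  "csubspace C \<longleftrightarrow> subspace C \<and> (\<forall>c. \<forall>x\<in>C. cmul c x \<in> C)"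

text \<open>Cutting off the coefficients of \<open>x\<close> outside a finite set \<open>S\<close>
  of words would destroy symmetry. The vector \<open>y\<close> is instead a combination of product
  vectors such that pairing with \<open>y\<close> is the part over \<open>S\<close> of the pairing
  with \<open>x\<close>. Pairing with \<open>x - y\<close> is then the tail, and taking
  \<open>x - y\<close> itself as test vector bounds its norm by Cauchy-Schwarz.\<close>

lemma csubspace_pvec_UNIV:
  assumes C: "closed C" "csubspace C" and P: "\<And>Vs. pvec Vs \<in> C"
  shows "x \<in> C"
proof (rule closed_approachable[THEN iffD1, OF C(1)], intro allI impI)
  fix \<epsilon> :: real assume e: "\<epsilon> > 0"
  have hx: "((\<lambda>w. (cmod (fv x w))\<^sup>2) has_sum (\<Sum>\<^sub>\<infinity>w\<in>basis_words. (cmod (fv x w))\<^sup>2)) basis_words"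
    by (intro has_sum_infsum fock_summable) simp
  obtain S where S: "finite S" "S \<subseteq> basis_words"
    "dist (\<Sum>w\<in>S. (cmod (fv x w))\<^sup>2) (\<Sum>\<^sub>\<infinity>w\<in>basis_words. (cmod (fv x w))\<^sup>2) \<le> (\<epsilon> / 2)\<^sup>2"
    using has_sum_finite_approximation[OF hx, of "(\<epsilon> / 2)\<^sup>2"] e by auto
  define g where "g = (\<lambda>w. if w \<in> S then 0 else cnj (fv x w))"
  have xs: "(\<lambda>w. (cmod (fv x w))\<^sup>2) summable_on basis_words" by (simp add: fock_summable)
  have gh: "((\<lambda>w. (cmod (g w))\<^sup>2) has_sum ((\<Sum>\<^sub>\<infinity>w\<in>basis_words. (cmod (fv x w))\<^sup>2) - (\<Sum>w\<in>S. (cmod (fv x w))\<^sup>2))) basis_words"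
  proof -
    have "((\<lambda>w. if w \<in> S then (cmod (fv x w))\<^sup>2 else 0) has_sum (\<Sum>w\<in>S. (cmod (fv x w))\<^sup>2)) basis_words"
      by (rule has_sum_cong_neutral[THEN iffD1, OF _ _ _ has_sum_finite[OF S(1)]]) (use S(2) in auto)
    from has_sum_diff[OF has_sum_infsum[OF xs] this] show ?thesis
      by (rule has_sum_cong[THEN iffD1, rotated]) (auto simp: g_def)
  qed
  define y where "y = (\<Sum>w\<in>S. cmul (fv x w / of_real (sqrt (fact (length w)))) (pvec w))"
  have yC: "y \<in> C"
    unfolding y_def using C(2) P by (intro subspace_sum) (auto simp: csubspace_def)
  have cipy: "cip z y = (\<Sum>w\<in>S. fv z w * cnj (fv x w))" for z
  proof -
    have "cip z y = (\<Sum>w\<in>S. cip z (cmul (fv x w / of_real (sqrt (fact (length w)))) (pvec w)))"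
      unfolding y_def by (rule bounded_linear.linear[OF bounded_linear_cip_right, THEN linear_sum])
    also have "\<dots> = (\<Sum>w\<in>S. fv z w * cnj (fv x w))"
      by (rule sum.cong) (simp_all add: cip_cmul_right cip_pvec)
    finally show ?thesis .
  qed
  have "cip z (x - y) = (\<Sum>\<^sub>\<infinity>w\<in>basis_words. fv z w * g w)" for z
  proof -
    have "((\<lambda>w. if w \<in> S then fv z w * cnj (fv x w) else 0) has_sum cip z y) basis_words"
      unfolding cipy
      by (rule has_sum_cong_neutral[THEN iffD1, OF _ _ _ has_sum_finite[OF S(1)]]) (use S(2) in auto)
    from has_sum_diff[OF fock_inner_has_sum[OF fv_fock fv_fock, of z x] this]
    have "((\<lambda>w. fv z w * g w) has_sum (cip z x - cip z y)) basis_words"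
      unfolding cip_def by (rule has_sum_cong[THEN iffD1, rotated]) (auto simp: g_def)
    then show ?thesis
      using linear_diff[OF bounded_linear.linear[OF bounded_linear_cip_right], of z x y]
      by (simp add: has_sum_iff)
  qed
  from this[of "x - y"] have "complex_of_real ((norm (x - y))\<^sup>2) = (\<Sum>\<^sub>\<infinity>w\<in>basis_words. fv (x - y) w * g w)"
    unfolding cip_self .
  from arg_cong[OF this, of cmod] have eq: "(norm (x - y))\<^sup>2 = cmod (\<Sum>\<^sub>\<infinity>w\<in>basis_words. fv (x - y) w * g w)"
    unfolding norm_of_real by simp
  have "((norm (x - y))\<^sup>2)\<^sup>2 \<le> (\<Sum>\<^sub>\<infinity>w\<in>basis_words. (cmod (fv (x - y) w))\<^sup>2) * (\<Sum>\<^sub>\<infinity>w\<in>basis_words. (cmod (g w))\<^sup>2)"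
    unfolding eq
  proof (rule sq_summable_Cauchy_Schwarz)
    show "(\<lambda>w. (cmod (g w))\<^sup>2) summable_on basis_words" using gh by (rule has_sum_imp_summable)
  qed (simp add: fock_summable)
  also have "(\<Sum>\<^sub>\<infinity>w\<in>basis_words. (cmod (fv (x - y) w))\<^sup>2) = (norm (x - y))\<^sup>2"
  proof -
    have "complex_of_real ((norm (x - y))\<^sup>2) = of_real (\<Sum>\<^sub>\<infinity>w\<in>basis_words. (cmod (fv (x - y) w))\<^sup>2)"
      unfolding cip_self[symmetric] cip_def by (rule fock_inner_self[OF fv_fock])
    then show ?thesis unfolding of_real_eq_iff ..
  qed
  also have "(norm (x - y))\<^sup>2 * (\<Sum>\<^sub>\<infinity>w\<in>basis_words. (cmod (g w))\<^sup>2) \<le> (norm (x - y))\<^sup>2 * (\<epsilon> / 2)\<^sup>2"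
  proof (rule mult_left_mono)
    show "(\<Sum>\<^sub>\<infinity>w\<in>basis_words. (cmod (g w))\<^sup>2) \<le> (\<epsilon> / 2)\<^sup>2"
      using infsumI[OF gh] S(3) unfolding dist_real_def by linarith
  qed simp
  finally have *: "(norm (x - y))\<^sup>2 * (norm (x - y))\<^sup>2 \<le> (norm (x - y))\<^sup>2 * (\<epsilon> / 2)\<^sup>2"
    by (simp only: power2_eq_square[of "(norm (x - y))\<^sup>2"])
  have "(norm (x - y))\<^sup>2 \<le> (\<epsilon> / 2)\<^sup>2"
  proof (cases "x = y")
    case False
    then have "(norm (x - y))\<^sup>2 > 0" by simp
    with * show ?thesis by (rule mult_left_le_imp_le)
  qed simp
  then have "norm (x - y) \<le> \<epsilon> / 2" by (rule power2_le_imp_le) (use e in auto)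
  then show "\<exists>y\<in>C. dist y x < \<epsilon>"
    using e yC by (intro bexI[of _ y]) (auto simp: dist_norm norm_minus_commute)
qed

text \<open>The homogeneous Taylor terms of degree below \<open>N\<close> of \<open>evec h X\<close>
  in \<open>X\<close>; they are also its levels below \<open>N\<close>.\<close>

definition evec_trunc :: "real \<Rightarrow> nat \<Rightarrow> 'a::{real_inner, second_countable_topology} \<times> 'a \<Rightarrow> 'a fk" where
  "evec_trunc h N X = (\<Sum>j<N. (1 / (sqrt (2 * h) ^ j * fact j)) *\<^sub>R pvec (replicate j X))"

lemma evec_trunc_sums:
  assumes h: "h > 0"
  shows "(\<lambda>k. if k < N then 0 else ((norm X)\<^sup>2 / (2 * h)) ^ k / fact k) sums (norm (evec h X - evec_trunc h N X))\<^sup>2"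
proof -
  have f: "fv (evec h X - evec_trunc h N X) w = (if length w < N then 0 else coherent_vec h X w)" for w
  proof -
    define n where "n = length w"
    have "fv (evec_trunc h N X) w = (\<Sum>j<N. of_real (1 / (sqrt (2 * h) ^ j * fact j)) * product_vec (replicate j X) w)"
      unfolding evec_trunc_def fv_sum fv_scaleR fv_pvec ..
    also have "\<dots> = (\<Sum>j<N. if j = n then of_real (1 / (sqrt (2 * h) ^ j * fact j)) * product_vec (replicate j X) w else 0)"
      by (rule sum.cong) (auto simp: n_def product_vec_length)
    also have "\<dots> = (if n < N then coherent_vec h X w else 0)"
      using coherent_vec_product_vec[of w n h X] by (simp add: n_def)
    finally show ?thesis by (simp add: fv_minus fv_evec[OF h] n_def)
  qed
  have "level (fv (evec h X - evec_trunc h N X)) k = (if k < N then 0 else ((norm X)\<^sup>2 / (2 * h)) ^ k / fact k)" for k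
  proof (cases "k < N")
    case True
    then show ?thesis unfolding level_def f by (auto simp: words_def intro!: infsum_0)
  next
    case False
    have "level (fv (evec h X - evec_trunc h N X)) k = level (coherent_vec h X) k"
      unfolding level_def f by (rule infsum_cong) (use False in \<open>auto simp: words_def\<close>)
    then show ?thesis using False by (simp add: level_coherent_vec[OF h])
  qed
  then have "level (fv (evec h X - evec_trunc h N X)) = (\<lambda>k. if k < N then 0 else ((norm X)\<^sup>2 / (2 * h)) ^ k / fact k)"
    by (rule ext)
  with level_sums_norm[of "evec h X - evec_trunc h N X"] show ?thesis by simp
qed

lemma pvec_replicate_scaleR: "pvec (replicate n (t *\<^sub>R X)) = t ^ n *\<^sub>R pvec (replicate n X)"
proof -
  have "product_vec (replicate n (t *\<^sub>R X)) w = of_real t ^ n * product_vec (replicate n X) w" for w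
  proof (cases "length w = n")
    case True
    have "(\<Prod>W\<leftarrow>w. cinner (t *\<^sub>R X) W) = of_real t ^ length w * (\<Prod>W\<leftarrow>w. cinner X W)"
      by (induction w) (simp_all add: scaleR_eq_cscale cinner_simps)
    then show ?thesis unfolding product_vec_replicate[OF True] using True by simp
  qed (simp add: product_vec_length)
  then show ?thesis by (simp add: fv_inject[symmetric] fv_pvec fv_scaleR fun_eq_iff)
qed

text \<open>Strong induction: at the parameter \<open>t X\<close> the terms of degree below
  \<open>n\<close> lie in \<open>C\<close>. Removing them and dividing by \<open>t ^ n\<close>
  leaves the n-th term up to an error of order \<open>t\<close>, and \<open>C\<close> is
  closed.\<close>

lemma pvec_replicate_in:
  assumes C: "closed C" "csubspace C" and h: "h > 0" and E: "\<And>X. evec h X \<in> C"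
  shows "pvec (replicate n X) \<in> C"
proof (induction n rule: less_induct)
  case (less n)
  have sub: "subspace C" using C(2) by (simp add: csubspace_def)
  define x where "x = (norm X)\<^sup>2 / (2 * h)"
  have x: "x \<ge> 0" using h by (simp add: x_def)
  define \<alpha> where "\<alpha> j = 1 / (sqrt (2 * h) ^ j * fact j)" for j
  define a where "a = \<alpha> n *\<^sub>R pvec (replicate n X)"
  define t where "t m = 1 / (real m + 1)" for m
  define y where "y m = (1 / t m ^ n) *\<^sub>R (evec h (t m *\<^sub>R X) - evec_trunc h n (t m *\<^sub>R X))" for m
  have t: "t m > 0" "t m \<le> 1" for m by (auto simp: t_def)
  have yC: "y m \<in> C" for m
    unfolding y_def evec_trunc_def pvec_replicate_scaleR
    by (intro subspace_scale subspace_diff subspace_sum sub E) (use less in auto)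
  have bound: "norm (y m - a) \<le> t m * exp (x / 2)" for m
  proof -
    have "evec_trunc h (Suc n) (t m *\<^sub>R X) = evec_trunc h n (t m *\<^sub>R X) + t m ^ n *\<^sub>R a"
      by (simp add: evec_trunc_def a_def \<alpha>_def pvec_replicate_scaleR mult.commute)
    then have ya: "y m - a = (1 / t m ^ n) *\<^sub>R (evec h (t m *\<^sub>R X) - evec_trunc h (Suc n) (t m *\<^sub>R X))"
      using t(1)[of m] by (simp add: y_def scaleR_diff_right scaleR_add_right)
    have "(norm (evec h (t m *\<^sub>R X) - evec_trunc h (Suc n) (t m *\<^sub>R X)))\<^sup>2 \<le> (t m ^ Suc n)\<^sup>2 * exp x"
    proof (rule sums_le[OF _ evec_trunc_sums[OF h]])
      show "(\<lambda>k. (t m ^ Suc n)\<^sup>2 * (x ^ k /\<^sub>R fact k)) sums ((t m ^ Suc n)\<^sup>2 * exp x)"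
        by (intro sums_mult exp_converges)
      fix k
      show "(if k < Suc n then 0 else ((norm (t m *\<^sub>R X))\<^sup>2 / (2 * h)) ^ k / fact k) \<le> (t m ^ Suc n)\<^sup>2 * (x ^ k /\<^sub>R fact k)"
      proof (cases "k < Suc n")
        case False
        have "((norm (t m *\<^sub>R X))\<^sup>2 / (2 * h)) ^ k = (t m ^ k)\<^sup>2 * x ^ k"
        proof -
          have "(norm (t m *\<^sub>R X))\<^sup>2 / (2 * h) = (t m)\<^sup>2 * x" by (simp add: x_def power_mult_distrib)
          then show ?thesis by (simp add: power_mult_distrib power_mult[symmetric] mult.commute)
        qed
        moreover have "(t m ^ k)\<^sup>2 \<le> (t m ^ Suc n)\<^sup>2"
          using False t[of m] by (intro power_mono power_decreasing) (auto simp: less_imp_le)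
        ultimately have "((norm (t m *\<^sub>R X))\<^sup>2 / (2 * h)) ^ k \<le> (t m ^ Suc n)\<^sup>2 * x ^ k"
          using x by (simp only: mult_right_mono zero_le_power)
        from divide_right_mono[OF this, of "fact k"] have
          "((norm (t m *\<^sub>R X))\<^sup>2 / (2 * h)) ^ k / fact k \<le> (t m ^ Suc n)\<^sup>2 * x ^ k / fact k" by simp
        also have "\<dots> = (t m ^ Suc n)\<^sup>2 * (x ^ k /\<^sub>R fact k)"
          unfolding real_scaleR_def divide_inverse by (simp only: mult_ac)
        finally show ?thesis using False by (simp only: if_False)
      qed (use x in simp)
    qed
    also have "\<dots> = (t m ^ Suc n * exp (x / 2))\<^sup>2"
      unfolding power_mult_distrib by (simp add: exp_double[symmetric])
    finally have "norm (evec h (t m *\<^sub>R X) - evec_trunc h (Suc n) (t m *\<^sub>R X)) \<le> t m ^ Suc n * exp (x / 2)"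
      by (rule power2_le_imp_le) (use t(1)[of m] in simp)
    then have "norm (evec h (t m *\<^sub>R X) - evec_trunc h (Suc n) (t m *\<^sub>R X)) / t m ^ n \<le> t m ^ Suc n * exp (x / 2) / t m ^ n"
      using t(1)[of m] by (intro divide_right_mono) auto
    also have "t m ^ Suc n * exp (x / 2) / t m ^ n = t m * exp (x / 2)" using t(1)[of m] by simp
    finally show ?thesis unfolding ya norm_scaleR using t(1)[of m] by simp
  qed
  have "t \<longlonglongrightarrow> 0"
    using LIMSEQ_inverse_real_of_nat by (simp add: t_def[abs_def] inverse_eq_divide add.commute)
  then have lim: "(\<lambda>m. t m * exp (x / 2)) \<longlonglongrightarrow> 0"
    by (rule tendsto_mult_left_zero)
  have "(\<lambda>m. y m - a) \<longlonglongrightarrow> 0"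
    by (rule Lim_null_comparison[OF always_eventually[OF allI[OF bound]] lim])
  then have "y \<longlonglongrightarrow> a" by (simp add: LIM_zero_iff)
  then have "a \<in> C" using closed_sequentially[OF C(1)] yC by blast
  then have "(1 / \<alpha> n) *\<^sub>R a \<in> C" by (rule subspace_scale[OF sub])
  moreover have "\<alpha> n \<noteq> 0" using h by (simp add: \<alpha>_def)
  ultimately show ?case by (simp add: a_def)
qed

text \<open>The product rule for a symmetric multilinear map along a line. Splitting one copy of
  \<open>X + t V\<close> moves either \<open>X\<close> or \<open>V\<close> into the prefix
  \<open>us\<close>, which is therefore kept arbitrary in the induction; symmetry then merges the n
  equal contributions.\<close>

lemma pvec_derivative:
  "((\<lambda>t. pvec (us @ replicate n (X + t *\<^sub>R V))) has_vector_derivative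
     real n *\<^sub>R pvec (V # us @ replicate (n - 1) (X + t *\<^sub>R V))) (at t)"
proof (induction n arbitrary: us)
  case (Suc n)
  have mv: "pvec (us @ A # ws) = pvec (A # us @ ws)" for us A and ws :: "('a \<times> 'a) list"
    by (rule pvec_sym) simp
  have split: "pvec ((X + t *\<^sub>R V) # ws) = pvec (X # ws) + t *\<^sub>R pvec (V # ws)" for t ws
    by (simp add: pvec_add scaleR_eq_cscale pvec_cscale scaleR_cmul)
  define g where "g W t = pvec ((W # us) @ replicate n (X + t *\<^sub>R V))" for W t
  define g' where "g' W t = real n *\<^sub>R pvec (V # (W # us) @ replicate (n - 1) (X + t *\<^sub>R V))" for W t
  have g: "(g W has_vector_derivative g' W t) (at t)" for W
    unfolding g_def g'_def by (rule Suc.IH)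
  have "((\<lambda>t. g X t + t *\<^sub>R g V t) has_vector_derivative (g' X t + (t *\<^sub>R g' V t + 1 *\<^sub>R g V t))) (at t)"
    by (rule has_vector_derivative_add[OF g has_vector_derivative_scaleR[OF DERIV_ident g]])
  moreover have "(\<lambda>t. pvec (us @ replicate (Suc n) (X + t *\<^sub>R V))) = (\<lambda>t. g X t + t *\<^sub>R g V t)"
    by (rule ext) (simp add: g_def mv split)
  moreover have "g' X t + (t *\<^sub>R g' V t + 1 *\<^sub>R g V t) =
      real (Suc n) *\<^sub>R pvec (V # us @ replicate (Suc n - 1) (X + t *\<^sub>R V))"
  proof -
    have "g' X t + t *\<^sub>R g' V t = real n *\<^sub>R pvec (V # us @ replicate n (X + t *\<^sub>R V))"
    \<comment> \<open>For \<open>n = 0\<close> both derivative terms carry the coefficient 0, so the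
      truncated \<open>n - 1\<close> does no harm.\<close>
    proof (cases n)
      case (Suc k)
      have sw: "pvec (V # (X # us) @ replicate k (X + t *\<^sub>R V)) = pvec (X # (V # us) @ replicate k (X + t *\<^sub>R V))"
        by (rule pvec_sym) simp
      have "g' X t + t *\<^sub>R g' V t = real n *\<^sub>R (pvec (X # (V # us) @ replicate k (X + t *\<^sub>R V)) +
          t *\<^sub>R pvec (V # (V # us) @ replicate k (X + t *\<^sub>R V)))"
        by (simp only: g'_def Suc diff_Suc_1 sw scaleR_add_right scaleR_left_commute[of t])
      also have "\<dots> = real n *\<^sub>R pvec ((X + t *\<^sub>R V) # (V # us) @ replicate k (X + t *\<^sub>R V))"
        by (simp only: split)
      also have "pvec ((X + t *\<^sub>R V) # (V # us) @ replicate k (X + t *\<^sub>R V)) = pvec (V # us @ replicate n (X + t *\<^sub>R V))"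
        by (rule pvec_sym) (simp add: Suc)
      finally show ?thesis .
    qed (simp add: g'_def)
    then show ?thesis by (simp add: g_def scaleR_add_left add.assoc[symmetric])
  qed
  ultimately show ?case by (simp only:)
qed simp

lemma has_vector_derivative_difference_quotient:
  assumes "(g has_vector_derivative d) (at 0)"
  shows "((\<lambda>t. (1 / t) *\<^sub>R (g t - g 0)) \<longlongrightarrow> d) (at 0)"
proof -
  have "((\<lambda>t. norm (g t - g 0 - (t - 0) *\<^sub>R d) / norm (t - 0)) \<longlongrightarrow> 0) (at 0)"
    using assms unfolding has_vector_derivative_def has_derivative_iff_norm by (rule conjunct2)
  then have "((\<lambda>t. norm ((1 / t) *\<^sub>R (g t - g 0) - d)) \<longlongrightarrow> 0) (at 0)"
  proof (rule Lim_transform_eventually)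
    show "\<forall>\<^sub>F t in at 0. norm (g t - g 0 - (t - 0) *\<^sub>R d) / norm (t - 0) = norm ((1 / t) *\<^sub>R (g t - g 0) - d)"
      unfolding eventually_at_filter
    proof (intro always_eventually allI impI)
      fix t :: real assume "t \<noteq> 0"
      then have "(1 / t) *\<^sub>R (g t - g 0) - d = (1 / t) *\<^sub>R (g t - g 0 - (t - 0) *\<^sub>R d)"
        by (simp add: scaleR_diff_right)
      then show "norm (g t - g 0 - (t - 0) *\<^sub>R d) / norm (t - 0) = norm ((1 / t) *\<^sub>R (g t - g 0) - d)"
        by simp
    qed
  qed
  then show ?thesis by (rule LIM_zero_cancel[OF tendsto_norm_zero_cancel])
qed

text \<open>The coefficients of the coherent states are powers; the product vectors are obtained
  from these by polarization, that is by differentiating along lines.\<close>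

lemma csubspace_evec_UNIV:
  assumes C: "closed C" "csubspace C" and h: "h > 0" and E: "\<And>X. evec h X \<in> C"
  shows "x \<in> C"
proof -
  have sub: "subspace C" using C(2) by (simp add: csubspace_def)
  \<comment> \<open>Each differentiation turns one of \<open>n + 1\<close> copies of
    \<open>X\<close> into a new vector, so the number of remaining copies has to stay arbitrary; the
    case of no copies is the goal.\<close>
  have "pvec (us @ replicate n X) \<in> C" for us n X
  proof (induction us arbitrary: n X)
    case Nil
    then show ?case using pvec_replicate_in[OF C h E] by simp
  next
    case (Cons V us)
    define g where "g t = pvec (us @ replicate (Suc n) (X + t *\<^sub>R V))" for t
    have gC: "g t \<in> C" for t unfolding g_def by (rule Cons.IH)
    have "(g has_vector_derivative real (Suc n) *\<^sub>R pvec (V # us @ replicate n X)) (at 0)"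
      using pvec_derivative[of us "Suc n" X V 0] unfolding g_def[abs_def] by simp
    then have "((\<lambda>t. (1 / t) *\<^sub>R (g t - g 0)) \<longlongrightarrow> real (Suc n) *\<^sub>R pvec (V # us @ replicate n X)) (at 0)"
      by (rule has_vector_derivative_difference_quotient)
    then have "real (Suc n) *\<^sub>R pvec (V # us @ replicate n X) \<in> C"
      by (rule Lim_in_closed_set[OF C(1), rotated 2])
        (auto intro!: always_eventually subspace_scale subspace_diff sub gC)
    then have "(1 / real (Suc n)) *\<^sub>R real (Suc n) *\<^sub>R pvec (V # us @ replicate n X) \<in> C"
      by (rule subspace_scale[OF sub])
    then show ?case by simp
  qed
  from this[of _ 0] have "pvec Vs \<in> C" for Vs by simp
  then show ?thesis by (rule csubspace_pvec_UNIV[OF C])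
qed

section \<open>Bounded sesquilinear forms on the Fock space\<close>

definition sesquilinear_bounded ::
  "real \<Rightarrow> ('a::{real_inner, second_countable_topology} fk \<Rightarrow> 'a fk \<Rightarrow> complex) \<Rightarrow> bool" where
  "sesquilinear_bounded K b \<longleftrightarrow>
     (\<forall>x y z. b (x + y) z = b x z + b y z) \<and> (\<forall>c x z. b (cmul c x) z = c * b x z) \<and>
     (\<forall>x y z. b z (x + y) = b z x + b z y) \<and> (\<forall>c x z. b z (cmul c x) = cnj c * b z x) \<and>
     (\<forall>x y. cmod (b x y) \<le> K * norm x * norm y)"

lemma sesquilinear_boundedD:
  assumes "sesquilinear_bounded K b"
  shows "b (x + y) z = b x z + b y z" "b (cmul c x) z = c * b x z"
    "b z (x + y) = b z x + b z y" "b z (cmul c x) = cnj c * b z x"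
    "cmod (b x y) \<le> K * norm x * norm y"
  using assms unfolding sesquilinear_bounded_def by blast+

lemma sesquilinear_bounded_linear_left:
  assumes S: "sesquilinear_bounded K b"
  shows "bounded_linear (\<lambda>x. b x z)"
proof (rule bounded_linear_intro[where K = "K * norm z"])
  show "cmod (b x z) \<le> norm x * (K * norm z)" for x
    using sesquilinear_boundedD(5)[OF S, of x z] by (simp only: mult_ac)
qed (simp_all add: sesquilinear_boundedD[OF S] scaleR_cmul scaleR_conv_of_real)

lemma sesquilinear_bounded_linear_right:
  assumes S: "sesquilinear_bounded K b"
  shows "bounded_linear (b z)"
proof (rule bounded_linear_intro[where K = "K * norm z"])
  show "cmod (b z x) \<le> norm x * (K * norm z)" for x
    using sesquilinear_boundedD(5)[OF S, of z x] by (simp only: mult_ac)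
qed (simp_all add: sesquilinear_boundedD[OF S] scaleR_cmul scaleR_conv_of_real)

lemma csubspace_zero_left:
  assumes S: "sesquilinear_bounded K b"
  shows "closed {x. b x z = 0}" "csubspace {x. b x z = 0}"
proof -
  interpret L: bounded_linear "\<lambda>x. b x z" by (rule sesquilinear_bounded_linear_left[OF S])
  show "closed {x. b x z = 0}"
    by (intro closed_Collect_eq linear_continuous_on L.bounded_linear_axioms continuous_intros)
  show "csubspace {x. b x z = 0}"
    by (simp add: csubspace_def subspace_def L.zero L.add L.scaleR sesquilinear_boundedD(2)[OF S])
qed

lemma csubspace_zero_right:
  assumes S: "sesquilinear_bounded K b"
  shows "closed {x. b z x = 0}" "csubspace {x. b z x = 0}"
proof -
  interpret L: bounded_linear "b z" by (rule sesquilinear_bounded_linear_right[OF S])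
  show "closed {x. b z x = 0}"
    by (intro closed_Collect_eq linear_continuous_on L.bounded_linear_axioms continuous_intros)
  show "csubspace {x. b z x = 0}"
    by (simp add: csubspace_def subspace_def L.zero L.add L.scaleR sesquilinear_boundedD(4)[OF S])
qed

lemma exp_sums_divide_fact_real: "(\<lambda>k. r ^ k / fact k) sums exp r" for r :: real
  using exp_converges[of r] by (simp add: divide_inverse mult.commute)

text \<open>The tail of the exponential series is monotone in its argument, so the error is uniform
  on balls; this is what turns truncations into locally uniform approximations.\<close>

lemma evec_trunc_error:
  assumes h: "h > 0" and X: "norm X \<le> R"
  shows "(norm (evec h X - evec_trunc h N X))\<^sup>2 \<le> exp (R\<^sup>2 / (2 * h)) - (\<Sum>k<N. (R\<^sup>2 / (2 * h)) ^ k / fact k)"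
proof -
  define r where "r = R\<^sup>2 / (2 * h)"
  have e: "(\<lambda>k. r ^ k / fact k) sums exp r"
    by (rule exp_sums_divide_fact_real)
  have "(\<lambda>k. if k \<in> {..<N} then r ^ k / fact k else 0) sums (\<Sum>k<N. r ^ k / fact k)"
    by (rule sums_If_finite_set) simp
  from sums_diff[OF e this]
  have s: "(\<lambda>k. r ^ k / fact k - (if k \<in> {..<N} then r ^ k / fact k else 0)) sums (exp r - (\<Sum>k<N. r ^ k / fact k))" .
  show ?thesis
    unfolding r_def[symmetric]
  proof (rule sums_le[OF _ evec_trunc_sums[OF h] s])
    fix k
    have "(norm X)\<^sup>2 / (2 * h) \<le> r"
      unfolding r_def by (intro divide_right_mono power_mono X) (use h in auto)
    then have "((norm X)\<^sup>2 / (2 * h)) ^ k / fact k \<le> r ^ k / fact k"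
      by (intro divide_right_mono power_mono) (use h in auto)
    then show "(if k < N then 0 else ((norm X)\<^sup>2 / (2 * h)) ^ k / fact k) \<le>
        r ^ k / fact k - (if k \<in> {..<N} then r ^ k / fact k else 0)"
      by simp
  qed
qed

lemma pvec_insert_line:
  "pvec (us @ replicate (Suc n) (M + cscale c D)) =
     pvec ((M # us) @ replicate n (M + cscale c D)) + cmul c (pvec ((D # us) @ replicate n (M + cscale c D)))"
proof -
  have "pvec (us @ replicate (Suc n) (M + cscale c D)) = pvec ((M + cscale c D) # us @ replicate n (M + cscale c D))"
    by (rule pvec_sym) simp
  then show ?thesis by (simp only: pvec_add pvec_cscale append_Cons)
qed

text \<open>In the second argument \<open>b\<close> is antilinear and the parameter is conjugated,
  so the two conjugations cancel and the function is a polynomial in \<open>y\<close>. Copies are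
  extracted one at a time until no argument depends on \<open>y\<close>.\<close>

lemma pvec_form_holomorphic:
  assumes S: "sesquilinear_bounded K b"
  shows "(\<lambda>y. b (pvec (us @ replicate n (M + cscale (\<i> * y) D)))
                (pvec (ws @ replicate m (M + cscale (\<i> * cnj y) D)))) holomorphic_on UNIV"
proof (induction n arbitrary: us)
  case 0
  show ?case
  proof (induction m arbitrary: ws)
    case (Suc m)
    have "(\<lambda>y. b (pvec (us @ replicate 0 (M + cscale (\<i> * y) D))) (pvec (ws @ replicate (Suc m) (M + cscale (\<i> * cnj y) D)))) =
       (\<lambda>y. b (pvec (us @ replicate 0 (M + cscale (\<i> * y) D))) (pvec ((M # ws) @ replicate m (M + cscale (\<i> * cnj y) D))) +
        (- \<i> * y) * b (pvec (us @ replicate 0 (M + cscale (\<i> * y) D))) (pvec ((D # ws) @ replicate m (M + cscale (\<i> * cnj y) D))))"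
      unfolding pvec_insert_line sesquilinear_boundedD(3,4)[OF S] by simp
    then show ?case
      by (simp only:) (intro holomorphic_on_add holomorphic_on_mult Suc.IH holomorphic_on_const holomorphic_on_ident)
  qed simp
next
  case (Suc n)
  show ?case
    unfolding pvec_insert_line sesquilinear_boundedD(1,2)[OF S]
    by (intro holomorphic_on_add holomorphic_on_mult Suc.IH holomorphic_on_const holomorphic_on_ident)
qed

lemma evec_trunc_form_holomorphic:
  assumes S: "sesquilinear_bounded K b"
  shows "(\<lambda>y. b (evec_trunc h N (M + cscale (\<i> * y) D)) (evec_trunc h N (M + cscale (\<i> * cnj y) D))) holomorphic_on UNIV"
proof -
  define \<alpha> where "\<alpha> j = 1 / (sqrt (2 * h) ^ j * fact j)" for j
  define p where "p j c = pvec (replicate j (M + cscale c D))" for j c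
  have e: "b (evec_trunc h N (M + cscale c D)) (evec_trunc h N (M + cscale d D)) =
      (\<Sum>j<N. \<Sum>k<N. of_real (\<alpha> j * \<alpha> k) * b (p j c) (p k d))" for c d
  proof -
    have L1: "b (evec_trunc h N (M + cscale c D)) z = (\<Sum>j<N. of_real (\<alpha> j) * b (p j c) z)" for z
    proof -
      interpret L: bounded_linear "\<lambda>x. b x z" by (rule sesquilinear_bounded_linear_left[OF S])
      show ?thesis unfolding evec_trunc_def \<alpha>_def[symmetric] p_def[symmetric] L.sum L.scaleR scaleR_conv_of_real ..
    qed
    have R1: "b z (evec_trunc h N (M + cscale d D)) = (\<Sum>k<N. of_real (\<alpha> k) * b z (p k d))" for z
    proof -
      interpret L: bounded_linear "b z" by (rule sesquilinear_bounded_linear_right[OF S])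
      show ?thesis unfolding evec_trunc_def \<alpha>_def[symmetric] p_def[symmetric] L.sum L.scaleR scaleR_conv_of_real ..
    qed
    show ?thesis unfolding L1 unfolding R1 by (simp add: sum_distrib_left mult.assoc)
  qed
  have "(\<lambda>y. b (p j (\<i> * y)) (p k (\<i> * cnj y))) holomorphic_on UNIV" for j k
    using pvec_form_holomorphic[OF S, of "[]" j M D "[]" k] by (simp add: p_def)
  then show ?thesis
    unfolding e by (intro holomorphic_on_sum holomorphic_on_mult holomorphic_on_const)
qed

lemma norm_line_le: "norm (M + cscale c D) \<le> norm M + cmod c * norm D"
  using norm_triangle_ineq[of M "cscale c D"] by (simp add: norm_cscale)

text \<open>Truncating both coherent vectors gives polynomials in \<open>y\<close>, which converge
  locally uniformly because \<open>b\<close> is bounded.\<close>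

lemma evec_form_holomorphic:
  assumes S: "sesquilinear_bounded K b" and K: "K \<ge> 0" and h: "h > 0"
  shows "(\<lambda>y. b (evec h (M + cscale (\<i> * y) D)) (evec h (M + cscale (\<i> * cnj y) D))) holomorphic_on UNIV"
proof (rule holomorphic_uniform_sequence[OF open_UNIV])
  show "(\<lambda>y. b (evec_trunc h N (M + cscale (\<i> * y) D)) (evec_trunc h N (M + cscale (\<i> * cnj y) D))) holomorphic_on UNIV" for N
    by (rule evec_trunc_form_holomorphic[OF S])
next
  fix z :: complex
  \<comment> \<open>\<open>R\<close> bounds both parameters as long as \<open>y\<close> stays within
    distance 1 of \<open>z\<close>. For such parameters \<open>E\<close> bounds the coherent vectors
    and \<open>\<tau> N\<close> the truncation errors.\<close>
  define R where "R = norm M + (cmod z + 1) * norm D"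
  define E where "E = exp (R\<^sup>2 / (4 * h))"
  define \<tau> where "\<tau> N = sqrt (exp (R\<^sup>2 / (2 * h)) - (\<Sum>k<N. (R\<^sup>2 / (2 * h)) ^ k / fact k))" for N
  have R0: "R \<ge> 0" by (simp add: R_def)
  have tau: "\<tau> \<longlonglongrightarrow> 0"
  proof -
    have "(\<lambda>k. (R\<^sup>2 / (2 * h)) ^ k / fact k) sums exp (R\<^sup>2 / (2 * h))"
      by (rule exp_sums_divide_fact_real)
    then have "(\<lambda>N. \<Sum>k<N. (R\<^sup>2 / (2 * h)) ^ k / fact k) \<longlonglongrightarrow> exp (R\<^sup>2 / (2 * h))" by (simp add: sums_def)
    from tendsto_real_sqrt[OF tendsto_diff[OF tendsto_const this, of "exp (R\<^sup>2 / (2 * h))"]]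
    show ?thesis unfolding \<tau>_def by simp
  qed
  have err: "norm (evec h X - evec_trunc h N X) \<le> \<tau> N" if "norm X \<le> R" for X N
    unfolding \<tau>_def by (rule real_le_rsqrt) (rule evec_trunc_error[OF h that])
  have nE: "norm (evec h X) \<le> E" if "norm X \<le> R" for X
  proof -
    have "(norm X)\<^sup>2 / (4 * h) \<le> R\<^sup>2 / (4 * h)"
      using h that by (intro divide_right_mono power_mono) auto
    then show ?thesis by (simp add: norm_evec[OF h] E_def)
  qed
  have diff: "cmod (b (evec_trunc h N X) (evec_trunc h N Y) - b (evec h X) (evec h Y)) \<le>
      K * (E + \<tau> N) * \<tau> N + K * \<tau> N * E" if X: "norm X \<le> R" and Y: "norm Y \<le> R" for X Y N
  proof -
    define x x' y y' where "x = evec h X" "x' = evec_trunc h N X" "y = evec h Y" "y' = evec_trunc h N Y"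
    interpret L: bounded_linear "\<lambda>x. b x y" by (rule sesquilinear_bounded_linear_left[OF S])
    interpret G: bounded_linear "b x'" by (rule sesquilinear_bounded_linear_right[OF S])
    have ex: "norm (x - x') \<le> \<tau> N" "norm (y - y') \<le> \<tau> N" "norm x \<le> E" "norm y \<le> E"
      unfolding x_x'_y_y'_def using err[OF X] err[OF Y] nE[OF X] nE[OF Y] by auto
    have t0: "\<tau> N \<ge> 0" using ex(1) norm_ge_zero order.trans by blast
    have x': "norm x' \<le> E + \<tau> N"
      using norm_triangle_ineq4[of x "x - x'"] ex by simp
    have "b x y - b x' y' = b (x - x') y + b x' (y - y')" by (simp add: L.diff G.diff)
    then have "cmod (b x y - b x' y') \<le> cmod (b (x - x') y) + cmod (b x' (y - y'))"
      using norm_triangle_ineq by metis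
    also have "\<dots> \<le> K * norm (x - x') * norm y + K * norm x' * norm (y - y')"
      by (intro add_mono sesquilinear_boundedD(5)[OF S])
    also have "\<dots> \<le> K * \<tau> N * E + K * (E + \<tau> N) * \<tau> N"
      by (intro add_mono mult_mono mult_left_mono K ex x' mult_nonneg_nonneg) (use t0 in \<open>auto simp: E_def\<close>)
    finally show ?thesis by (simp add: x_x'_y_y'_def norm_minus_commute)
  qed
  have lim: "(\<lambda>N. K * (E + \<tau> N) * \<tau> N + K * \<tau> N * E) \<longlonglongrightarrow> K * (E + 0) * 0 + K * 0 * E"
    by (intro tendsto_intros tau)
  have "uniform_limit (cball z 1) (\<lambda>N y. b (evec_trunc h N (M + cscale (\<i> * y) D)) (evec_trunc h N (M + cscale (\<i> * cnj y) D)))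
      (\<lambda>y. b (evec h (M + cscale (\<i> * y) D)) (evec h (M + cscale (\<i> * cnj y) D))) sequentially"
  proof (rule uniform_limitI)
    fix e :: real assume "e > 0"
    with lim have "\<forall>\<^sub>F N in sequentially. K * (E + \<tau> N) * \<tau> N + K * \<tau> N * E < e"
      by (intro order_tendstoD(2)[OF lim]) simp
    then show "\<forall>\<^sub>F N in sequentially. \<forall>y\<in>cball z 1.
        dist (b (evec_trunc h N (M + cscale (\<i> * y) D)) (evec_trunc h N (M + cscale (\<i> * cnj y) D)))
          (b (evec h (M + cscale (\<i> * y) D)) (evec h (M + cscale (\<i> * cnj y) D))) < e"
    proof (rule eventually_mono, intro ballI)
      fix N y assume N: "K * (E + \<tau> N) * \<tau> N + K * \<tau> N * E < e" and "y \<in> cball z 1"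
      then have y: "cmod y \<le> cmod z + 1"
        using norm_triangle_sub[of y z] by (simp add: dist_norm norm_minus_commute)
      have R: "norm (M + cscale c D) \<le> R" if "cmod c = cmod y" for c
      proof -
        have "cmod c * norm D \<le> (cmod z + 1) * norm D" by (rule mult_right_mono) (use y that in auto)
        then show ?thesis using norm_line_le[of M c D] unfolding R_def by linarith
      qed
      show "dist (b (evec_trunc h N (M + cscale (\<i> * y) D)) (evec_trunc h N (M + cscale (\<i> * cnj y) D)))
          (b (evec h (M + cscale (\<i> * y) D)) (evec h (M + cscale (\<i> * cnj y) D))) < e"
        unfolding dist_norm
        by (rule le_less_trans[OF diff N]) (simp_all add: R norm_mult)
    qed
  qed
  then show "\<exists>d>0. cball z d \<subseteq> UNIV \<and> uniform_limit (cball z d)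
      (\<lambda>N y. b (evec_trunc h N (M + cscale (\<i> * y) D)) (evec_trunc h N (M + cscale (\<i> * cnj y) D)))
      (\<lambda>y. b (evec h (M + cscale (\<i> * y) D)) (evec h (M + cscale (\<i> * cnj y) D))) sequentially"
    by (intro exI[of _ 1]) simp
qed

text \<open>The function \<open>y \<mapsto> b(e(M + \<i>yD), e(M + \<i>y*D))\<close>, with \<open>y*\<close> the conjugate of \<open>y\<close>, is entire and vanishes
  on the real axis, where both arguments agree; at \<open>y = -\<i>\<close> the arguments are \<open>M \<plusminus> D\<close>.\<close>

lemma form_determined_by_diagonal:
  fixes b :: "'a::{real_inner, second_countable_topology} fk \<Rightarrow> 'a fk \<Rightarrow> complex"
  assumes S: "sesquilinear_bounded K b" and K: "K \<ge> 0" and h: "h > 0"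
    and diag: "\<And>X. b (evec h X) (evec h X) = 0"
  shows "b x y = 0"
proof -
  have off: "b (evec h X) (evec h Y) = 0" for X Y
  proof -
    define M D where "M = (1/2) *\<^sub>R (X + Y)" and "D = (1/2) *\<^sub>R (X - Y)"
    define k where "k y = b (evec h (M + cscale (\<i> * y) D)) (evec h (M + cscale (\<i> * cnj y) D))" for y
    have hol: "k holomorphic_on UNIV"
      unfolding k_def by (rule evec_form_holomorphic[OF S K h])
    have "k (- \<i>) = 0"
    proof (rule analytic_continuation[OF hol open_UNIV connected_UNIV, where U = "range complex_of_real" and \<xi> = 0])
      show "0 islimpt range complex_of_real"
        unfolding islimpt_sequential
      proof (intro exI[of _ "\<lambda>n. complex_of_real (inverse (real (Suc n)))"] conjI allI)
        show "complex_of_real (inverse (real (Suc n))) \<in> range complex_of_real - {0}" for n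
          by (auto simp del: of_real_inverse)
        show "(\<lambda>n. complex_of_real (inverse (real (Suc n)))) \<longlonglongrightarrow> 0"
          using tendsto_of_real[OF LIMSEQ_inverse_real_of_nat, where 'a = complex] by (simp only: of_real_0)
      qed
      show "k z = 0" if z: "z \<in> range complex_of_real" for z
      proof -
        obtain r where "z = of_real r" using z by blast
        then show ?thesis by (simp only: k_def complex_cnj_complex_of_real diag)
      qed
    qed auto
    moreover have "M + cscale (\<i> * (- \<i>)) D = X" "M + cscale (\<i> * cnj (- \<i>)) D = Y"
    proof -
      have "cscale (\<i> * (- \<i>)) D = D" "cscale (\<i> * cnj (- \<i>)) D = - D"
        by (simp_all add: cscale_def prod_eq_iff)
      moreover have "M + D = X" "M + - D = Y"
        by (simp_all add: M_def D_def scaleR_add_right[symmetric] scaleR_diff_right[symmetric])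
      ultimately show "M + cscale (\<i> * (- \<i>)) D = X" "M + cscale (\<i> * cnj (- \<i>)) D = Y" by simp_all
    qed
    ultimately show ?thesis unfolding k_def by (simp only:)
  qed
  \<comment> \<open>Totality of the coherent vectors is applied in one argument at a time.\<close>
  have "b (evec h X) y = 0" for X y
    using csubspace_evec_UNIV[OF csubspace_zero_right[OF S, of "evec h X"] h] off by blast
  then show ?thesis
    using csubspace_evec_UNIV[OF csubspace_zero_left[OF S, of y] h] by blast
qed

lemma cip_sum_right: "cip z (\<Sum>w\<in>S. f w) = (\<Sum>w\<in>S. cip z (f w))"
  by (rule linear_sum) (rule bounded_linear.linear[OF bounded_linear_cip_right])

text \<open>Riesz representation: since the forms in \<open>fock\<close> are evaluated by pairing with product vectors,
  the representing vector can be written down directly.\<close>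

lemma form_representation:
  fixes b :: "'a::{real_inner, second_countable_topology} fk \<Rightarrow> 'a fk \<Rightarrow> complex"
  assumes S: "sesquilinear_bounded K b" and K: "K \<ge> 0"
  shows "\<exists>y. \<forall>z. cip y z = b x z"
proof -
  define f where "f Ws = b x (pvec Ws) / of_real (sqrt (fact (length Ws)))" for Ws
  have bnd: "cmod (f Ws) \<le> (K * norm x) * prod_list (map norm Ws)" for Ws
  proof -
    have "cmod (b x (pvec Ws)) \<le> K * norm x * (sqrt (fact (length Ws)) * prod_list (map norm Ws))"
      by (rule order.trans[OF sesquilinear_boundedD(5)[OF S]])
        (intro mult_left_mono norm_pvec_le mult_nonneg_nonneg K norm_ge_zero)
    then show ?thesis by (simp add: f_def norm_divide divide_le_eq mult_ac)
  qed
  \<comment> \<open>The finite square sum \<open>s\<close> equals \<open>b x y\<close> for the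
    vector \<open>y\<close> built from these coefficients. Cauchy-Schwarz gives
    \<open>norm y \<le> sqrt s\<close>, so the boundedness of \<open>b\<close> yields
    \<open>s \<le> K * norm x * sqrt s\<close>, and one root cancels.\<close>
  have fin: "(\<Sum>w\<in>T. (cmod (f w))\<^sup>2) \<le> (K * norm x)\<^sup>2" if T: "finite T" "T \<subseteq> basis_words" for T
  proof -
    define s where "s = (\<Sum>w\<in>T. (cmod (f w))\<^sup>2)"
    define y where "y = (\<Sum>w\<in>T. cmul (f w / of_real (sqrt (fact (length w)))) (pvec w))"
    have s0: "s \<ge> 0" unfolding s_def by (rule sum_nonneg) simp
    interpret L: bounded_linear "b x" by (rule sesquilinear_bounded_linear_right[OF S])
    have "b x y = (\<Sum>w\<in>T. complex_of_real ((cmod (f w))\<^sup>2))"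
      unfolding y_def L.sum
    proof (rule sum.cong)
      fix w assume "w \<in> T"
      have "b x (cmul (f w / of_real (sqrt (fact (length w)))) (pvec w)) = cnj (f w) * f w"
        by (simp add: sesquilinear_boundedD(4)[OF S] f_def)
      then show "b x (cmul (f w / of_real (sqrt (fact (length w)))) (pvec w)) = complex_of_real ((cmod (f w))\<^sup>2)"
        unfolding complex_norm_square by (simp only: mult.commute)
    qed simp
    then have bs: "b x y = of_real s" by (simp only: s_def of_real_sum)
    have "cip y y = (\<Sum>w\<in>T. fv y w * cnj (f w))"
    proof -
      have "cip y y = (\<Sum>w\<in>T. cip y (cmul (f w / of_real (sqrt (fact (length w)))) (pvec w)))"
        by (subst (2) y_def) (rule cip_sum_right)
      also have "\<dots> = (\<Sum>w\<in>T. fv y w * cnj (f w))"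
        by (rule sum.cong) (simp_all add: cip_cmul_right cip_pvec)
      finally show ?thesis .
    qed
    then have "complex_of_real ((norm y)\<^sup>2) = (\<Sum>w\<in>T. fv y w * cnj (f w))" by (simp only: cip_self)
    from arg_cong[OF this, of cmod] have eq: "(norm y)\<^sup>2 = cmod (\<Sum>w\<in>T. fv y w * cnj (f w))"
      unfolding norm_of_real by simp
    also have "\<dots> \<le> (\<Sum>w\<in>T. cmod (fv y w) * cmod (f w))"
      by (rule order.trans[OF norm_sum]) (simp add: norm_mult)
    finally have "((norm y)\<^sup>2)\<^sup>2 \<le> (\<Sum>w\<in>T. cmod (fv y w) * cmod (f w))\<^sup>2"
      by (intro power_mono) auto
    also have "\<dots> \<le> (\<Sum>w\<in>T. (cmod (fv y w))\<^sup>2) * s"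
      unfolding s_def by (rule Cauchy_Schwarz_ineq_sum)
    also have "\<dots> \<le> (norm y)\<^sup>2 * s"
    proof (rule mult_right_mono[OF _ s0])
      have "(\<Sum>w\<in>T. (cmod (fv y w))\<^sup>2) \<le> (\<Sum>\<^sub>\<infinity>w\<in>basis_words. (cmod (fv y w))\<^sup>2)"
        by (rule finite_sum_le_infsum) (use T in \<open>auto simp: fock_summable\<close>)
      moreover have "complex_of_real ((norm y)\<^sup>2) = of_real (\<Sum>\<^sub>\<infinity>w\<in>basis_words. (cmod (fv y w))\<^sup>2)"
        unfolding cip_self[symmetric] cip_def by (rule fock_inner_self[OF fv_fock])
      ultimately show "(\<Sum>w\<in>T. (cmod (fv y w))\<^sup>2) \<le> (norm y)\<^sup>2" unfolding of_real_eq_iff by simp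
    qed
    finally have y: "(norm y)\<^sup>2 * (norm y)\<^sup>2 \<le> (norm y)\<^sup>2 * s"
      by (simp only: power2_eq_square[of "(norm y)\<^sup>2"])
    have ny: "norm y \<le> sqrt s"
    proof (cases "y = 0")
      case False
      then have "(norm y)\<^sup>2 > 0" by simp
      with y have "(norm y)\<^sup>2 \<le> s" by (rule mult_left_le_imp_le)
      then show ?thesis by (rule real_le_rsqrt)
    qed (use s0 in simp)
    have "s = cmod (b x y)" using s0 by (simp add: bs)
    also have "\<dots> \<le> K * norm x * norm y" by (rule sesquilinear_boundedD(5)[OF S])
    also have "\<dots> \<le> K * norm x * sqrt s" by (intro mult_left_mono ny mult_nonneg_nonneg K norm_ge_zero)
    finally have le: "sqrt s * sqrt s \<le> K * norm x * sqrt s" using s0 by simp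
    have "sqrt s \<le> K * norm x"
    proof (cases "s = 0")
      case False
      then have "sqrt s > 0" using s0 by simp
      with le show ?thesis by (rule mult_right_le_imp_le)
    qed (simp add: K)
    then have "(sqrt s)\<^sup>2 \<le> (K * norm x)\<^sup>2" by (rule power_mono) (use s0 in simp)
    then show ?thesis using s0 by (simp add: s_def[symmetric])
  qed
  have su: "(\<lambda>w. (cmod (f w))\<^sup>2) summable_on basis_words"
  proof (rule nonneg_bdd_above_summable_on)
    show "bdd_above (sum (\<lambda>w. (cmod (f w))\<^sup>2) ` {F. F \<subseteq> basis_words \<and> finite F})"
      by (rule bdd_aboveI2[where M = "(K * norm x)\<^sup>2"]) (use fin in auto)
  qed simp
  then have lev: "\<forall>n. (\<lambda>w. (cmod (f w))\<^sup>2) summable_on words n" "summable (level f)"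
    unfolding level_summable_iff by blast+
  have "fock_form f"
    unfolding fock_form_def
  proof (intro conjI)
    show "\<forall>V W ws. f ((V + W) # ws) = f (V # ws) + f (W # ws)"
      by (simp add: f_def pvec_add sesquilinear_boundedD(3)[OF S] add_divide_distrib)
    show "\<forall>c V ws. f (cscale c V # ws) = cnj c * f (V # ws)"
      by (simp add: f_def pvec_cscale sesquilinear_boundedD(4)[OF S])
    show "\<forall>n. \<exists>C. \<forall>Vs. length Vs = n \<longrightarrow> cmod (f Vs) \<le> C * prod_list (map norm Vs)"
      using bnd by blast
    show "\<forall>Vs Ws. mset Vs = mset Ws \<longrightarrow> f Vs = f Ws"
    proof (intro allI impI)
      fix Vs Ws :: "('a \<times> 'a) list" assume m: "mset Vs = mset Ws"
      show "f Vs = f Ws" unfolding f_def pvec_sym[OF m] mset_eq_length[OF m] ..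
    qed
    show "\<forall>n. (\<lambda>w. (cmod (f w))\<^sup>2) summable_on words n" by (rule lev)
  qed
  then have fF: "f \<in> fock" using lev by (simp add: fock_iff)
  define y where "y = Fk f"
  have fy: "fv y = f" using fF by (simp add: y_def Fk_inverse)
  interpret L: bounded_linear "b x" by (rule sesquilinear_bounded_linear_right[OF S])
  interpret G: bounded_linear "cip y" by (rule bounded_linear_cip_right)
  \<comment> \<open>Both sides are continuous and antilinear in \<open>z\<close>, so agreement on
    product vectors, which holds by the choice of \<open>f\<close>, is enough.\<close>
  have "closed {z. cip y z = b x z}"
    by (intro closed_Collect_eq linear_continuous_on L.bounded_linear_axioms G.bounded_linear_axioms)
  moreover have "csubspace {z. cip y z = b x z}"
    by (simp add: csubspace_def subspace_def L.zero L.add L.scaleR G.zero G.add G.scaleR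
        sesquilinear_boundedD(4)[OF S] cip_cmul_right)
  moreover have "pvec Ws \<in> {z. cip y z = b x z}" for Ws
    by (simp add: cip_pvec fy f_def)
  ultimately have "z \<in> {z. cip y z = b x z}" for z by (rule csubspace_pvec_UNIV)
  then show ?thesis by blast
qed

section \<open>Gaussian integrals of power series\<close>

definition gauss :: "real \<Rightarrow> real measure" where
  "gauss h = density lborel (normal_density 0 (sqrt h))"

lemma sets_gauss [measurable_cong, simp]: "sets (gauss h) = sets borel"
  by (simp add: gauss_def)

lemma prob_space_gauss: "h > 0 \<Longrightarrow> prob_space (gauss h)"
  unfolding gauss_def by (rule prob_space_normal_density) simp

lemma integral_gauss:
  fixes f :: "real \<Rightarrow> 'b::{banach, second_countable_topology}"
  assumes [measurable]: "f \<in> borel_measurable borel"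
  shows "integrable (gauss h) f \<longleftrightarrow> integrable lborel (\<lambda>z. normal_density 0 (sqrt h) z *\<^sub>R f z)"
    "integral\<^sup>L (gauss h) f = (\<integral>z. normal_density 0 (sqrt h) z *\<^sub>R f z \<partial>lborel)"
proof -
  show "integrable (gauss h) f \<longleftrightarrow> integrable lborel (\<lambda>z. normal_density 0 (sqrt h) z *\<^sub>R f z)"
    unfolding gauss_def by (rule integrable_density) auto
  show "integral\<^sup>L (gauss h) f = (\<integral>z. normal_density 0 (sqrt h) z *\<^sub>R f z \<partial>lborel)"
    unfolding gauss_def by (rule integral_density) auto
qed

lemma normal_density_shift:
  assumes "h > 0"
  shows "normal_density 0 (sqrt h) (q * h + z) * exp (q * (q * h + z)) = exp (q\<^sup>2 * h / 2) * normal_density 0 (sqrt h) z"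
proof -
  have e: "- (q * h + z)\<^sup>2 / (2 * h) + q * (q * h + z) = q\<^sup>2 * h / 2 + - z\<^sup>2 / (2 * h)"
    using assms by (simp add: field_simps power2_eq_square)
  have "normal_density 0 (sqrt h) (q * h + z) * exp (q * (q * h + z)) =
      1 / sqrt (2 * pi * h) * exp (- (q * h + z)\<^sup>2 / (2 * h) + q * (q * h + z))"
    unfolding exp_add using assms by (simp add: normal_density_def)
  also have "\<dots> = exp (q\<^sup>2 * h / 2) * normal_density 0 (sqrt h) z"
    unfolding e exp_add using assms by (simp add: normal_density_def)
  finally show ?thesis .
qed

text \<open>The Cameron-Martin formula in one dimension: completing the square turns the exponential
  weight into a translation by \<open>q * h\<close>.\<close>

lemma gauss_shift:
  fixes f :: "real \<Rightarrow> 'b::{banach, second_countable_topology}"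
  assumes h: "h > 0" and [measurable]: "f \<in> borel_measurable borel"
  shows "integrable (gauss h) (\<lambda>z. exp (q * z) *\<^sub>R f z) \<longleftrightarrow> integrable (gauss h) (\<lambda>z. f (q * h + z))"
    "(\<integral>z. exp (q * z) *\<^sub>R f z \<partial>gauss h) = exp (q\<^sup>2 * h / 2) *\<^sub>R (\<integral>z. f (q * h + z) \<partial>gauss h)"
proof -
  define g where "g z = normal_density 0 (sqrt h) z *\<^sub>R exp (q * z) *\<^sub>R f z" for z
  define k where "k z = normal_density 0 (sqrt h) z *\<^sub>R f (q * h + z)" for z
  define c where "c = exp (q\<^sup>2 * h / 2)"
  have c: "c \<noteq> 0" by (simp add: c_def)
  have g: "g (q * h + 1 * z) = c *\<^sub>R k z" for z
    using normal_density_shift[OF h, of q z] by (simp add: g_def k_def c_def)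
  have kg: "integrable lborel (\<lambda>z. c *\<^sub>R k z) \<longleftrightarrow> integrable lborel k"
  proof
    assume a: "integrable lborel (\<lambda>z. c *\<^sub>R k z)"
    have "integrable lborel (\<lambda>z. inverse c *\<^sub>R c *\<^sub>R k z)" by (rule integrable_scaleR_right) (rule a)
    then show "integrable lborel k" using c by simp
  qed (intro integrable_scaleR_right)
  have "integrable (gauss h) (\<lambda>z. exp (q * z) *\<^sub>R f z) \<longleftrightarrow> integrable lborel g"
    unfolding g_def by (rule integral_gauss) measurable
  also have "\<dots> \<longleftrightarrow> integrable lborel (\<lambda>z. g (q * h + 1 * z))"
    by (rule lborel_integrable_real_affine_iff[symmetric]) simp
  also have "\<dots> \<longleftrightarrow> integrable lborel k" unfolding g kg ..
  also have "\<dots> \<longleftrightarrow> integrable (gauss h) (\<lambda>z. f (q * h + z))"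
    unfolding k_def by (rule integral_gauss(1)[symmetric]) measurable
  finally show "integrable (gauss h) (\<lambda>z. exp (q * z) *\<^sub>R f z) \<longleftrightarrow> integrable (gauss h) (\<lambda>z. f (q * h + z))" .
  have "(\<integral>z. exp (q * z) *\<^sub>R f z \<partial>gauss h) = integral\<^sup>L lborel g"
    unfolding g_def by (rule integral_gauss) measurable
  also have "\<dots> = (\<integral>z. g (q * h + 1 * z) \<partial>lborel)"
    using lborel_integral_real_affine[of 1 g "q * h"] by simp
  also have "\<dots> = c *\<^sub>R integral\<^sup>L lborel k"
  proof (cases "integrable lborel k")
    case False
    then have nk: "\<not> integrable lborel (\<lambda>z. c *\<^sub>R k z)" using kg by simp
    show ?thesis unfolding g not_integrable_integral_eq[OF nk] not_integrable_integral_eq[OF False] by simp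
  qed (unfold g, rule integral_scaleR_right)
  also have "integral\<^sup>L lborel k = (\<integral>z. f (q * h + z) \<partial>gauss h)"
    unfolding k_def by (rule integral_gauss(2)[symmetric]) measurable
  finally show "(\<integral>z. exp (q * z) *\<^sub>R f z \<partial>gauss h) = exp (q\<^sup>2 * h / 2) *\<^sub>R (\<integral>z. f (q * h + z) \<partial>gauss h)"
    unfolding c_def .
qed

lemma gauss_exp:
  assumes h: "h > 0"
  shows "integrable (gauss h) (\<lambda>z. exp (q * z))" "(\<integral>z. exp (q * z) \<partial>gauss h) = exp (q\<^sup>2 * h / 2)"
proof -
  interpret prob_space "gauss h" by (rule prob_space_gauss[OF h])
  show "integrable (gauss h) (\<lambda>z. exp (q * z))"
    using gauss_shift(1)[OF h, of "\<lambda>_. 1 :: real" q] by simp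
  show "(\<integral>z. exp (q * z) \<partial>gauss h) = exp (q\<^sup>2 * h / 2)"
    using gauss_shift(2)[OF h, of "\<lambda>_. 1 :: real" q] prob_space by simp
qed

lemma gauss_moments:
  assumes h: "h > 0"
  shows "(\<integral>z. z ^ (2 * k) \<partial>gauss h) = fact (2 * k) / fact k * (h / 2) ^ k"
    "(\<integral>z. z ^ (2 * k + 1) \<partial>gauss h) = 0"
    "integrable (gauss h) (\<lambda>z. z ^ n)"
proof -
  have int: "(\<integral>z. z ^ n \<partial>gauss h) = (\<integral>z. normal_density 0 (sqrt h) z * (z - 0) ^ n \<partial>lborel)" for n
    by (subst integral_gauss) simp_all
  have "(\<integral>z. z ^ (2 * k) \<partial>gauss h) = fact (2 * k) / ((2 / (sqrt h)\<^sup>2) ^ k * fact k)"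
    unfolding int by (rule has_bochner_integral_integral_eq[OF normal_moment_even]) (use h in simp)
  also have "\<dots> = fact (2 * k) / fact k * (h / 2) ^ k"
    using h by (simp add: field_simps)
  finally show "(\<integral>z. z ^ (2 * k) \<partial>gauss h) = fact (2 * k) / fact k * (h / 2) ^ k" .
  show "(\<integral>z. z ^ (2 * k + 1) \<partial>gauss h) = 0"
    unfolding int by (rule has_bochner_integral_integral_eq[OF normal_moment_odd]) (use h in simp)
  show "integrable (gauss h) (\<lambda>z. z ^ n)"
    using integrable_normal_moment[of "sqrt h" 0 n] h by (simp add: integral_gauss)
qed

text \<open>Odd moments vanish, and the even moment \<open>(2i)! / i! (h/2)^i\<close> cancels the
  factorial of the Taylor series. What remains is the series of \<open>exp ((h/2) d^2)\<close> for
  the Taylor coefficients \<open>b\<close>. The partial sums are dominated by \<open>w\<close>, a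
  sum of two integrable exponentials.\<close>

lemma gauss_power_series:
  fixes b :: "nat \<Rightarrow> complex"
  assumes h: "h > 0" and q: "q \<ge> 0" and b: "\<And>j. cmod (b j) \<le> C * q ^ j"
  shows "(\<lambda>i. b (2 * i) * of_real ((h / 2) ^ i / fact i)) sums
           (\<integral>z. (\<Sum>j. b j * of_real (z ^ j / fact j)) \<partial>gauss h)"
proof -
  define S where "S n z = (\<Sum>j<n. b j * of_real (z ^ j / fact j))" for n and z :: real
  define f where "f z = (\<Sum>j. b j * of_real (z ^ j / fact j))" for z :: real
  define w where "w z = C * (exp (q * z) + exp (- q * z))" for z
  have C: "C \<ge> 0" using order.trans[OF norm_ge_zero b[of 0]] by simp
  have tb: "cmod (b j * of_real (z ^ j / fact j)) \<le> C * ((q * \<bar>z\<bar>) ^ j / fact j)" for j and z :: real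
  proof -
    have "cmod (b j * of_real (z ^ j / fact j)) = cmod (b j) * (\<bar>z\<bar> ^ j / fact j)"
      using power_abs[of z j] by (simp add: norm_mult norm_divide norm_power)
    also have "\<dots> \<le> (C * q ^ j) * (\<bar>z\<bar> ^ j / fact j)"
      by (intro mult_right_mono b) simp
    finally show ?thesis by (simp add: power_mult_distrib)
  qed
  have es: "(\<lambda>j. C * ((q * \<bar>z\<bar>) ^ j / fact j)) sums (C * exp (q * \<bar>z\<bar>))" for z :: real
    by (intro sums_mult exp_sums_divide_fact_real)
  have sf: "summable (\<lambda>j. b j * of_real (z ^ j / fact j))" for z :: real
    by (rule summable_comparison_test'[OF sums_summable[OF es[of z]]]) (rule tb)
  have lim: "(\<lambda>n. S n z) \<longlonglongrightarrow> f z" for z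
    unfolding S_def f_def by (rule summable_LIMSEQ[OF sf])
  have bnd: "cmod (S n z) \<le> w z" for n z
  proof -
    have "cmod (S n z) \<le> (\<Sum>j<n. C * ((q * \<bar>z\<bar>) ^ j / fact j))"
      unfolding S_def by (rule order.trans[OF norm_sum sum_mono[OF tb]])
    also have "\<dots> \<le> C * exp (q * \<bar>z\<bar>)"
      using sum_le_suminf[OF sums_summable[OF es[of z]], of "{..<n}"] sums_unique[OF es[of z]] C q by simp
    also have "\<dots> \<le> w z"
      unfolding w_def by (intro mult_left_mono C) (auto simp: abs_if)
    finally show ?thesis .
  qed
  have [measurable]: "S n \<in> borel_measurable borel" for n unfolding S_def by measurable
  have [measurable]: "f \<in> borel_measurable borel"
    by (rule borel_measurable_LIMSEQ_metric[of S]) (use lim in auto)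
  have wi: "integrable (gauss h) w"
    unfolding w_def by (intro integrable_mult_right Bochner_Integration.integrable_add gauss_exp h)
  have "(\<lambda>n. integral\<^sup>L (gauss h) (S n)) \<longlonglongrightarrow> integral\<^sup>L (gauss h) f"
    by (rule integral_dominated_convergence[OF _ _ wi]) (use lim bnd in auto)
  moreover have "integral\<^sup>L (gauss h) (S n) = (\<Sum>j<n. b j * of_real ((\<integral>z. z ^ j \<partial>gauss h) / fact j))" for n
  proof -
    have i: "integrable (gauss h) (\<lambda>z. complex_of_real (z ^ j / fact j))" for j
      by (intro integrable_of_real integrable_divide gauss_moments h)
    have "integral\<^sup>L (gauss h) (S n) = (\<Sum>j<n. \<integral>z. b j * of_real (z ^ j / fact j) \<partial>gauss h)"
      unfolding S_def by (intro Bochner_Integration.integral_sum integrable_mult_right i)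
    also have "\<dots> = (\<Sum>j<n. b j * of_real ((\<integral>z. z ^ j \<partial>gauss h) / fact j))"
      by (simp only: integral_mult_right_zero integral_complex_of_real integral_divide_zero)
    finally show ?thesis .
  qed
  ultimately have "(\<lambda>j. b j * of_real ((\<integral>z. z ^ j \<partial>gauss h) / fact j)) sums integral\<^sup>L (gauss h) f"
    by (simp only: sums_def)
  moreover have "((\<lambda>i. b (2 * i) * of_real ((\<integral>z. z ^ (2 * i) \<partial>gauss h) / fact (2 * i))) sums integral\<^sup>L (gauss h) f) =
      ((\<lambda>j. b j * of_real ((\<integral>z. z ^ j \<partial>gauss h) / fact j)) sums integral\<^sup>L (gauss h) f)"
  proof (rule sums_mono_reindex[of "\<lambda>i. 2 * i"])
    show "strict_mono ((*) (2 :: nat))" by (rule strict_monoI) simp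
    fix n assume "n \<notin> range ((*) (2 :: nat))"
    then have "odd n" by (metis evenE rangeI)
    then obtain k where "n = 2 * k + 1" by (rule oddE)
    then show "b n * of_real ((\<integral>z. z ^ n \<partial>gauss h) / fact n) = 0"
      using gauss_moments(2)[OF h, of k] by simp
  qed
  ultimately show ?thesis
    unfolding f_def[symmetric] gauss_moments(1)[OF h] by simp
qed

text \<open>A complex exponent admits no translation of the density; the power series covers
  it.\<close>

lemma gauss_cexp:
  fixes c :: complex
  assumes h: "h > 0"
  shows "(\<integral>z. exp (c * of_real z) \<partial>gauss h) = exp (c\<^sup>2 * of_real (h / 2))"
proof -
  have e: "(\<Sum>j. c ^ j * of_real (z ^ j / fact j)) = exp (c * of_real z)" for z :: real
  proof -
    have "(\<lambda>j. c ^ j * of_real (z ^ j / fact j)) = (\<lambda>j. (c * of_real z) ^ j / fact j)"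
      by (rule ext) (simp add: power_mult_distrib)
    then show ?thesis using exp_sums_divide_fact[of "c * of_real z"] by (simp only: sums_unique[symmetric])
  qed
  have "(\<lambda>i. c ^ (2 * i) * of_real ((h / 2) ^ i / fact i)) sums (\<integral>z. exp (c * of_real z) \<partial>gauss h)"
    using gauss_power_series[OF h, of "cmod c" "\<lambda>j. c ^ j" 1] unfolding e by (simp add: norm_power)
  moreover have "c ^ (2 * i) * of_real (d ^ i / fact i) = (c\<^sup>2 * of_real d) ^ i / fact i" for i and d :: real
    by (simp add: power_mult power_mult_distrib)
  ultimately show ?thesis
    using exp_sums_divide_fact[of "c\<^sup>2 * of_real (h / 2)"] sums_unique2 by (simp only:) blast
qed

section \<open>Gaussian measures on finite dimensional subspaces\<close>

text \<open>The law of \<open>z\<^sub>1 e\<^sub>1 + \<dots> + z\<^sub>n e\<^sub>n\<close> for independent centred Gaussian \<open>z\<^sub>i\<close> of variance \<open>h\<close>.\<close>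

primrec gauss_span :: "real \<Rightarrow> 'b::{real_inner, second_countable_topology} list \<Rightarrow> 'b measure" where
  "gauss_span h [] = return borel 0"
| "gauss_span h (e # es) = distr (gauss_span h es \<Otimes>\<^sub>M gauss h) borel (\<lambda>(Y, z). Y + z *\<^sub>R e)"

lemma sets_gauss_span [measurable_cong, simp]: "sets (gauss_span h es) = sets borel"
  by (cases es) simp_all

lemma prob_space_gauss_span: "h > 0 \<Longrightarrow> prob_space (gauss_span h es)"
proof (induction es)
  case (Cons e es)
  have "prob_space (gauss_span h es \<Otimes>\<^sub>M gauss h)"
    by (intro prob_space_pair Cons.IH prob_space_gauss Cons.prems)
  then show ?case
    unfolding gauss_span.simps by (rule prob_space.prob_space_distr) measurable
qed (simp add: prob_space_return)

lemma gauss_span_Cons_integral: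
  fixes f :: "'b::{real_inner, second_countable_topology} \<Rightarrow> complex"
  assumes h: "h > 0" and i: "integrable (gauss_span h (e # es)) f" and [measurable]: "f \<in> borel_measurable borel"
  shows "integral\<^sup>L (gauss_span h (e # es)) f = (\<integral>Y. (\<integral>z. f (Y + z *\<^sub>R e) \<partial>gauss h) \<partial>gauss_span h es)"
proof -
  interpret M1: prob_space "gauss_span h es" by (rule prob_space_gauss_span[OF h])
  interpret M2: prob_space "gauss h" by (rule prob_space_gauss[OF h])
  interpret P: pair_sigma_finite "gauss_span h es" "gauss h" ..
  have i': "integrable (gauss_span h es \<Otimes>\<^sub>M gauss h) (\<lambda>p. f (case p of (Y, z) \<Rightarrow> Y + z *\<^sub>R e))"
    using i unfolding gauss_span.simps by (subst (asm) integrable_distr_eq) auto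
  have "integral\<^sup>L (gauss_span h (e # es)) f = integral\<^sup>L (gauss_span h es \<Otimes>\<^sub>M gauss h) (\<lambda>p. f (case p of (Y, z) \<Rightarrow> Y + z *\<^sub>R e))"
    unfolding gauss_span.simps by (rule integral_distr) auto
  also have "\<dots> = (\<integral>Y. (\<integral>z. f (Y + z *\<^sub>R e) \<partial>gauss h) \<partial>gauss_span h es)"
    using P.integral_fst'[OF i'] by simp
  finally show ?thesis .
qed

text \<open>Computed with nonnegative integrals, where the order of integration is free, so that the
  value also proves integrability; that of complex exponentials follows from
  \<open>|exp (l Z)| = exp (Re (l Z))\<close>.\<close>

lemma gauss_span_exp_nn:
  fixes r :: "'b::{real_inner, second_countable_topology} \<Rightarrow> real"
  assumes h: "h > 0" and r: "bounded_linear r"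
  shows "(\<integral>\<^sup>+Z. ennreal (exp (r Z)) \<partial>gauss_span h es) = ennreal (exp (h / 2 * (\<Sum>e\<leftarrow>es. (r e)\<^sup>2)))"
proof (induction es)
  case Nil
  interpret r: bounded_linear r by fact
  have [measurable]: "r \<in> borel_measurable borel"
    by (intro borel_measurable_continuous_onI linear_continuous_on r)
  show ?case by (simp add: nn_integral_return r.zero)
next
  case (Cons e es)
  interpret r: bounded_linear r by fact
  interpret M2: prob_space "gauss h" by (rule prob_space_gauss[OF h])
  have [measurable]: "r \<in> borel_measurable borel"
    by (intro borel_measurable_continuous_onI linear_continuous_on r)
  have inner: "(\<integral>\<^sup>+z. ennreal (exp (r (Y + z *\<^sub>R e))) \<partial>gauss h) = ennreal (exp (h / 2 * (r e)\<^sup>2)) * ennreal (exp (r Y))" for Y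
  proof -
    have "(\<integral>\<^sup>+z. ennreal (exp (r (Y + z *\<^sub>R e))) \<partial>gauss h) = (\<integral>\<^sup>+z. ennreal (exp (r Y)) * ennreal (exp (r e * z)) \<partial>gauss h)"
      by (rule nn_integral_cong) (simp add: r.add r.scaleR exp_add ennreal_mult'[symmetric] mult.commute)
    also have "\<dots> = ennreal (exp (r Y)) * (\<integral>\<^sup>+z. ennreal (exp (r e * z)) \<partial>gauss h)"
      by (rule nn_integral_cmult) measurable
    also have "(\<integral>\<^sup>+z. ennreal (exp (r e * z)) \<partial>gauss h) = ennreal (exp ((r e)\<^sup>2 * h / 2))"
      using gauss_exp[OF h, of "r e"] by (subst nn_integral_eq_integral) auto
    finally show ?thesis by (simp add: mult.commute)
  qed
  have "(\<integral>\<^sup>+Z. ennreal (exp (r Z)) \<partial>gauss_span h (e # es)) =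
      (\<integral>\<^sup>+p. ennreal (exp (r (case p of (Y, z) \<Rightarrow> Y + z *\<^sub>R e))) \<partial>(gauss_span h es \<Otimes>\<^sub>M gauss h))"
    unfolding gauss_span.simps by (rule nn_integral_distr) auto
  also have "\<dots> = (\<integral>\<^sup>+Y. (\<integral>\<^sup>+z. ennreal (exp (r (Y + z *\<^sub>R e))) \<partial>gauss h) \<partial>gauss_span h es)"
    by (subst M2.nn_integral_fst[symmetric]) auto
  also have "\<dots> = ennreal (exp (h / 2 * (r e)\<^sup>2)) * (\<integral>\<^sup>+Y. ennreal (exp (r Y)) \<partial>gauss_span h es)"
    unfolding inner by (rule nn_integral_cmult) measurable
  also have "\<dots> = ennreal (exp (h / 2 * (\<Sum>e\<leftarrow>e # es. (r e)\<^sup>2)))"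
    unfolding Cons.IH by (simp add: ennreal_mult'[symmetric] exp_add[symmetric] distrib_left)
  finally show ?case .
qed

lemma gauss_span_integrable_exp:
  fixes l :: "'b::{real_inner, second_countable_topology} \<Rightarrow> complex"
  assumes h: "h > 0" and l: "bounded_linear l"
  shows "integrable (gauss_span h es) (\<lambda>Z. exp (l Z))"
proof -
  have [measurable]: "l \<in> borel_measurable borel"
    by (intro borel_measurable_continuous_onI linear_continuous_on l)
  have "bounded_linear (\<lambda>Z. Re (l Z))" by (rule bounded_linear_compose[OF bounded_linear_Re l])
  from gauss_span_exp_nn[OF h this, of es] show ?thesis
    by (intro integrableI_bounded) (auto simp: norm_exp_eq_Re)
qed

lemma gauss_span_integral_exp:
  fixes l :: "'b::{real_inner, second_countable_topology} \<Rightarrow> complex"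
  assumes h: "h > 0" and l: "bounded_linear l"
  shows "(\<integral>Z. exp (l Z) \<partial>gauss_span h es) = exp (of_real (h / 2) * (\<Sum>e\<leftarrow>es. (l e)\<^sup>2))"
proof (induction es)
  case Nil
  interpret l: bounded_linear l by fact
  have [measurable]: "l \<in> borel_measurable borel"
    by (intro borel_measurable_continuous_onI linear_continuous_on l)
  show ?case by (simp add: integral_return l.zero)
next
  case (Cons e es)
  interpret l: bounded_linear l by fact
  have [measurable]: "l \<in> borel_measurable borel"
    by (intro borel_measurable_continuous_onI linear_continuous_on l)
  have inner: "(\<integral>z. exp (l (Y + z *\<^sub>R e)) \<partial>gauss h) = exp (of_real (h / 2) * (l e)\<^sup>2) * exp (l Y)" for Y
  proof -
    have "(\<integral>z. exp (l (Y + z *\<^sub>R e)) \<partial>gauss h) = (\<integral>z. exp (l Y) * exp (l e * of_real z) \<partial>gauss h)"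
      by (simp add: l.add l.scaleR exp_add scaleR_conv_of_real mult.commute)
    also have "\<dots> = exp (l Y) * exp ((l e)\<^sup>2 * of_real (h / 2))"
      unfolding integral_mult_right_zero gauss_cexp[OF h] ..
    finally show ?thesis by (simp only: mult.commute)
  qed
  have "(\<integral>Z. exp (l Z) \<partial>gauss_span h (e # es)) = (\<integral>Y. (\<integral>z. exp (l (Y + z *\<^sub>R e)) \<partial>gauss h) \<partial>gauss_span h es)"
    by (rule gauss_span_Cons_integral[OF h gauss_span_integrable_exp[OF h l]]) measurable
  also have "\<dots> = exp (of_real (h / 2) * (l e)\<^sup>2) * exp (of_real (h / 2) * (\<Sum>e\<leftarrow>es. (l e)\<^sup>2))"
    unfolding inner integral_mult_right_zero Cons.IH ..
  finally show ?case by (simp add: exp_add[symmetric] distrib_left)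
qed

lemma gauss_span_integrable_exp_bounded:
  fixes f :: "'b::{real_inner, second_countable_topology} \<Rightarrow> complex"
  assumes h: "h > 0" and r: "bounded_linear r" and [measurable]: "f \<in> borel_measurable borel"
    and f: "\<And>Z. cmod (f Z) \<le> C"
  shows "integrable (gauss_span h es) (\<lambda>Z. of_real (exp (r Z)) * f Z)"
proof (rule Bochner_Integration.integrable_bound[where f = "\<lambda>Z. C * exp (r Z)"])
  have [measurable]: "r \<in> borel_measurable borel"
    by (intro borel_measurable_continuous_onI linear_continuous_on r)
  show "integrable (gauss_span h es) (\<lambda>Z. C * exp (r Z))"
    using gauss_span_exp_nn[OF h r, of es]
    by (intro integrable_mult_right integrableI_bounded) auto
  show "(\<lambda>Z. of_real (exp (r Z)) * f Z) \<in> borel_measurable (gauss_span h es)" by measurable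
  have "C \<ge> 0" using f norm_ge_zero order.trans by blast
  then show "AE Z in gauss_span h es. norm (of_real (exp (r Z)) * f Z) \<le> norm (C * exp (r Z))"
    using f by (auto simp: norm_mult mult.commute[of C] intro!: mult_left_mono)
qed

text \<open>The Cameron-Martin formula, one direction at a time: integrating out the direction
  \<open>e\<close> leaves a function \<open>g\<close> that is again bounded and measurable, to which
  the induction hypothesis applies.\<close>

lemma gauss_span_shift:
  fixes f :: "'b::{real_inner, second_countable_topology} \<Rightarrow> complex"
  assumes h: "h > 0" and [measurable]: "f \<in> borel_measurable borel" and f: "\<And>Z. cmod (f Z) \<le> C"
  shows "(\<integral>Z. of_real (exp (X \<bullet> Z / h)) * f Z \<partial>gauss_span h es) =
     of_real (exp ((\<Sum>e\<leftarrow>es. (X \<bullet> e)\<^sup>2) / (2 * h))) * (\<integral>Z. f ((\<Sum>e\<leftarrow>es. (X \<bullet> e) *\<^sub>R e) + Z) \<partial>gauss_span h es)"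
  using assms(2,3)
proof (induction es arbitrary: f)
  case Nil
  note [measurable] = Nil.prems(1)
  show ?case by (simp add: integral_return)
next
  case (Cons e es)
  note [measurable] = Cons.prems(1)
  interpret M2: prob_space "gauss h" by (rule prob_space_gauss[OF h])
  interpret P: prob_space "gauss_span h (e # es)" by (rule prob_space_gauss_span[OF h])
  have r: "bounded_linear (\<lambda>Z. X \<bullet> Z / h)"
    using bounded_linear_compose[OF bounded_linear_mult_right[of "inverse h"] bounded_linear_inner_right[of X]]
    by (simp add: divide_inverse mult.commute)
  define p where "p = (\<Sum>e\<leftarrow>es. (X \<bullet> e) *\<^sub>R e)"
  define g where "g Y = (\<integral>z. f (Y + ((X \<bullet> e) + z) *\<^sub>R e) \<partial>gauss h)" for Y
  have gm: "g \<in> borel_measurable borel" unfolding g_def by measurable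
  have gb: "cmod (g Y) \<le> C" for Y
  proof -
    have "cmod (g Y) \<le> (\<integral>z. cmod (f (Y + ((X \<bullet> e) + z) *\<^sub>R e)) \<partial>gauss h)"
      unfolding g_def by (rule integral_norm_bound)
    also have "\<dots> \<le> C"
    proof (rule M2.integral_le_const)
      show "integrable (gauss h) (\<lambda>z. cmod (f (Y + ((X \<bullet> e) + z) *\<^sub>R e)))"
        by (rule M2.integrable_const_bound[where B = C]) (use Cons.prems(2) in auto)
    qed (use Cons.prems(2) in auto)
    finally show ?thesis .
  qed
  have inner: "(\<integral>z. of_real (exp (X \<bullet> (Y + z *\<^sub>R e) / h)) * f (Y + z *\<^sub>R e) \<partial>gauss h) =
      of_real (exp ((X \<bullet> e)\<^sup>2 / (2 * h))) * (of_real (exp (X \<bullet> Y / h)) * g Y)" for Y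
  proof -
    define q where "q = X \<bullet> e / h"
    have qh: "q * h = X \<bullet> e" "q\<^sup>2 * h / 2 = (X \<bullet> e)\<^sup>2 / (2 * h)"
      using h by (simp_all add: q_def power2_eq_square)
    have "(\<integral>z. of_real (exp (X \<bullet> (Y + z *\<^sub>R e) / h)) * f (Y + z *\<^sub>R e) \<partial>gauss h) =
        (\<integral>z. of_real (exp (X \<bullet> Y / h)) * (exp (q * z) *\<^sub>R f (Y + z *\<^sub>R e)) \<partial>gauss h)"
    proof (rule Bochner_Integration.integral_cong[OF refl])
      fix z
      have "X \<bullet> (Y + z *\<^sub>R e) / h = X \<bullet> Y / h + q * z"
        by (simp add: inner_add_right q_def add_divide_distrib)
      then show "of_real (exp (X \<bullet> (Y + z *\<^sub>R e) / h)) * f (Y + z *\<^sub>R e) =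
          of_real (exp (X \<bullet> Y / h)) * (exp (q * z) *\<^sub>R f (Y + z *\<^sub>R e))"
        by (simp add: exp_add scaleR_conv_of_real del: of_real_exp)
    qed
    also have "\<dots> = of_real (exp (X \<bullet> Y / h)) * (exp (q\<^sup>2 * h / 2) *\<^sub>R (\<integral>z. f (Y + (q * h + z) *\<^sub>R e) \<partial>gauss h))"
      unfolding integral_mult_right_zero
      by (subst gauss_shift(2)[OF h, of "\<lambda>z. f (Y + z *\<^sub>R e)"]) auto
    finally show ?thesis unfolding qh g_def scaleR_conv_of_real by (simp only: mult_ac)
  qed
  have "(\<integral>Z. of_real (exp (X \<bullet> Z / h)) * f Z \<partial>gauss_span h (e # es)) =
      (\<integral>Y. (\<integral>z. of_real (exp (X \<bullet> (Y + z *\<^sub>R e) / h)) * f (Y + z *\<^sub>R e) \<partial>gauss h) \<partial>gauss_span h es)"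
    by (rule gauss_span_Cons_integral[OF h gauss_span_integrable_exp_bounded[OF h r Cons.prems]]) measurable
  also have "\<dots> = of_real (exp ((X \<bullet> e)\<^sup>2 / (2 * h))) * (of_real (exp ((\<Sum>e\<leftarrow>es. (X \<bullet> e)\<^sup>2) / (2 * h))) * (\<integral>Y. g (p + Y) \<partial>gauss_span h es))"
    unfolding inner integral_mult_right_zero Cons.IH[OF gm gb] p_def ..
  also have "(\<integral>Y. g (p + Y) \<partial>gauss_span h es) = (\<integral>Z. f ((X \<bullet> e) *\<^sub>R e + p + Z) \<partial>gauss_span h (e # es))"
  proof -
    have "(\<integral>Z. f ((X \<bullet> e) *\<^sub>R e + p + Z) \<partial>gauss_span h (e # es)) =
        (\<integral>Y. (\<integral>z. f ((X \<bullet> e) *\<^sub>R e + p + (Y + z *\<^sub>R e)) \<partial>gauss h) \<partial>gauss_span h es)"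
      by (rule gauss_span_Cons_integral[OF h P.integrable_const_bound[where B = C]]) (use Cons.prems(2) in auto)
    then show ?thesis unfolding g_def by (simp add: scaleR_add_left add_ac)
  qed
  finally show ?case
    by (simp add: p_def exp_add[symmetric] add_divide_distrib mult.assoc[symmetric] del: of_real_exp flip: of_real_mult)
qed

section \<open>Inverting the heat semigroup\<close>

lemma double_series_bound_summable:
  fixes a :: "nat \<Rightarrow> nat \<Rightarrow> complex"
  assumes a: "\<And>j k. cmod (a j k) \<le> u j * v k"
    and u: "summable u" "\<And>j. u j \<ge> 0" and v: "summable v" "\<And>k. v k \<ge> 0"
  shows "(\<lambda>(j, k). a j k) summable_on UNIV \<times> UNIV"
proof -
  have us: "u summable_on UNIV" "v summable_on UNIV"
    using u v by (simp_all add: summable_on_UNIV_nonneg_real_iff)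
  have "((\<lambda>(j, k). u j * v k) has_sum infsum u UNIV * infsum v UNIV) (UNIV \<times> UNIV)"
    by (rule has_sum_product) (use us u v in simp_all)
  then have "(\<lambda>p. u (fst p) * v (snd p)) summable_on UNIV \<times> UNIV"
    by (simp add: has_sum_imp_summable case_prod_unfold)
  then have "(\<lambda>p. cmod (a (fst p) (snd p))) summable_on UNIV \<times> UNIV"
    by (rule summable_on_comparison_test) (use a in auto)
  then show ?thesis
    unfolding case_prod_unfold by (rule abs_summable_summable)
qed

lemma sums_swap:
  fixes a :: "nat \<Rightarrow> nat \<Rightarrow> complex"
  assumes a: "\<And>j k. cmod (a j k) \<le> u j * v k"
    and u: "summable u" "\<And>j. u j \<ge> 0" and v: "summable v" "\<And>k. v k \<ge> 0"
    and r: "\<And>k. (\<lambda>j. a j k) sums r k"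
  shows "(\<lambda>j. \<Sum>k. a j k) sums (\<Sum>k. r k)"
proof -
  note su = double_series_bound_summable[OF a u v]
  have row: "a j summable_on UNIV" for j
  proof (rule norm_summable_imp_summable_on)
    show "summable (\<lambda>k. cmod (a j k))"
      by (rule summable_comparison_test'[OF summable_mult[OF v(1), of "u j"]]) (use a in simp)
  qed
  have col: "(\<lambda>j. a j k) summable_on UNIV" for k
  proof (rule norm_summable_imp_summable_on)
    show "summable (\<lambda>j. cmod (a j k))"
      by (rule summable_comparison_test'[OF summable_mult2[OF u(1), of "v k"]]) (use a in simp)
  qed
  have row': "infsum (a j) UNIV = (\<Sum>k. a j k)" for j
    using has_sum_imp_sums[OF has_sum_infsum[OF row[of j]]] by (simp add: sums_iff)
  have col': "infsum (\<lambda>j. a j k) UNIV = r k" for k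
    using sums_unique2[OF has_sum_imp_sums[OF has_sum_infsum[OF col[of k]]] r] .
  have su': "(\<lambda>(k, j). a j k) summable_on UNIV \<times> UNIV"
    by (rule double_series_bound_summable[of _ v u]) (use a u v in \<open>simp_all add: mult.commute\<close>)
  have "(\<lambda>j. infsum (a j) UNIV) summable_on UNIV" by (rule summable_on_Sigma_banach[OF su])
  then have "((\<lambda>j. \<Sum>k. a j k) has_sum (\<Sum>\<^sub>\<infinity>j. \<Sum>\<^sub>\<infinity>k. a j k)) UNIV"
    unfolding row' by simp
  also have "(\<Sum>\<^sub>\<infinity>j. \<Sum>\<^sub>\<infinity>k. a j k) = (\<Sum>\<^sub>\<infinity>k. \<Sum>\<^sub>\<infinity>j. a j k)" by (rule infsum_swap_banach[OF su])
  also have "\<dots> = (\<Sum>k. r k)"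
  proof -
    have "(\<lambda>k. infsum (\<lambda>j. a j k) UNIV) summable_on UNIV" by (rule summable_on_Sigma_banach[OF su'])
    then have "(r has_sum infsum r UNIV) UNIV" unfolding col' by simp
    from has_sum_imp_sums[OF this] show ?thesis unfolding col' by (simp add: sums_iff)
  qed
  finally show ?thesis by (rule has_sum_imp_sums)
qed

lemma binomial_cancel:
  "(\<Sum>i\<le>m. (x ^ i / fact i) * ((- x) ^ (m - i) / fact (m - i))) = (if m = 0 then 1 else 0)" for x :: real
proof -
  have "(\<Sum>i\<le>m. (x ^ i / fact i) * ((- x) ^ (m - i) / fact (m - i))) =
      (\<Sum>i\<le>m. (x ^ i /\<^sub>R fact i) * ((- x) ^ (m - i) /\<^sub>R fact (m - i)))"
    by (rule sum.cong) (simp_all add: field_simps)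
  also have "\<dots> = (x + - x) ^ m /\<^sub>R fact m"
    by (rule exp_series_add_commuting[symmetric]) simp
  finally show ?thesis by (cases m) simp_all
qed

lemma power_square_commute: "(x ^ k)\<^sup>2 = (x\<^sup>2) ^ k" for x :: real
  by (simp add: power_mult[symmetric] mult.commute)

text \<open>The identity \<open>exp (x D) exp (- x D) = 1\<close> with \<open>A m\<close> in the
  role of the m-th power of D. The double series converges absolutely; regrouped by
  \<open>m = i + k\<close>, every block vanishes except \<open>m = 0\<close>.\<close>

lemma exp_cancel_sums:
  fixes A :: "nat \<Rightarrow> complex"
  assumes A: "\<And>m. cmod (A m) \<le> B * r ^ m" and r: "r \<ge> 0"
  shows "(\<lambda>i. \<Sum>k. of_real ((x ^ i / fact i) * ((- x) ^ k / fact k)) * A (i + k)) sums A 0"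
proof -
  define f where "f = (\<lambda>(i, k). of_real ((x ^ i / fact i) * ((- x) ^ k / fact k)) * A (i + k))"
  define u where "u i = (\<bar>x\<bar> * r) ^ i / fact i" for i
  have B: "B \<ge> 0" using order.trans[OF norm_ge_zero A[of 0]] by simp
  have us: "summable u" unfolding u_def by (rule sums_summable[OF exp_sums_divide_fact_real])
  have u0: "u i \<ge> 0" for i using r by (simp add: u_def)
  have fb: "cmod (of_real ((x ^ i / fact i) * ((- x) ^ k / fact k)) * A (i + k)) \<le> u i * (B * u k)" for i k
  proof -
    have "cmod (of_real ((x ^ i / fact i) * ((- x) ^ k / fact k)) * A (i + k)) =
        (\<bar>x\<bar> ^ i / fact i) * (\<bar>x\<bar> ^ k / fact k) * cmod (A (i + k))"
      by (simp only: norm_mult norm_of_real abs_mult abs_divide power_abs abs_minus_cancel) simp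
    also have "\<dots> \<le> (\<bar>x\<bar> ^ i / fact i) * (\<bar>x\<bar> ^ k / fact k) * (B * r ^ (i + k))"
      by (intro mult_left_mono A) simp
    also have "\<dots> = u i * (B * u k)" by (simp add: u_def power_mult_distrib power_add)
    finally show ?thesis .
  qed
  have su: "f summable_on UNIV \<times> UNIV"
    unfolding f_def by (rule double_series_bound_summable[OF fb us u0 summable_mult[OF us]]) (use B u0 in simp)
  have row: "(\<lambda>k. f (i, k)) summable_on UNIV" for i
  proof (rule norm_summable_imp_summable_on)
    show "summable (\<lambda>k. cmod (f (i, k)))"
      by (rule summable_comparison_test'[OF summable_mult[OF summable_mult[OF us, of B], of "u i"]])
        (use fb in \<open>simp add: f_def\<close>)
  qed
  have row': "infsum (\<lambda>k. f (i, k)) UNIV = (\<Sum>k. f (i, k))" for i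
    using has_sum_imp_sums[OF has_sum_infsum[OF row[of i]]] by (simp add: sums_iff)
  have su2: "(\<lambda>(i, k). f (i, k)) summable_on UNIV \<times> UNIV" using su by (simp add: case_prod_unfold)
  have "((\<lambda>i. \<Sum>k. f (i, k)) has_sum infsum f (UNIV \<times> UNIV)) UNIV"
    using summable_on_Sigma_banach[OF su2] infsum_Sigma_banach[OF su] unfolding row' by (simp add: has_sum_iff)
  moreover have "infsum f (UNIV \<times> UNIV) = A 0"
  proof -
    have b: "bij_betw (\<lambda>(m, i). (i, m - i)) (Sigma UNIV (\<lambda>m. {..m})) (UNIV \<times> (UNIV :: nat set))"
      by (rule bij_betw_byWitness[where f' = "\<lambda>(i, k). (i + k, i)"]) auto
    have hs: "((\<lambda>p. f ((\<lambda>(m, i). (i, m - i)) p)) has_sum infsum f (UNIV \<times> UNIV)) (Sigma UNIV (\<lambda>m. {..m}))"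
      using su by (subst has_sum_reindex_bij_betw[OF b]) simp
    have "((\<lambda>m :: nat. if m = 0 then A 0 else 0) has_sum infsum f (UNIV \<times> UNIV)) UNIV"
    proof (rule has_sum_SigmaD[OF hs])
      fix m :: nat
      have "(\<Sum>i\<le>m. f (i, m - i)) = of_real (\<Sum>i\<le>m. (x ^ i / fact i) * ((- x) ^ (m - i) / fact (m - i))) * A m"
        unfolding of_real_sum sum_distrib_right by (rule sum.cong) (simp_all add: f_def)
      then have "(\<Sum>i\<le>m. f (i, m - i)) = (if m = 0 then A 0 else 0)"
        unfolding binomial_cancel by simp
      then show "((\<lambda>i. f (case (m, i) of (m, i) \<Rightarrow> (i, m - i))) has_sum (if m = 0 then A 0 else 0)) {..m}"
        by (intro has_sum_finiteI) simp_all
    qed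
    moreover have "((\<lambda>m. if m = 0 then A 0 else 0) has_sum (\<Sum>m\<in>{0::nat}. if m = 0 then A 0 else 0)) (UNIV :: nat set)"
      by (rule has_sum_cong_neutral[THEN iffD1, OF _ _ _ has_sum_finite[of "{0::nat}"]]) auto
    ultimately show ?thesis using has_sum_unique by fastforce
  qed
  ultimately show ?thesis
    by (intro has_sum_imp_sums) (simp add: f_def)
qed

text \<open>The geometric bound on the derivatives beats the factorial in the Lagrange remainder.
  The remainder exists for real functions, so complex ones are treated through real and imaginary
  parts.\<close>

lemma real_taylor_sums:
  fixes f :: "nat \<Rightarrow> real \<Rightarrow> real"
  assumes d: "\<And>m x. DERIV (f m) x :> f (Suc m) x" and b: "\<And>m x. \<bar>f m x\<bar> \<le> A * r ^ m"
  shows "(\<lambda>m. z ^ m / fact m * f m 0) sums f 0 z"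
proof -
  have "(\<lambda>n. \<Sum>m<n. z ^ m / fact m * f m 0) \<longlonglongrightarrow> f 0 z"
  proof (rule LIM_zero_cancel, rule Lim_null_comparison[OF always_eventually[OF allI]])
    fix n
    obtain t where "f 0 z = (\<Sum>m<n. (f m 0 / fact m) * z ^ m) + (f n t / fact n) * z ^ n"
      using Maclaurin_all_le[of f "f 0" z n] d by blast
    moreover have "(\<Sum>m<n. (f m 0 / fact m) * z ^ m) = (\<Sum>m<n. z ^ m / fact m * f m 0)"
      by (rule sum.cong) simp_all
    ultimately have "norm ((\<Sum>m<n. z ^ m / fact m * f m 0) - f 0 z) = \<bar>f n t\<bar> * (\<bar>z\<bar> ^ n / fact n)"
      by (simp add: abs_mult power_abs)
    also have "\<dots> \<le> (A * r ^ n) * (\<bar>z\<bar> ^ n / fact n)"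
      by (intro mult_right_mono b) simp
    finally show "norm ((\<Sum>m<n. z ^ m / fact m * f m 0) - f 0 z) \<le> A * ((r * \<bar>z\<bar>) ^ n / fact n)"
      by (simp add: power_mult_distrib)
  next
    have "(\<lambda>n. (r * \<bar>z\<bar>) ^ n / fact n) \<longlonglongrightarrow> 0"
      by (rule summable_LIMSEQ_zero[OF sums_summable[OF exp_sums_divide_fact_real]])
    then show "(\<lambda>n. A * ((r * \<bar>z\<bar>) ^ n / fact n)) \<longlonglongrightarrow> 0" by (rule tendsto_mult_right_zero)
  qed
  then show ?thesis by (simp add: sums_def)
qed

text \<open>\<open>heat_inv h F [e\<^sub>1, \<dots>, e\<^sub>n] []\<close> is the product of the operators \<open>exp (- (h/2) \<partial>\<^sup>2)\<close>, with \<open>\<partial>\<close> the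
  derivative along \<open>e\<^sub>i\<close>, applied to \<open>F\<close>; the list \<open>Vs\<close> records further derivatives. They are applied
  outermost, so that the symmetry of the differentials is not used.\<close>

primrec heat_inv ::
  "real \<Rightarrow> ('b::real_normed_vector \<Rightarrow> complex) \<Rightarrow> 'b list \<Rightarrow> 'b list \<Rightarrow> 'b \<Rightarrow> complex" where
  "heat_inv h F [] = (\<lambda>Vs X. nderiv F Vs X)"
| "heat_inv h F (e # es) = (\<lambda>Vs X.
     \<Sum>k. of_real ((- (h / 2)) ^ k / fact k) * heat_inv h F es (Vs @ replicate (2 * k) e) X)"

text \<open>Here \<open>q\<close> stands for the square root of the quadratic form Q, and
  \<open>bound\<close> is the estimate that defines the symbol class, with constant
  \<open>C\<close>.\<close>

context
  fixes q :: "'b::{real_inner, second_countable_topology} \<Rightarrow> real" and F :: "'b \<Rightarrow> complex" and C h :: real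
  assumes q: "\<And>V. q V \<ge> 0" and diff: "\<And>Vs X. nderiv F Vs differentiable (at X)"
    and bound: "\<And>Vs X. cmod (nderiv F Vs X) \<le> C * prod_list (map q Vs)" and h: "h > 0"
begin

lemma prod_q_nonneg: "prod_list (map q Vs) \<ge> 0"
  by (induction Vs) (auto simp: q)

lemma C_nonneg: "C \<ge> 0"
  using order.trans[OF norm_ge_zero bound[of "[]"]] by simp

lemma nderiv_line_derivative:
  "((\<lambda>t. nderiv F Vs (X + t *\<^sub>R V)) has_vector_derivative nderiv F (V # Vs) (X + t *\<^sub>R V)) (at t)"
proof -
  define D where "D = frechet_derivative (nderiv F Vs) (at (X + t *\<^sub>R V))"
  have D: "(nderiv F Vs has_derivative D) (at (X + t *\<^sub>R V))"
    using diff[of Vs] unfolding D_def by (simp only: frechet_derivative_works)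
  have l: "((\<lambda>t. X + t *\<^sub>R V) has_derivative (\<lambda>s. s *\<^sub>R V)) (at t)"
    by (auto intro!: derivative_eq_intros)
  have "((\<lambda>t. nderiv F Vs (X + t *\<^sub>R V)) has_derivative (\<lambda>s. D (s *\<^sub>R V))) (at t)"
    by (rule has_derivative_compose[OF l D])
  moreover have "D (s *\<^sub>R V) = s *\<^sub>R D V" for s
    using has_derivative_bounded_linear[OF D] by (simp add: bounded_linear.linear linear_scale)
  ultimately show ?thesis by (simp add: has_vector_derivative_def D_def)
qed

lemma nderiv_taylor:
  "(\<lambda>j. of_real (z ^ j / fact j) * nderiv F (replicate j V @ Vs) X) sums nderiv F Vs (X + z *\<^sub>R V)"
proof -
  define \<phi> where "\<phi> j t = nderiv F (replicate j V @ Vs) (X + t *\<^sub>R V)" for j t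
  have d: "(\<phi> j has_vector_derivative \<phi> (Suc j) t) (at t)" for j t
    using nderiv_line_derivative[of "replicate j V @ Vs" X V t] by (simp add: \<phi>_def[abs_def])
  have b: "cmod (\<phi> j t) \<le> (C * prod_list (map q Vs)) * q V ^ j" for j t
    using bound[of "replicate j V @ Vs" "X + t *\<^sub>R V"] by (simp add: \<phi>_def mult_ac)
  have "(\<lambda>j. z ^ j / fact j * Re (\<phi> j 0)) sums Re (\<phi> 0 z)"
  proof (rule real_taylor_sums)
    show "DERIV (\<lambda>t. Re (\<phi> m t)) x :> Re (\<phi> (Suc m) x)" for m x
      unfolding has_real_derivative_iff_has_vector_derivative
      by (rule bounded_linear.has_vector_derivative[OF bounded_linear_Re d])
    show "\<bar>Re (\<phi> m x)\<bar> \<le> (C * prod_list (map q Vs)) * q V ^ m" for m x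
      by (rule order.trans[OF abs_Re_le_cmod b])
  qed
  moreover have "(\<lambda>j. z ^ j / fact j * Im (\<phi> j 0)) sums Im (\<phi> 0 z)"
  proof (rule real_taylor_sums)
    show "DERIV (\<lambda>t. Im (\<phi> m t)) x :> Im (\<phi> (Suc m) x)" for m x
      unfolding has_real_derivative_iff_has_vector_derivative
      by (rule bounded_linear.has_vector_derivative[OF bounded_linear_Im d])
    show "\<bar>Im (\<phi> m x)\<bar> \<le> (C * prod_list (map q Vs)) * q V ^ m" for m x
      by (rule order.trans[OF abs_Im_le_cmod b])
  qed
  ultimately have "(\<lambda>j. of_real (z ^ j / fact j) * \<phi> j 0) sums \<phi> 0 z"
    unfolding sums_complex_iff by (simp only: Re_complex_of_real Im_complex_of_real times_complex.sel mult_zero_left diff_0_right add_0_right)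
  then show ?thesis by (simp add: \<phi>_def)
qed

definition heat_const :: "'b list \<Rightarrow> real" where
  "heat_const es = exp (h / 2 * (\<Sum>e\<leftarrow>es. (q e)\<^sup>2))"

lemma heat_const_Cons: "heat_const (e # es) = exp (h / 2 * (q e)\<^sup>2) * heat_const es"
  by (simp add: heat_const_def exp_add[symmetric] distrib_left)

text \<open>A pair of derivatives along \<open>e\<close> costs \<open>(q e)^2\<close>, which is
  Q(e), so the series in this direction is dominated by \<open>exp ((h / 2) * (q e)^2)\<close>. This
  is the origin of the exponential constant in the norm estimate.\<close>

lemma heat_inv_bound:
  "cmod (heat_inv h F es Vs X) \<le> C * prod_list (map q Vs) * heat_const es"
proof (induction es arbitrary: Vs)
  case (Cons e es)
  define K where "K = C * prod_list (map q Vs) * heat_const es"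
  define a where "a k = of_real ((- (h / 2)) ^ k / fact k) * heat_inv h F es (Vs @ replicate (2 * k) e) X" for k
  have s: "(\<lambda>k. K * ((h / 2 * (q e)\<^sup>2) ^ k / fact k)) sums (K * exp (h / 2 * (q e)\<^sup>2))"
    by (intro sums_mult exp_sums_divide_fact_real)
  have t: "cmod (a k) \<le> K * ((h / 2 * (q e)\<^sup>2) ^ k / fact k)" for k
  proof -
    have "cmod (a k) = (h / 2) ^ k / fact k * cmod (heat_inv h F es (Vs @ replicate (2 * k) e) X)"
      using h by (simp add: a_def norm_mult norm_divide norm_power)
    also have "\<dots> \<le> (h / 2) ^ k / fact k * (C * prod_list (map q (Vs @ replicate (2 * k) e)) * heat_const es)"
      by (rule mult_left_mono[OF Cons.IH]) (use h in simp)
    also have "\<dots> = K * ((h / 2 * (q e)\<^sup>2) ^ k / fact k)"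
      unfolding power_mult_distrib[of "h / 2"] by (simp add: K_def power_mult power_square_commute mult_ac)
    finally show ?thesis .
  qed
  have "summable (\<lambda>k. cmod (a k))"
    by (rule summable_comparison_test'[OF sums_summable[OF s]]) (use t in simp)
  then have "cmod (\<Sum>k. a k) \<le> (\<Sum>k. K * ((h / 2 * (q e)\<^sup>2) ^ k / fact k))"
    by (intro order.trans[OF summable_norm suminf_le[OF t]] sums_summable[OF s])
  then show ?case
    unfolding sums_unique[OF s, symmetric] by (simp add: a_def K_def heat_const_Cons mult_ac)
qed (use bound in \<open>simp add: heat_const_def\<close>)

text \<open>The Taylor expansion passes through the series of \<open>heat_inv\<close> by exchanging
  two sums, so no differentiation under a series occurs. The exchange is justified by a bound that
  factors into a function of \<open>j\<close> and one of \<open>k\<close>.\<close>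

lemma heat_inv_taylor:
  "(\<lambda>j. of_real (z ^ j / fact j) * heat_inv h F es (replicate j V @ Vs) X) sums heat_inv h F es Vs (X + z *\<^sub>R V)"
proof (induction es arbitrary: Vs)
  case Nil
  then show ?case using nderiv_taylor by simp
next
  case (Cons e es)
  define K where "K = C * prod_list (map q Vs) * heat_const es"
  define c where "c k = complex_of_real ((- (h / 2)) ^ k / fact k)" for k
  define a where "a j k = c k * (of_real (z ^ j / fact j) * heat_inv h F es (replicate j V @ Vs @ replicate (2 * k) e) X)" for j k
  have K0: "K \<ge> 0" unfolding K_def heat_const_def by (intro mult_nonneg_nonneg C_nonneg prod_q_nonneg) simp
  have "(\<lambda>j. \<Sum>k. a j k) sums (\<Sum>k. c k * heat_inv h F es (Vs @ replicate (2 * k) e) (X + z *\<^sub>R V))"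
  proof (rule sums_swap)
    show "(\<lambda>j. a j k) sums (c k * heat_inv h F es (Vs @ replicate (2 * k) e) (X + z *\<^sub>R V))" for k
      unfolding a_def by (intro sums_mult Cons.IH)
    show "summable (\<lambda>j. (\<bar>z\<bar> * q V) ^ j / fact j)" by (rule sums_summable[OF exp_sums_divide_fact_real])
    show "summable (\<lambda>k. K * ((h / 2 * (q e)\<^sup>2) ^ k / fact k))"
      by (rule summable_mult[OF sums_summable[OF exp_sums_divide_fact_real]])
    show "(\<bar>z\<bar> * q V) ^ j / fact j \<ge> 0" for j using q by simp
    show "K * ((h / 2 * (q e)\<^sup>2) ^ k / fact k) \<ge> 0" for k using K0 h by simp
    fix j k
    have "cmod (a j k) = (h / 2) ^ k / fact k * (\<bar>z\<bar> ^ j / fact j * cmod (heat_inv h F es (replicate j V @ Vs @ replicate (2 * k) e) X))"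
      using h by (simp add: a_def c_def norm_mult norm_divide norm_power)
    also have "\<dots> \<le> (h / 2) ^ k / fact k * (\<bar>z\<bar> ^ j / fact j * (C * prod_list (map q (replicate j V @ Vs @ replicate (2 * k) e)) * heat_const es))"
      by (intro mult_left_mono heat_inv_bound) (use h in simp_all)
    also have "\<dots> = (\<bar>z\<bar> * q V) ^ j / fact j * (K * ((h / 2 * (q e)\<^sup>2) ^ k / fact k))"
      unfolding power_mult_distrib[of "h / 2"] by (simp add: K_def power_mult power_mult_distrib power_square_commute mult_ac)
    finally show "cmod (a j k) \<le> (\<bar>z\<bar> * q V) ^ j / fact j * (K * ((h / 2 * (q e)\<^sup>2) ^ k / fact k))" .
  qed
  moreover have "(\<Sum>k. a j k) = of_real (z ^ j / fact j) * heat_inv h F (e # es) (replicate j V @ Vs) X" for j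
  proof -
    define d where "d k = c k * heat_inv h F es (replicate j V @ Vs @ replicate (2 * k) e) X" for k
    have "summable d"
    proof (rule summable_comparison_test'[OF summable_mult[OF sums_summable[OF exp_sums_divide_fact_real]]])
      fix k
      have "cmod (d k) = (h / 2) ^ k / fact k * cmod (heat_inv h F es (replicate j V @ Vs @ replicate (2 * k) e) X)"
        using h by (simp add: d_def c_def norm_mult norm_divide norm_power)
      also have "\<dots> \<le> (h / 2) ^ k / fact k * (C * prod_list (map q (replicate j V @ Vs @ replicate (2 * k) e)) * heat_const es)"
        by (intro mult_left_mono heat_inv_bound) (use h in simp_all)
      also have "\<dots> = (q V ^ j * K) * ((h / 2 * (q e)\<^sup>2) ^ k / fact k)"
        unfolding power_mult_distrib[of "h / 2"] by (simp add: K_def power_mult power_square_commute mult_ac)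
      finally show "cmod (d k) \<le> (q V ^ j * K) * ((h / 2 * (q e)\<^sup>2) ^ k / fact k)" .
    qed
    have "(\<Sum>k. a j k) = (\<Sum>k. of_real (z ^ j / fact j) * d k)"
      by (rule arg_cong[of _ _ suminf], rule ext) (simp only: a_def d_def mult.left_commute)
    also have "\<dots> = of_real (z ^ j / fact j) * suminf d" by (rule suminf_mult) fact
    also have "suminf d = heat_inv h F (e # es) (replicate j V @ Vs) X"
      by (simp only: heat_inv.simps d_def[abs_def] c_def append_assoc)
    finally show ?thesis .
  qed
  ultimately show ?case by (simp add: c_def)
qed

lemma heat_inv_measurable [measurable]: "heat_inv h F es Vs \<in> borel_measurable borel"
proof (induction es arbitrary: Vs)
  case Nil
  have "continuous_on UNIV (nderiv F Vs)"
    using diff by (intro differentiable_imp_continuous_on) (simp add: differentiable_on_def)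
  then show ?case by (simp add: borel_measurable_continuous_onI)
next
  case (Cons e es)
  note [measurable] = Cons.IH
  show ?case by simp
qed

text \<open>Gaussian averaging along \<open>e\<close> acts on Taylor coefficients as
  \<open>exp ((h/2) d^2)\<close>, the operator just applied as \<open>exp (- (h/2) d^2)\<close>; the
  two series cancel.\<close>

lemma heat_inv_gauss:
  "(\<integral>z. heat_inv h F (e # es) [] (X + z *\<^sub>R e) \<partial>gauss h) = heat_inv h F es [] X"
proof -
  \<comment> \<open>Derivatives along \<open>e\<close> before (\<open>a\<close>) and after
    (\<open>b\<close>) the inverse heat operator in the direction \<open>e\<close>.\<close>
  define a where "a m = heat_inv h F es (replicate m e) X" for m
  define b where "b j = heat_inv h F (e # es) (replicate j e) X" for j
  have ab: "b j = (\<Sum>k. of_real ((- (h / 2)) ^ k / fact k) * a (j + 2 * k))" for j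
    by (simp add: b_def a_def replicate_add)
  have bb: "cmod (b j) \<le> (C * heat_const (e # es)) * q e ^ j" for j
    using heat_inv_bound[of "e # es" "replicate j e" X] by (simp only: b_def map_replicate prod_list_replicate mult_ac)
  have T: "heat_inv h F (e # es) [] (X + z *\<^sub>R e) = (\<Sum>j. b j * of_real (z ^ j / fact j))" for z
    using sums_unique[OF heat_inv_taylor[of z "e # es" e "[]" X]]
    by (simp only: b_def append_Nil2 mult.commute)
  have "(\<lambda>i. b (2 * i) * of_real ((h / 2) ^ i / fact i)) sums (\<integral>z. heat_inv h F (e # es) [] (X + z *\<^sub>R e) \<partial>gauss h)"
    unfolding T by (rule gauss_power_series[OF h q bb])
  moreover have "(\<lambda>i. \<Sum>k. of_real (((h / 2) ^ i / fact i) * ((- (h / 2)) ^ k / fact k)) * a (2 * (i + k))) sums a (2 * 0)"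
  proof (rule exp_cancel_sums[where A = "\<lambda>m. a (2 * m)"])
    show "cmod (a (2 * m)) \<le> (C * heat_const es) * ((q e)\<^sup>2) ^ m" for m
      using heat_inv_bound[of es "replicate (2 * m) e" X] by (simp add: a_def power_mult power_square_commute mult_ac)
  qed simp
  moreover have "b (2 * i) * of_real ((h / 2) ^ i / fact i) =
      (\<Sum>k. of_real (((h / 2) ^ i / fact i) * ((- (h / 2)) ^ k / fact k)) * a (2 * (i + k)))" for i
  proof -
    define d where "d k = of_real ((- (h / 2)) ^ k / fact k) * a (2 * i + 2 * k)" for k
    define K where "K = C * heat_const es * q e ^ (2 * i)"
    have "summable d"
    proof (rule summable_comparison_test'[OF summable_mult[OF sums_summable[OF exp_sums_divide_fact_real]]])
      fix k
      have "cmod (d k) = (h / 2) ^ k / fact k * cmod (a (2 * i + 2 * k))"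
        using h by (simp add: d_def norm_mult norm_divide norm_power)
      also have "\<dots> \<le> (h / 2) ^ k / fact k * (C * prod_list (map q (replicate (2 * i + 2 * k) e)) * heat_const es)"
        unfolding a_def by (intro mult_left_mono heat_inv_bound) (use h in simp_all)
      also have "\<dots> = K * ((h / 2 * (q e)\<^sup>2) ^ k / fact k)"
        unfolding power_mult_distrib[of "h / 2"] by (simp add: K_def power_mult power_add power_square_commute mult_ac)
      finally show "cmod (d k) \<le> K * ((h / 2 * (q e)\<^sup>2) ^ k / fact k)" .
    qed
    have "b (2 * i) = suminf d" unfolding ab d_def[abs_def] ..
    then have "b (2 * i) * of_real ((h / 2) ^ i / fact i) = (\<Sum>k. d k * of_real ((h / 2) ^ i / fact i))"
      using suminf_mult2[OF \<open>summable d\<close>] by (simp only:)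
    also have "\<dots> = (\<Sum>k. of_real (((h / 2) ^ i / fact i) * ((- (h / 2)) ^ k / fact k)) * a (2 * (i + k)))"
      by (rule arg_cong[of _ _ suminf], rule ext) (simp only: d_def of_real_mult distrib_left distrib_right mult_ac)
    finally show ?thesis .
  qed
  ultimately have "(\<integral>z. heat_inv h F (e # es) [] (X + z *\<^sub>R e) \<partial>gauss h) = a (2 * 0)"
    using sums_unique2 by (simp only:) blast
  then show ?thesis by (simp add: a_def)
qed

lemma heat_inv_gauss_span:
  "(\<integral>Z. heat_inv h F es [] (X + Z) \<partial>gauss_span h es) = F X"
proof (induction es)
  case Nil
  have [measurable]: "F \<in> borel_measurable borel" using heat_inv_measurable[of "[]" "[]"] by simp
  show ?case by (simp add: integral_return)
next
  case (Cons e es)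
  interpret P: prob_space "gauss_span h (e # es)" by (rule prob_space_gauss_span[OF h])
  have "(\<integral>Z. heat_inv h F (e # es) [] (X + Z) \<partial>gauss_span h (e # es)) =
      (\<integral>Y. (\<integral>z. heat_inv h F (e # es) [] (X + (Y + z *\<^sub>R e)) \<partial>gauss h) \<partial>gauss_span h es)"
  proof (rule gauss_span_Cons_integral[OF h P.integrable_const_bound])
    show "AE Z in gauss_span h (e # es). cmod (heat_inv h F (e # es) [] (X + Z)) \<le> C * prod_list (map q []) * heat_const (e # es)"
      by (intro always_eventually allI heat_inv_bound)
    show m: "(\<lambda>Z. heat_inv h F (e # es) [] (X + Z)) \<in> borel_measurable borel"
      by (rule measurable_compose[OF _ heat_inv_measurable]) measurable
    show "(\<lambda>Z. heat_inv h F (e # es) [] (X + Z)) \<in> borel_measurable (gauss_span h (e # es))"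
      using m by (simp only: measurable_cong_sets[OF sets_gauss_span refl])
  qed
  also have "\<dots> = (\<integral>Y. heat_inv h F es [] (X + Y) \<partial>gauss_span h es)"
    unfolding add.assoc[symmetric] heat_inv_gauss ..
  finally show ?case using Cons.IH by simp
qed

text \<open>The left side is the diagonal of the anti-Wick form on coherent vectors. For an
  orthonormal list, \<open>F\<close> is evaluated at the projection of \<open>X\<close>, and the
  exponent contains the squared norm of that projection.\<close>

lemma heat_inv_gauss_span_exp:
  "(\<integral>Z. of_real (exp (X \<bullet> Z / h)) * heat_inv h F es [] Z \<partial>gauss_span h es) =
     of_real (exp ((\<Sum>e\<leftarrow>es. (X \<bullet> e)\<^sup>2) / (2 * h))) * F (\<Sum>e\<leftarrow>es. (X \<bullet> e) *\<^sub>R e)"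
  unfolding gauss_span_shift[OF h heat_inv_measurable heat_inv_bound] heat_inv_gauss_span ..

end

section \<open>Anti-Wick quantization of cylindrical symbols\<close>

definition evec_combos :: "real \<Rightarrow> 'a::{real_inner, second_countable_topology} fk set" where
  "evec_combos h = {x. \<exists>ts. x = (\<Sum>(c, X)\<leftarrow>ts. cmul c (evec h X))}"

lemma evec_combos_closed_ops:
  "0 \<in> evec_combos h"
  "x \<in> evec_combos h \<Longrightarrow> y \<in> evec_combos h \<Longrightarrow> x + y \<in> evec_combos h"
  "x \<in> evec_combos h \<Longrightarrow> cmul c x \<in> evec_combos h"
proof -
  show "0 \<in> evec_combos h" unfolding evec_combos_def by (rule CollectI, rule exI[of _ "[]"]) simp
next
  assume "x \<in> evec_combos h" "y \<in> evec_combos h"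
  then obtain ts us where "x = (\<Sum>(c, X)\<leftarrow>ts. cmul c (evec h X))" "y = (\<Sum>(c, X)\<leftarrow>us. cmul c (evec h X))"
    by (auto simp: evec_combos_def)
  then have "x + y = (\<Sum>(c, X)\<leftarrow>ts @ us. cmul c (evec h X))" by simp
  then show "x + y \<in> evec_combos h" unfolding evec_combos_def by blast
next
  assume "x \<in> evec_combos h"
  then obtain ts where x: "x = (\<Sum>(c, X)\<leftarrow>ts. cmul c (evec h X))" by (auto simp: evec_combos_def)
  interpret L: bounded_linear "cmul c" by (rule bounded_linear_cmul)
  have "cmul c (\<Sum>(c, X)\<leftarrow>ts. cmul c (evec h X)) = (\<Sum>(c, X)\<leftarrow>map (\<lambda>(d, X). (c * d, X)) ts. cmul c (evec h X))" for ts
    by (induction ts) (auto simp: L.zero cmul_add cmul_cmul)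
  then show "cmul c x \<in> evec_combos h" unfolding evec_combos_def x by blast
qed

lemma evec_combos_dense:
  fixes x :: "'a::{real_inner, second_countable_topology} fk"
  assumes h: "h > 0" shows "x \<in> closure (evec_combos h)"
proof (rule csubspace_evec_UNIV[OF closed_closure _ h])
  show "evec h X \<in> closure (evec_combos h)" for X
  proof (rule subsetD[OF closure_subset])
    show "evec h X \<in> evec_combos h"
      unfolding evec_combos_def by (rule CollectI, rule exI[of _ "[(1, X)]"]) (simp add: cmul_one)
  qed
  have cm: "cmul c x \<in> closure (evec_combos h)" if x: "x \<in> closure (evec_combos h)" for c and x :: "'a fk"
  proof -
    obtain u where u: "\<And>n. u n \<in> evec_combos h" "u \<longlonglongrightarrow> x" using x unfolding closure_sequential by blast
    have "(\<lambda>n. cmul c (u n)) \<longlonglongrightarrow> cmul c x" by (rule bounded_linear.tendsto[OF bounded_linear_cmul u(2)])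
    then show ?thesis
      unfolding closure_sequential by (intro exI[of _ "\<lambda>n. cmul c (u n)"] conjI allI evec_combos_closed_ops(3) u)
  qed
  have ad: "x + y \<in> closure (evec_combos h)"
    if xy: "x \<in> closure (evec_combos h)" "y \<in> closure (evec_combos h)" for x y :: "'a fk"
  proof -
    obtain u v where u: "\<And>n. u n \<in> evec_combos h" "u \<longlonglongrightarrow> x" and v: "\<And>n. v n \<in> evec_combos h" "v \<longlonglongrightarrow> y"
      using xy unfolding closure_sequential by blast
    have "(\<lambda>n. u n + v n) \<longlonglongrightarrow> x + y" by (rule tendsto_add[OF u(2) v(2)])
    then show ?thesis
      unfolding closure_sequential by (intro exI[of _ "\<lambda>n. u n + v n"] conjI allI evec_combos_closed_ops(2) u v)
  qed
  show "csubspace (closure (evec_combos h) :: 'a fk set)"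
    unfolding csubspace_def subspace_def scaleR_cmul
    using subsetD[OF closure_subset evec_combos_closed_ops(1)] by (intro conjI ballI allI cm ad)
qed

lemma continuous_cinner:
  "continuous_on UNIV (\<lambda>Z. cinner Z W)" "continuous_on UNIV (\<lambda>Z. cinner W Z)" "continuous_on UNIV (\<lambda>Z. cinner Z Z)"
  unfolding cinner_def Complex_eq by (intro continuous_intros)+

text \<open>The squared distance of two coherent vectors is an explicit combination of exponentials
  of inner products of their parameters.\<close>

lemma continuous_evec:
  assumes h: "h > 0" shows "continuous_on UNIV (evec h)"
proof -
  have "(evec h \<longlongrightarrow> evec h W) (at W)" for W :: "'a \<times> 'a"
  proof -
    define g where "g Z = Re (exp (cinner Z Z / of_real (2 * h)) - exp (cinner Z W / of_real (2 * h)) -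
        exp (cinner W Z / of_real (2 * h)) + exp (cinner W W / of_real (2 * h)))" for Z
    have cont: "continuous_on UNIV g"
      unfolding g_def by (intro continuous_intros continuous_cinner) (use h in auto)
    have "(g \<longlongrightarrow> g W) (at W)" using cont unfolding continuous_on_def by blast
    moreover have "g W = 0" by (simp add: g_def)
    ultimately have "((\<lambda>Z. sqrt (g Z)) \<longlongrightarrow> 0) (at W)" using tendsto_real_sqrt[of g 0 "at W"] by simp
    moreover have "sqrt (g Z) = norm (evec h Z - evec h W)" for Z
    proof -
      interpret L: bounded_linear "\<lambda>x. cip x y" for y by (rule bounded_linear_cip_left)
      interpret R: bounded_linear "cip x" for x by (rule bounded_linear_cip_right)
      have "(norm (evec h Z - evec h W))\<^sup>2 = Re (cip (evec h Z - evec h W) (evec h Z - evec h W))"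
        by (simp add: cip_self)
      also have "\<dots> = g Z" unfolding L.diff R.diff cip_evec[OF h] g_def by simp
      finally show ?thesis by (rule real_sqrt_unique[OF _ norm_ge_zero])
    qed
    ultimately have "((\<lambda>Z. norm (evec h Z - evec h W)) \<longlongrightarrow> 0) (at W)" by simp
    then show ?thesis by (rule LIM_zero_cancel[OF tendsto_norm_zero_cancel])
  qed
  then show ?thesis unfolding continuous_on_def by blast
qed

lemma cip_evec_measurable:
  assumes h: "h > 0"
  shows "(\<lambda>Z. cip x (evec h Z)) \<in> borel_measurable borel" "(\<lambda>Z. cnj (cip x (evec h Z))) \<in> borel_measurable borel"
proof -
  have "continuous_on UNIV (cip x)" by (rule linear_continuous_on[OF bounded_linear_cip_right])
  from continuous_on_compose2[OF this continuous_evec[OF h]]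
  have c: "continuous_on UNIV (\<lambda>Z. cip x (evec h Z))" by simp
  show "(\<lambda>Z. cip x (evec h Z)) \<in> borel_measurable borel"
    by (rule borel_measurable_continuous_onI[OF c])
  show "(\<lambda>Z. cnj (cip x (evec h Z))) \<in> borel_measurable borel"
    by (rule borel_measurable_continuous_onI[OF continuous_on_cnj[OF c]])
qed

text \<open>A real basis of the complex span of \<open>xs\<close>, as \<open>(0, e)\<close> is
  \<open>\<i>\<close> times \<open>(e, 0)\<close>.\<close>

definition realify :: "'a::real_inner list \<Rightarrow> ('a \<times> 'a) list" where
  "realify xs = concat (map (\<lambda>e. [(e, 0), (0, e)]) xs)"

lemma sum_list_realify:
  fixes \<phi> :: "'a::real_inner \<times> 'a \<Rightarrow> 'c::ab_group_add"
  assumes "distinct xs"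
  shows "(\<Sum>f\<leftarrow>realify xs. \<phi> f) = (\<Sum>e\<in>set xs. \<phi> (e, 0) + \<phi> (0, e))"
proof -
  have "(\<Sum>f\<leftarrow>realify xs. \<phi> f) = (\<Sum>e\<leftarrow>xs. \<phi> (e, 0) + \<phi> (0, e))"
    by (induction xs) (simp_all add: realify_def add.assoc)
  then show ?thesis using sum_list_distinct_conv_sum_set[OF assms] by metis
qed

definition cproj :: "'a::real_inner set \<Rightarrow> 'a \<times> 'a \<Rightarrow> 'a \<times> 'a" where
  "cproj S X = (\<Sum>e\<in>S. cscale (cinner X (e, 0)) (e, 0))"

lemma cinner_sum_left: "cinner (\<Sum>i\<in>I. f i) Y = (\<Sum>i\<in>I. cinner (f i) Y)"
proof (induction I rule: infinite_finite_induct)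
  case (insert i I) then show ?case by (simp add: cinner_simps)
qed (simp_all add: cinner_def complex_eq_iff)

lemma cinner_cproj: "cinner (cproj S X) Y = (\<Sum>e\<in>S. cinner X (e, 0) * cinner (e, 0) Y)"
  unfolding cproj_def cinner_sum_left cinner_simps ..

lemma cinner_cproj_cproj:
  assumes S: "finite S" "orthonormal S"
  shows "cinner (cproj S X) (cproj S Y) = cinner (cproj S X) Y"
  unfolding cinner_cproj
proof (rule sum.cong[OF refl])
  fix e assume e: "e \<in> S"
  have "cinner (cproj S Y) (e, 0) = (\<Sum>d\<in>S. if d = e then cinner Y (d, 0) else 0)"
    unfolding cinner_cproj
  proof (rule sum.cong[OF refl])
    fix d assume "d \<in> S"
    then have "cinner (d, 0) (e, 0) = (if d = e then 1 else 0)"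
      using orthonormal_inner[OF S(2) _ e, of d] by (simp add: cinner_def complex_eq_iff)
    then show "cinner Y (d, 0) * cinner (d, 0) (e, 0) = (if d = e then cinner Y (d, 0) else 0)" by simp
  qed
  then have "cinner (cproj S Y) (e, 0) = cinner Y (e, 0)" using S(1) e by simp
  then have "cinner (e, 0) (cproj S Y) = cinner (e, 0) Y"
    using cinner_commute[of "(e, 0)" "cproj S Y"] cinner_commute[of "(e, 0)" Y] by simp
  then show "cinner X (e, 0) * cinner (e, 0) (cproj S Y) = cinner X (e, 0) * cinner (e, 0) Y" by simp
qed

lemma bounded_linear_cinner_sum:
  "bounded_linear (\<lambda>Z. (cinner X Z + cinner Z Y) / of_real (2 * h))"
proof (rule bounded_linear_compose[OF bounded_linear_divide bounded_linear_add])
  show "bounded_linear (cinner X)"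
    by (rule bounded_linear_intro[where K = "norm X"])
      (simp_all add: cinner_simps scaleR_eq_cscale scaleR_conv_of_real mult.commute, metis mult.commute norm_cinner_le)
  show "bounded_linear (\<lambda>Z. cinner Z Y)"
    by (rule bounded_linear_intro[where K = "norm Y"])
      (simp_all add: cinner_simps scaleR_eq_cscale scaleR_conv_of_real norm_cinner_le)
qed

text \<open>The exponent \<open>l\<close> is real linear in Z. In the sum of its squares at
  \<open>(e, 0)\<close> and \<open>\<i> (e, 0)\<close> the squares of \<open>cinner X (e, 0)\<close>
  and \<open>cinner (e, 0) Y\<close> cancel and only their product survives; here the subspace must
  be complex. The variance \<open>h\<close> is the one that reproduces the denominator
  \<open>2 h\<close> of the kernel.\<close>

lemma gauss_kernel:
  assumes h: "h > 0" and xs: "distinct xs"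
  shows "integrable (gauss_span h (realify xs)) (\<lambda>Z. cip (evec h X) (evec h Z) * cip (evec h Z) (evec h Y))"
    "(\<integral>Z. cip (evec h X) (evec h Z) * cip (evec h Z) (evec h Y) \<partial>gauss_span h (realify xs)) =
       exp (cinner (cproj (set xs) X) Y / of_real (2 * h))"
proof -
  define l where "l Z = (cinner X Z + cinner Z Y) / of_real (2 * h)" for Z
  have l: "bounded_linear l" unfolding l_def by (rule bounded_linear_cinner_sum)
  have e: "cip (evec h X) (evec h Z) * cip (evec h Z) (evec h Y) = exp (l Z)" for Z
    unfolding cip_evec[OF h] l_def by (simp add: exp_add[symmetric] add_divide_distrib)
  show "integrable (gauss_span h (realify xs)) (\<lambda>Z. cip (evec h X) (evec h Z) * cip (evec h Z) (evec h Y))"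
    unfolding e by (rule gauss_span_integrable_exp[OF h l])
  have sq: "(l (e, 0))\<^sup>2 + (l (0, e))\<^sup>2 = cinner X (e, 0) * cinner (e, 0) Y / (of_real h)\<^sup>2" for e
  proof -
    have i: "(0, e) = cscale \<i> (e, 0)" by (simp add: cscale_def)
    have "l (0, e) = (- \<i> * cinner X (e, 0) + \<i> * cinner (e, 0) Y) / of_real (2 * h)"
      unfolding l_def i cinner_simps by simp
    then have "(l (e, 0))\<^sup>2 + (l (0, e))\<^sup>2 =
        ((cinner X (e, 0) + cinner (e, 0) Y)\<^sup>2 + (- \<i> * cinner X (e, 0) + \<i> * cinner (e, 0) Y)\<^sup>2) / (of_real (2 * h))\<^sup>2"
      unfolding l_def[of "(e, 0)"] by (simp only: power_divide add_divide_distrib[symmetric])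
    also have "(cinner X (e, 0) + cinner (e, 0) Y)\<^sup>2 + (- \<i> * cinner X (e, 0) + \<i> * cinner (e, 0) Y)\<^sup>2 =
        4 * (cinner X (e, 0) * cinner (e, 0) Y)"
      by (simp add: power2_eq_square algebra_simps)
    finally show ?thesis by (simp add: power2_eq_square)
  qed
  have s: "of_real (h / 2) * (\<Sum>f\<leftarrow>realify xs. (l f)\<^sup>2) = cinner (cproj (set xs) X) Y / of_real (2 * h)"
    unfolding sum_list_realify[OF xs] sq cinner_cproj sum_divide_distrib[symmetric]
    using h by (simp add: power2_eq_square)
  show "(\<integral>Z. cip (evec h X) (evec h Z) * cip (evec h Z) (evec h Y) \<partial>gauss_span h (realify xs)) =
       exp (cinner (cproj (set xs) X) Y / of_real (2 * h))"
    unfolding e gauss_span_integral_exp[OF h l] s ..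
qed

text \<open>For combinations \<open>x\<close> of coherent states the integral is \<open>\<langle>x', x\<rangle>\<close>, where \<open>x'\<close> arises from \<open>x\<close> by
  projecting the parameters of the coherent states. As \<open>\<langle>x', x\<rangle> = \<parallel>x'\<parallel>\<^sup>2\<close>, it is at most \<open>\<parallel>x\<parallel>\<^sup>2\<close>.\<close>

lemma gauss_bessel_combos:
  assumes h: "h > 0" and xs: "distinct xs" "orthonormal (set xs)" and x: "x \<in> evec_combos h"
  shows "(\<integral>\<^sup>+Z. ennreal ((cmod (cip x (evec h Z)))\<^sup>2) \<partial>gauss_span h (realify xs)) \<le> ennreal ((norm x)\<^sup>2)"
proof -
  obtain ts where ts: "x = (\<Sum>(c, X)\<leftarrow>ts. cmul c (evec h X))" using x by (auto simp: evec_combos_def)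
  define n where "n = length ts"
  define c where "c i = fst (ts ! i)" for i
  define X where "X i = snd (ts ! i)" for i
  have x: "x = (\<Sum>i<n. cmul (c i) (evec h (X i)))"
    unfolding ts sum_list_sum_nth n_def c_def X_def by (simp add: atLeast0LessThan case_prod_unfold)
  define x' where "x' = (\<Sum>i<n. cmul (c i) (evec h (cproj (set xs) (X i))))"
  have ip: "cip (\<Sum>i<n. cmul (c i) (evec h (A i))) (\<Sum>i<n. cmul (c i) (evec h (B i))) =
      (\<Sum>i<n. \<Sum>j<n. c i * (cnj (c j) * cip (evec h (A i)) (evec h (B j))))" for A B
  proof -
    interpret L: bounded_linear "\<lambda>x. cip x y" for y by (rule bounded_linear_cip_left)
    show ?thesis
      unfolding L.sum
      unfolding cip_sum_right
      unfolding cip_cmul_left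
      unfolding cip_cmul_right ..
  qed
  \<comment> \<open>Projecting one parameter or both gives the same inner product, as the projection
    is orthogonal.\<close>
  have x'x: "cip x' x = cip x' x'"
    unfolding x x'_def ip cip_evec[OF h] cinner_cproj_cproj[OF finite_set xs(2)] ..
  have "(norm x')\<^sup>2 = Re (cip x' x)" unfolding x'x by (simp add: cip_self)
  also have "\<dots> \<le> norm x' * norm x" by (rule order.trans[OF complex_Re_le_cmod norm_cip_le])
  finally have le: "norm x' * norm x' \<le> norm x' * norm x" by (simp add: power2_eq_square)
  have nx: "norm x' \<le> norm x"
  proof (cases "x' = 0")
    case False
    then have "norm x' > 0" by simp
    with le show ?thesis by (rule mult_left_le_imp_le)
  qed simp
  define f where "f Z = (\<Sum>i<n. \<Sum>j<n. c i * (cnj (c j) * (cip (evec h (X i)) (evec h Z) * cip (evec h Z) (evec h (X j)))))" for Z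
  have f: "f Z = of_real ((cmod (cip x (evec h Z)))\<^sup>2)" for Z
  proof -
    interpret L: bounded_linear "\<lambda>x. cip x y" for y by (rule bounded_linear_cip_left)
    have "cip x (evec h Z) = (\<Sum>i<n. c i * cip (evec h (X i)) (evec h Z))"
      unfolding x L.sum cip_cmul_left ..
    then have "of_real ((cmod (cip x (evec h Z)))\<^sup>2) = (\<Sum>i<n. c i * cip (evec h (X i)) (evec h Z)) * cnj (\<Sum>i<n. c i * cip (evec h (X i)) (evec h Z))"
      by (simp only: complex_norm_square)
    also have "\<dots> = f Z"
      unfolding f_def cnj_sum complex_cnj_mult sum_product cip_commute[of "evec h (X _)" "evec h Z", symmetric]
      by (simp add: cip_commute[of "evec h Z"] mult_ac)
    finally show ?thesis by simp
  qed
  have fi: "integrable (gauss_span h (realify xs)) f"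
    unfolding f_def by (intro Bochner_Integration.integrable_sum integrable_mult_right gauss_kernel h xs)
  have "integral\<^sup>L (gauss_span h (realify xs)) f =
      (\<Sum>i<n. \<Sum>j<n. c i * (cnj (c j) * exp (cinner (cproj (set xs) (X i)) (X j) / of_real (2 * h))))"
    unfolding f_def
    by (subst Bochner_Integration.integral_sum, intro Bochner_Integration.integrable_sum integrable_mult_right gauss_kernel h xs,
        subst Bochner_Integration.integral_sum, intro integrable_mult_right gauss_kernel h xs)
      (simp only: integral_mult_right_zero gauss_kernel(2)[OF h xs(1)])
  also have "\<dots> = cip x' x" unfolding x x'_def ip cip_evec[OF h] ..
  also have "\<dots> = of_real ((norm x')\<^sup>2)" unfolding x'x by (rule cip_self)
  finally have int: "integral\<^sup>L (gauss_span h (realify xs)) f = of_real ((norm x')\<^sup>2)" .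
  have gi: "integrable (gauss_span h (realify xs)) (\<lambda>Z. (cmod (cip x (evec h Z)))\<^sup>2)"
    using integrable_Re[OF fi] unfolding f by simp
  have "(\<integral>\<^sup>+Z. ennreal ((cmod (cip x (evec h Z)))\<^sup>2) \<partial>gauss_span h (realify xs)) =
      ennreal (\<integral>Z. (cmod (cip x (evec h Z)))\<^sup>2 \<partial>gauss_span h (realify xs))"
    by (rule nn_integral_eq_integral[OF gi]) simp
  also have "(\<integral>Z. (cmod (cip x (evec h Z)))\<^sup>2 \<partial>gauss_span h (realify xs)) = (norm x')\<^sup>2"
  proof -
    have "complex_of_real (\<integral>Z. (cmod (cip x (evec h Z)))\<^sup>2 \<partial>gauss_span h (realify xs)) = of_real ((norm x')\<^sup>2)"
      unfolding int[symmetric] f integral_complex_of_real ..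
    then show ?thesis unfolding of_real_eq_iff .
  qed
  also have "ennreal ((norm x')\<^sup>2) \<le> ennreal ((norm x)\<^sup>2)"
    by (intro ennreal_leI power_mono nx norm_ge_zero)
  finally show ?thesis .
qed

text \<open>Combinations of coherent vectors approximate \<open>x\<close>, the integrands converge
  for every Z, and Fatou's lemma preserves the inequality.\<close>

lemma gauss_bessel:
  assumes h: "h > 0" and xs: "distinct xs" "orthonormal (set xs)"
  shows "(\<integral>\<^sup>+Z. ennreal ((cmod (cip x (evec h Z)))\<^sup>2) \<partial>gauss_span h (realify xs)) \<le> ennreal ((norm x)\<^sup>2)"
proof -
  note [measurable] = cip_evec_measurable[OF h]
  obtain u where u: "\<And>n. u n \<in> evec_combos h" "u \<longlonglongrightarrow> x"
    using evec_combos_dense[OF h, of x] unfolding closure_sequential by blast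
  have lim: "(\<lambda>n. ennreal ((cmod (cip (u n) (evec h Z)))\<^sup>2)) \<longlonglongrightarrow> ennreal ((cmod (cip x (evec h Z)))\<^sup>2)" for Z
    by (intro tendsto_ennrealI tendsto_power tendsto_norm bounded_linear.tendsto[OF bounded_linear_cip_left u(2)])
  have "(\<integral>\<^sup>+Z. ennreal ((cmod (cip x (evec h Z)))\<^sup>2) \<partial>gauss_span h (realify xs)) =
      (\<integral>\<^sup>+Z. liminf (\<lambda>n. ennreal ((cmod (cip (u n) (evec h Z)))\<^sup>2)) \<partial>gauss_span h (realify xs))"
    by (rule nn_integral_cong) (rule lim_imp_Liminf[OF sequentially_bot lim, symmetric])
  also have "\<dots> \<le> liminf (\<lambda>n. \<integral>\<^sup>+Z. ennreal ((cmod (cip (u n) (evec h Z)))\<^sup>2) \<partial>gauss_span h (realify xs))"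
    by (rule nn_integral_liminf) measurable
  also have "\<dots> \<le> liminf (\<lambda>n. ennreal ((norm (u n))\<^sup>2))"
    by (rule Liminf_mono) (intro always_eventually allI gauss_bessel_combos h xs u)
  also have "\<dots> = ennreal ((norm x)\<^sup>2)"
    by (rule lim_imp_Liminf[OF sequentially_bot]) (intro tendsto_ennrealI tendsto_power tendsto_norm u)
  finally show ?thesis .
qed

text \<open>The weak integral of \<open>G\<close> times the rank one operators along coherent
  vectors. The vectors are unnormalized because their squared norm is the inverse of the exponential
  factor in the Gaussian density.\<close>

definition antiwick_form ::
  "real \<Rightarrow> 'a::{real_inner, second_countable_topology} list \<Rightarrow> ('a \<times> 'a \<Rightarrow> complex) \<Rightarrow> 'a fk \<Rightarrow> 'a fk \<Rightarrow> complex" where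
  "antiwick_form h xs G x y =
     (\<integral>Z. G Z * (cip x (evec h Z) * cnj (cip y (evec h Z))) \<partial>gauss_span h (realify xs))"

text \<open>By Bessel's inequality the function \<open>Z \<mapsto> cip x (evec h Z)\<close> has L2
  norm at most \<open>norm x\<close>. Cauchy-Schwarz for the integral then leaves only the bound
  \<open>M\<close> on the symbol.\<close>

lemma antiwick_form_sesquilinear:
  fixes G :: "'a::{real_inner, second_countable_topology} \<times> 'a \<Rightarrow> complex"
  assumes h: "h > 0" and xs: "distinct xs" "orthonormal (set xs)"
    and G: "G \<in> borel_measurable borel" and M: "\<And>Z. cmod (G Z) \<le> M"
  shows "sesquilinear_bounded M (antiwick_form h xs G)"
proof -
  note [measurable] = cip_evec_measurable[OF h] G
  define \<mu> where "\<mu> = gauss_span h (realify xs)"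
  have [measurable_cong, simp]: "sets \<mu> = sets borel" by (simp add: \<mu>_def)
  have M0: "M \<ge> 0" by (rule order.trans[OF norm_ge_zero M])
  define a where "a x Z = cmod (cip x (evec h Z))" for x :: "'a fk" and Z
  have [measurable]: "a x \<in> borel_measurable borel" for x unfolding a_def by measurable
  have bessel: "(\<integral>\<^sup>+Z. ennreal ((a x Z)\<^sup>2) \<partial>\<mu>) \<le> ennreal ((norm x)\<^sup>2)" for x
    unfolding a_def \<mu>_def by (rule gauss_bessel[OF h xs])
  have sqi: "integrable \<mu> (\<lambda>Z. (a x Z)\<^sup>2)" for x
    by (rule integrableI_bounded) (use le_less_trans[OF bessel ennreal_less_top, of x] in auto)
  have abi: "integrable \<mu> (\<lambda>Z. a x Z * a y Z)" for x y
  proof (rule Bochner_Integration.integrable_bound[where f = "\<lambda>Z. (a x Z)\<^sup>2 + (a y Z)\<^sup>2"])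
    show "integrable \<mu> (\<lambda>Z. (a x Z)\<^sup>2 + (a y Z)\<^sup>2)" by (intro Bochner_Integration.integrable_add sqi)
    show "AE Z in \<mu>. norm (a x Z * a y Z) \<le> norm ((a x Z)\<^sup>2 + (a y Z)\<^sup>2)"
    proof (intro always_eventually allI)
      fix Z
      have "a x Z \<ge> 0" "a y Z \<ge> 0" by (simp_all add: a_def)
      then have "0 \<le> a x Z * a y Z" by simp
      moreover have "2 * (a x Z * a y Z) \<le> (a x Z)\<^sup>2 + (a y Z)\<^sup>2"
        using sum_squares_bound[of "a x Z" "a y Z"] by (simp add: mult.assoc)
      ultimately show "norm (a x Z * a y Z) \<le> norm ((a x Z)\<^sup>2 + (a y Z)\<^sup>2)" by simp
    qed
  qed measurable
  have CS: "(\<integral>Z. a x Z * a y Z \<partial>\<mu>) \<le> norm x * norm y" for x y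
  proof -
    have nn: "a x Z \<ge> 0" for x Z by (simp add: a_def)
    have I0: "(\<integral>Z. a x Z * a y Z \<partial>\<mu>) \<ge> 0" by (intro integral_nonneg_AE always_eventually allI mult_nonneg_nonneg nn)
    have "ennreal ((\<integral>Z. a x Z * a y Z \<partial>\<mu>)\<^sup>2) = (ennreal (\<integral>Z. a x Z * a y Z \<partial>\<mu>))\<^sup>2"
      using I0 by (simp add: ennreal_power)
    also have "ennreal (\<integral>Z. a x Z * a y Z \<partial>\<mu>) = (\<integral>\<^sup>+Z. ennreal (a x Z) * ennreal (a y Z) \<partial>\<mu>)"
      by (subst nn_integral_eq_integral[symmetric, OF abi]) (auto simp: nn ennreal_mult')
    also have "(\<integral>\<^sup>+Z. ennreal (a x Z) * ennreal (a y Z) \<partial>\<mu>)\<^sup>2 \<le>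
        (\<integral>\<^sup>+Z. (ennreal (a x Z))\<^sup>2 \<partial>\<mu>) * (\<integral>\<^sup>+Z. (ennreal (a y Z))\<^sup>2 \<partial>\<mu>)"
      by (rule Cauchy_Schwarz_nn_integral) measurable
    also have "\<dots> = (\<integral>\<^sup>+Z. ennreal ((a x Z)\<^sup>2) \<partial>\<mu>) * (\<integral>\<^sup>+Z. ennreal ((a y Z)\<^sup>2) \<partial>\<mu>)"
      by (simp only: ennreal_power nn)
    also have "\<dots> \<le> ennreal ((norm x)\<^sup>2) * ennreal ((norm y)\<^sup>2)"
      by (intro mult_mono bessel) auto
    also have "\<dots> = ennreal ((norm x * norm y)\<^sup>2)" by (simp add: ennreal_mult'[symmetric] power_mult_distrib)
    finally have "(\<integral>Z. a x Z * a y Z \<partial>\<mu>)\<^sup>2 \<le> (norm x * norm y)\<^sup>2" by (subst (asm) ennreal_le_iff) simp_all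
    then show ?thesis by (rule power2_le_imp_le) simp
  qed
  have bnd: "cmod (G Z * (cip x (evec h Z) * cnj (cip y (evec h Z)))) \<le> M * (a x Z * a y Z)" for x y Z
    unfolding norm_mult complex_mod_cnj a_def by (intro mult_right_mono M) simp
  have int: "integrable \<mu> (\<lambda>Z. G Z * (cip x (evec h Z) * cnj (cip y (evec h Z))))" for x y
  proof (rule Bochner_Integration.integrable_bound[where f = "\<lambda>Z. M * (a x Z * a y Z)"])
    show "integrable \<mu> (\<lambda>Z. M * (a x Z * a y Z))" by (intro integrable_mult_right abi)
    show "AE Z in \<mu>. norm (G Z * (cip x (evec h Z) * cnj (cip y (evec h Z)))) \<le> norm (M * (a x Z * a y Z))"
      by (intro always_eventually allI order.trans[OF bnd]) simp
  qed measurable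
  have norm: "cmod (antiwick_form h xs G x y) \<le> M * norm x * norm y" for x y
  proof -
    have "cmod (antiwick_form h xs G x y) \<le> (\<integral>Z. cmod (G Z * (cip x (evec h Z) * cnj (cip y (evec h Z)))) \<partial>\<mu>)"
      unfolding antiwick_form_def \<mu>_def[symmetric] by (rule integral_norm_bound)
    also have "\<dots> \<le> (\<integral>Z. M * (a x Z * a y Z) \<partial>\<mu>)"
      by (rule integral_mono[OF integrable_norm[OF int]]) (intro integrable_mult_right abi, rule bnd)
    also have "\<dots> \<le> M * (norm x * norm y)"
      unfolding integral_mult_right_zero by (intro mult_left_mono CS M0)
    finally show ?thesis by (simp only: mult.assoc)
  qed
  show ?thesis
    unfolding sesquilinear_bounded_def
  proof (intro conjI allI norm)
    fix x y z :: "'a fk" and c :: complex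
    show "antiwick_form h xs G (x + y) z = antiwick_form h xs G x z + antiwick_form h xs G y z"
      unfolding antiwick_form_def \<mu>_def[symmetric] Bochner_Integration.integral_add[OF int int, symmetric]
      by (simp only: cip_add_left distrib_left distrib_right)
    show "antiwick_form h xs G z (x + y) = antiwick_form h xs G z x + antiwick_form h xs G z y"
      unfolding antiwick_form_def \<mu>_def[symmetric] Bochner_Integration.integral_add[OF int int, symmetric]
      by (simp only: cip_add_left complex_cnj_add distrib_left distrib_right)
    show "antiwick_form h xs G (cmul c x) z = c * antiwick_form h xs G x z"
      unfolding antiwick_form_def integral_mult_right_zero[symmetric] by (simp only: cip_cmul_left mult_ac)
    show "antiwick_form h xs G z (cmul c x) = cnj c * antiwick_form h xs G z x"
      unfolding antiwick_form_def integral_mult_right_zero[symmetric]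
      by (simp only: cip_cmul_left complex_cnj_mult mult_ac)
  qed
qed

lemma antiwick_form_diagonal:
  assumes h: "h > 0"
  shows "antiwick_form h xs G (evec h X) (evec h X) = (\<integral>Z. of_real (exp (X \<bullet> Z / h)) * G Z \<partial>gauss_span h (realify xs))"
proof -
  have "cip (evec h X) (evec h Z) * cnj (cip (evec h X) (evec h Z)) = of_real (exp (X \<bullet> Z / h))" for Z
  proof -
    have "Re (cinner X Z / of_real (2 * h)) = X \<bullet> Z / (2 * h)" using h by (simp add: Re_cinner Re_divide_of_real)
    then have "(cmod (cip (evec h X) (evec h Z)))\<^sup>2 = exp (X \<bullet> Z / (2 * h)) ^ 2"
      unfolding cip_evec[OF h] norm_exp_eq_Re by simp
    also have "\<dots> = exp (X \<bullet> Z / h)" using h by (simp add: exp_double[symmetric])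
    finally show ?thesis by (simp only: complex_norm_square[symmetric])
  qed
  then show ?thesis unfolding antiwick_form_def by (simp only: mult.commute)
qed

section \<open>Existence of a form with prescribed diagonal\<close>

text \<open>Forms with bound \<open>M\<close> are points of a product of closed discs, compact by
  Tychonoff. Along a finer filter all values converge, so the algebraic identities and the bound
  pass to the limit; the diagonal already converges along the given filter, which fixes its
  value.\<close>

lemma sesquilinear_form_cluster:
  fixes f :: "'i \<Rightarrow> 'a::{real_inner, second_countable_topology} fk \<Rightarrow> 'a fk \<Rightarrow> complex"
  assumes F: "\<FF> \<noteq> bot" and sesq: "\<forall>\<^sub>F i in \<FF>. sesquilinear_bounded M (f i)"
    and lim: "\<And>X. ((\<lambda>i. f i (evec h X) (evec h X)) \<longlongrightarrow> d X) \<FF>"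
  shows "\<exists>b. sesquilinear_bounded M b \<and> (\<forall>X. b (evec h X) (evec h X) = d X)"
proof -
  define g where "g i = (\<lambda>(x, y). f i x y)" for i
  define K where "K = PiE UNIV (\<lambda>(x :: 'a fk, y :: 'a fk). cball (0 :: complex) (M * norm x * norm y))"
  have "compactin (product_topology (\<lambda>_. euclidean) UNIV) K"
    unfolding K_def compactin_PiE by (auto simp: compact_cball)
  then have K: "compact K"
    unfolding euclidean_product_topology by simp
  have gK: "\<forall>\<^sub>F u in filtermap g \<FF>. u \<in> K"
    unfolding eventually_filtermap
  proof (rule eventually_mono[OF sesq])
    fix i assume "sesquilinear_bounded M (f i)"
    then show "g i \<in> K"
      unfolding K_def g_def by (auto simp: PiE_iff sesquilinear_boundedD(5))
  qed
  have "filtermap g \<FF> \<noteq> bot" using F by (simp add: filtermap_bot_iff)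
  with K gK obtain u where u: "inf (nhds u) (filtermap g \<FF>) \<noteq> bot"
    unfolding compact_filter by blast
  \<comment> \<open>The indices in \<open>\<FF>\<close> whose forms are close to the cluster point
    \<open>u\<close>. This filter is proper because \<open>u\<close> is a cluster point, and all
    values of the forms converge along it.\<close>
  define \<UU> where "\<UU> = inf (filtercomap g (nhds u)) \<FF>"
  have U: "\<UU> \<noteq> bot"
  proof
    assume "\<UU> = bot"
    then have "\<forall>\<^sub>F i in \<UU>. False" by simp
    then obtain Q R where Q: "eventually Q (filtercomap g (nhds u))" and R: "eventually R \<FF>"
      and QR: "\<And>i. Q i \<Longrightarrow> R i \<Longrightarrow> False"
      unfolding \<UU>_def eventually_inf by blast
    obtain Q' where Q': "eventually Q' (nhds u)" "\<And>i. Q' (g i) \<Longrightarrow> Q i"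
      using Q unfolding eventually_filtercomap by blast
    have "eventually (\<lambda>v. \<not> Q' v) (filtermap g \<FF>)"
      unfolding eventually_filtermap by (rule eventually_mono[OF R]) (use Q'(2) QR in blast)
    with Q'(1) have "\<forall>\<^sub>F v in inf (nhds u) (filtermap g \<FF>). False"
      unfolding eventually_inf by blast
    with u show False by (simp add: trivial_limit_def)
  qed
  have le: "\<UU> \<le> \<FF>" by (simp add: \<UU>_def)
  have "filterlim g (nhds u) \<UU>"
    unfolding \<UU>_def by (rule filterlim_mono[OF filterlim_filtercomap order_refl inf_le1])
  then have T: "((\<lambda>i. g i p) \<longlongrightarrow> u p) \<UU>" for p
    by (rule continuous_on_tendsto_compose[OF continuous_on_product_coordinates]) auto
  have L: "((\<lambda>i. f i x y) \<longlongrightarrow> u (x, y)) \<UU>" for x y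
    using T[of "(x, y)"] by (simp add: g_def)
  define b where "b x y = u (x, y)" for x y
  have ev: "\<forall>\<^sub>F i in \<UU>. sesquilinear_bounded M (f i)" by (rule filter_leD[OF le sesq])
  have eq: "v = w" if "((\<lambda>i. p i) \<longlongrightarrow> v) \<UU>" "((\<lambda>i. q i) \<longlongrightarrow> w) \<UU>" "\<And>i. sesquilinear_bounded M (f i) \<Longrightarrow> p i = q i"
    for p q :: "'i \<Rightarrow> complex" and v w
  proof (rule tendsto_unique[OF U that(1)])
    show "(p \<longlongrightarrow> w) \<UU>"
      by (rule Lim_transform_eventually[OF that(2)]) (rule eventually_mono[OF ev], simp add: that(3))
  qed
  have "sesquilinear_bounded M b"
    unfolding sesquilinear_bounded_def
  proof (intro conjI allI)
    show "b (x + y) z = b x z + b y z" for x y z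
      by (rule eq[OF L[of "x + y" z, folded b_def] tendsto_add[OF L[of x z, folded b_def] L[of y z, folded b_def]]])
        (rule sesquilinear_boundedD(1))
    show "b z (x + y) = b z x + b z y" for x y z
      by (rule eq[OF L[of z "x + y", folded b_def] tendsto_add[OF L[of z x, folded b_def] L[of z y, folded b_def]]])
        (rule sesquilinear_boundedD(3))
    show "b (cmul c x) z = c * b x z" for c x z
      by (rule eq[OF L[of "cmul c x" z, folded b_def] tendsto_mult[OF tendsto_const L[of x z, folded b_def]]])
        (rule sesquilinear_boundedD(2))
    show "b z (cmul c x) = cnj c * b z x" for c x z
      by (rule eq[OF L[of z "cmul c x", folded b_def] tendsto_mult[OF tendsto_const L[of z x, folded b_def]]])
        (rule sesquilinear_boundedD(4))
    show "cmod (b x y) \<le> M * norm x * norm y" for x y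
      unfolding b_def
      by (rule tendsto_upperbound[OF tendsto_norm[OF L[of x y]] _ U])
        (rule eventually_mono[OF ev], rule sesquilinear_boundedD(5))
  qed
  moreover have "b (evec h X) (evec h X) = d X" for X
    unfolding b_def by (rule tendsto_unique[OF U L tendsto_mono[OF le lim]])
  ultimately show ?thesis by blast
qed

lemma realify_trace_le:
  fixes A :: "'a::{real_inner, second_countable_topology} \<times> 'a \<Rightarrow> 'a \<times> 'a"
  assumes A: "selfadjoint_op A" "nonneg_op A" "trace_class A"
    and xs: "distinct xs" "orthonormal (set xs)"
  shows "(\<Sum>f\<leftarrow>realify xs. A f \<bullet> f) \<le> trace_op A"
proof -
  define S where "S = set xs"
  define F where "F = (\<lambda>e. (e, 0 :: 'a)) ` S \<union> (\<lambda>e. (0 :: 'a, e)) ` S"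
  \<comment> \<open>Unit vectors are nonzero, so the two families \<open>(e, 0)\<close> and
    \<open>(0, e)\<close> are disjoint.\<close>
  have n0: "e \<noteq> 0" if "e \<in> S" for e using that xs(2) by (auto simp: orthonormal_def S_def)
  have "(\<Sum>f\<leftarrow>realify xs. A f \<bullet> f) = (\<Sum>e\<in>S. A (e, 0) \<bullet> (e, 0)) + (\<Sum>e\<in>S. A (0, e) \<bullet> (0, e))"
    unfolding sum_list_realify[OF xs(1)] S_def sum.distrib ..
  also have "\<dots> = (\<Sum>f\<in>(\<lambda>e. (e, 0)) ` S. A f \<bullet> f) + (\<Sum>f\<in>(\<lambda>e. (0, e)) ` S. A f \<bullet> f)"
    by (subst (1 2) sum.reindex) (auto simp: inj_on_def)
  also have "\<dots> = (\<Sum>f\<in>F. A f \<bullet> f)"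
    unfolding F_def by (rule sum.union_disjoint[symmetric]) (use n0 in \<open>auto simp: S_def\<close>)
  also have "\<dots> \<le> (\<Sum>\<^sub>\<infinity>e\<in>some_basis. A e \<bullet> e)"
  proof (rule trace_orthonormal_le[OF hilbert_basis_some A(1,2) trace_class_summable[OF A]])
    show "finite F" by (simp add: F_def S_def)
    show "orthonormal F"
      unfolding orthonormal_def
    proof
      show "\<forall>e\<in>F. norm e = 1"
        using xs(2) by (auto simp: F_def S_def orthonormal_def norm_prod_def)
      show "pairwise orthogonal F"
      proof (rule pairwiseI)
        fix a b assume "a \<in> F" "b \<in> F" "a \<noteq> b"
        moreover have "x \<bullet> y = 0" if "x \<in> S" "y \<in> S" "x \<noteq> y" for x y
          using orthonormal_inner[OF xs(2)] that by (simp add: S_def)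
        ultimately show "orthogonal a b"
          unfolding F_def by (auto simp: inner_prod_def orthogonal_def; blast)
      qed
    qed
  qed
  finally show ?thesis by (simp add: trace_op_def)
qed

lemma wick_form_exists:
  fixes A :: "'a::{real_inner, second_countable_topology} \<times> 'a \<Rightarrow> 'a \<times> 'a"
  assumes h: "h > 0" and A: "selfadjoint_op A" "nonneg_op A" "trace_class A"
    and F: "smooth F" "S_bound (\<lambda>X. A X \<bullet> X) F C"
  shows "\<exists>b. sesquilinear_bounded (exp ((h / 2) * trace_op A) * C) b \<and>
    (\<forall>X. b (evec h X) (evec h X) = of_real (exp ((norm X)\<^sup>2 / (2 * h))) * F X)"
proof -
  define q where "q V = sqrt (A V \<bullet> V)" for V
  define \<FF> where "\<FF> = finite_subsets_at_top (some_basis :: 'a set)"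
  define L where "L S = (SOME xs. distinct xs \<and> set xs = S)" for S :: "'a set"
  have L: "distinct (L S)" "set (L S) = S" if "finite S" for S
    using someI_ex[of "\<lambda>xs. distinct xs \<and> set xs = S"] finite_distinct_list[OF that] unfolding L_def by blast+
  have nn: "A V \<bullet> V \<ge> 0" for V using A(2) unfolding nonneg_op_def by blast
  have q0: "q V \<ge> 0" for V unfolding q_def by (rule real_sqrt_ge_zero[OF nn])
  have diff: "nderiv F Vs differentiable (at X)" for Vs X
    using F(1) unfolding smooth_def by blast
  have bd: "cmod (nderiv F Vs X) \<le> C * prod_list (map q Vs)" for Vs X
    using F(2) unfolding S_bound_def q_def by blast
  note ctx = q0 diff bd h
  have on: "orthonormal S" if "S \<subseteq> some_basis" for S :: "'a set"
    using hilbert_basis_orthonormal[OF hilbert_basis_some] that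
    unfolding orthonormal_def by (auto intro: pairwise_subset)
  define f where "f S = antiwick_form h (L S) (heat_inv h F (realify (L S)) [])" for S
  have sesq: "\<forall>\<^sub>F S in \<FF>. sesquilinear_bounded (exp ((h / 2) * trace_op A) * C) (f S)"
    unfolding \<FF>_def
  proof (rule eventually_finite_subsets_at_top_weakI)
    fix S :: "'a set" assume S: "finite S" "S \<subseteq> some_basis"
    show "sesquilinear_bounded (exp ((h / 2) * trace_op A) * C) (f S)"
      unfolding f_def
    proof (rule antiwick_form_sesquilinear[OF h L(1)[OF S(1)] _ heat_inv_measurable[OF ctx]])
      show "orthonormal (set (L S))" using on[OF S(2)] L(2)[OF S(1)] by simp
      then have tr: "(\<Sum>e\<leftarrow>realify (L S). A e \<bullet> e) \<le> trace_op A"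
        by (rule realify_trace_le[OF A L(1)[OF S(1)]])
      have "(q e)\<^sup>2 = A e \<bullet> e" for e unfolding q_def by (rule real_sqrt_pow2[OF nn])
      then have "heat_const q h (realify (L S)) \<le> exp ((h / 2) * trace_op A)"
        unfolding heat_const_def[OF ctx] using tr h by simp
      then have "C * heat_const q h (realify (L S)) \<le> C * exp ((h / 2) * trace_op A)"
        by (rule mult_left_mono) (rule C_nonneg[OF ctx])
      with heat_inv_bound[OF ctx, of "realify (L S)" "[]"]
      show "cmod (heat_inv h F (realify (L S)) [] Z) \<le> exp ((h / 2) * trace_op A) * C" for Z
        by (metis (no_types, lifting) list.map(1) mult.commute mult.right_neutral order.trans prod_list.Nil)
    qed
  qed
  \<comment> \<open>For a finite \<open>S\<close> the diagonal value is
    \<open>exp (s S / (2 h)) F (cproj S X)\<close>, correct only on the complex span of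
    \<open>S\<close>. Parseval's identity, the basis expansion and the continuity of
    \<open>F\<close> give the limit.\<close>
  have lim: "((\<lambda>S. f S (evec h X) (evec h X)) \<longlongrightarrow> of_real (exp ((norm X)\<^sup>2 / (2 * h))) * F X) \<FF>" for X
  proof -
    define s where "s S = (\<Sum>e\<in>S. (cmod (cinner X (e, 0)))\<^sup>2)" for S
    have "((\<lambda>S. of_real (exp (s S / (2 * h))) * F (cproj S X)) \<longlongrightarrow> of_real (exp ((norm X)\<^sup>2 / (2 * h))) * F X) \<FF>"
    proof (intro tendsto_mult tendsto_of_real tendsto_exp tendsto_divide tendsto_const)
      show "(s \<longlongrightarrow> (norm X)\<^sup>2) \<FF>"
        using cinner_parseval[of X] unfolding has_sum_def \<FF>_def s_def[abs_def] .
      have c: "((\<lambda>S. cproj S X) \<longlongrightarrow> X) \<FF>"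
        using cinner_expansion[of X] unfolding has_sum_def \<FF>_def cproj_def .
      have "isCont F X"
        using diff[of "[]" X] by (simp add: differentiable_imp_continuous_within)
      then show "((\<lambda>S. F (cproj S X)) \<longlongrightarrow> F X) \<FF>" using c by (rule isCont_tendsto_compose)
    qed (use h in simp)
    then show ?thesis
    proof (rule Lim_transform_eventually)
      show "\<forall>\<^sub>F S in \<FF>. of_real (exp (s S / (2 * h))) * F (cproj S X) = f S (evec h X) (evec h X)"
        unfolding \<FF>_def
      proof (rule eventually_finite_subsets_at_top_weakI)
        fix S :: "'a set" assume S: "finite S" "S \<subseteq> some_basis"
        have "(\<Sum>e\<leftarrow>realify (L S). (X \<bullet> e)\<^sup>2) = s S"
          unfolding sum_list_realify[OF L(1)[OF S(1)]] L(2)[OF S(1)] s_def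
          by (rule sum.cong) (simp_all add: cmod_power2 cinner_def inner_prod_def)
        moreover have "(\<Sum>e\<leftarrow>realify (L S). (X \<bullet> e) *\<^sub>R e) = cproj S X"
          unfolding sum_list_realify[OF L(1)[OF S(1)]] L(2)[OF S(1)] cproj_def
          by (rule sum.cong) (simp_all add: cscale_def cinner_def inner_prod_def)
        ultimately show "of_real (exp (s S / (2 * h))) * F (cproj S X) = f S (evec h X) (evec h X)"
          unfolding f_def antiwick_form_diagonal[OF h] heat_inv_gauss_span_exp[OF ctx] by simp
      qed
    qed
  qed
  show ?thesis
    by (rule sesquilinear_form_cluster[OF _ sesq lim]) (simp add: \<FF>_def)
qed

section \<open>Bounded Wick operators\<close>

lemma fv_Fk: "\<Psi> \<in> fock \<Longrightarrow> fv (Fk \<Psi>) = \<Psi>"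
  by (rule Fk_inverse)

lemma coherent_fk:
  assumes h: "h > 0"
  shows "coherent h X = fv (cmul (of_real (exp (- (norm X)\<^sup>2 / (4 * h)))) (evec h X))"
  unfolding coherent_eq[OF h] fv_cmul fv_evec[OF h] ..

lemma coherent_fock: "h > 0 \<Longrightarrow> coherent h X \<in> (fock :: 'a::{real_inner, second_countable_topology} fvec set)"
  by (simp add: coherent_fk)

lemma bounded_operator_induced:
  fixes B :: "'a::{real_inner, second_countable_topology} fvec \<Rightarrow> 'a fvec"
  assumes B: "bounded_operator B"
  obtains T K where "K \<ge> 0" "\<And>x. fv (T x) = B (fv x)" "sesquilinear_bounded K (\<lambda>x y. cip (T x) y)"
proof -
  have lin: "linear_operator_on fock B" using B by (simp add: bounded_operator_def)
  obtain C where C: "\<And>\<Psi>. \<Psi> \<in> fock \<Longrightarrow> fock_norm (B \<Psi>) \<le> C * fock_norm \<Psi>"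
    using B unfolding bounded_operator_def by blast
  have Bf: "B \<Psi> \<in> fock" if "\<Psi> \<in> fock" for \<Psi> using lin that unfolding linear_operator_on_def by blast
  have Bl: "B (\<lambda>w. c * \<Phi> w + \<Psi> w) = (\<lambda>w. c * B \<Phi> w + B \<Psi> w)" if "\<Phi> \<in> fock" "\<Psi> \<in> fock" for c \<Phi> \<Psi>
    using lin that unfolding linear_operator_on_def by blast
  define T where "T x = Fk (B (fv x))" for x
  have T: "fv (T x) = B (fv x)" for x unfolding T_def by (rule fv_Fk) (simp add: Bf)
  have nT: "norm (T x) \<le> \<bar>C\<bar> * norm x" for x
  proof -
    have "norm (T x) \<le> C * norm x" using C[OF fv_fock, of x] by (simp add: T flip: fock_norm_fv)
    also have "\<dots> \<le> \<bar>C\<bar> * norm x" by (intro mult_right_mono) auto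
    finally show ?thesis .
  qed
  have Tl: "T (cmul c x + y) = cmul c (T x) + T y" for c x y
    using Bl[OF fv_fock fv_fock, of c x y] by (simp add: fv_inject[symmetric] T fv_plus fv_cmul)
  have T0: "T 0 = 0" using Tl[of 1 0 0] by (simp add: cmul_one)
  have "cmul c x + 0 = cmul c x" for c and x :: "'a fk" by simp
  then have Tc: "T (cmul c x) = cmul c (T x)" for c x using Tl[of c x 0] T0 by simp
  have Ta: "T (x + y) = T x + T y" for x y using Tl[of 1 x y] by (simp add: cmul_one)
  have "sesquilinear_bounded \<bar>C\<bar> (\<lambda>x y. cip (T x) y)"
    unfolding sesquilinear_bounded_def Tc Ta
  proof (intro conjI allI)
    show "cmod (cip (T x) y) \<le> \<bar>C\<bar> * norm x * norm y" for x y
      by (rule order.trans[OF norm_cip_le]) (intro mult_right_mono nT norm_ge_zero)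
  qed (simp_all add: cip_add_left cip_add_right cip_cmul_left cip_cmul_right)
  then show thesis using that[of "\<bar>C\<bar>" T] T by simp
qed

lemma wick_symbol_fk:
  assumes h: "h > 0" and T: "\<And>x. fv (T x) = B (fv x)" and S: "sesquilinear_bounded K (\<lambda>x y. cip (T x) y)"
  shows "wick_symbol h B X = of_real (exp (- (norm X)\<^sup>2 / (2 * h))) * cip (T (evec h X)) (evec h X)"
proof -
  define e where "e = exp (- (norm X)\<^sup>2 / (4 * h))"
  have "wick_symbol h B X = cip (T (cmul (of_real e) (evec h X))) (cmul (of_real e) (evec h X))"
    unfolding wick_symbol_def coherent_fk[OF h] cip_def T e_def ..
  also have "\<dots> = of_real e * (of_real e * cip (T (evec h X)) (evec h X))"
    by (simp add: sesquilinear_boundedD(2,4)[OF S])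
  also have "\<dots> = of_real (e * e) * cip (T (evec h X)) (evec h X)" by simp
  also have "e * e = exp (- (norm X)\<^sup>2 / (2 * h))"
    unfolding e_def mult_exp_exp using h by (simp add: field_simps)
  finally show ?thesis .
qed

text \<open>The Gaussian normalization of coherent states is a nonzero scalar, so equal symbols mean
  that the difference of the two forms vanishes on the diagonal of the unnormalized vectors. Both
  operators are extensional, so agreement on \<open>fock\<close> makes them equal.\<close>

lemma bounded_operator_wick_unique:
  fixes B B' :: "'a::{real_inner, second_countable_topology} fvec \<Rightarrow> 'a fvec"
  assumes h: "h > 0" and B: "bounded_operator B" "bounded_operator B'"
    and eq: "wick_symbol h B = wick_symbol h B'"
  shows "B = B'"
proof -
  obtain T K where T: "K \<ge> 0" "\<And>x. fv (T x) = B (fv x)" "sesquilinear_bounded K (\<lambda>x y. cip (T x) y)"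
    by (rule bounded_operator_induced[OF B(1)]) (rule that)
  obtain T' K' where T': "K' \<ge> 0" "\<And>x. fv (T' x) = B' (fv x)" "sesquilinear_bounded K' (\<lambda>x y. cip (T' x) y)"
    by (rule bounded_operator_induced[OF B(2)]) (rule that)
  have "sesquilinear_bounded (K + K') (\<lambda>x y. cip (T x) y - cip (T' x) y)"
    unfolding sesquilinear_bounded_def
  proof (intro conjI allI)
    show "cmod (cip (T x) y - cip (T' x) y) \<le> (K + K') * norm x * norm y" for x y
      using norm_triangle_ineq4[of "cip (T x) y" "cip (T' x) y"] sesquilinear_boundedD(5)[OF T(3), of x y]
        sesquilinear_boundedD(5)[OF T'(3), of x y] by (simp add: distrib_right)
  qed (simp_all only: sesquilinear_boundedD(1-4)[OF T(3)] sesquilinear_boundedD(1-4)[OF T'(3)] right_diff_distrib add_diff_add)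
  moreover have "cip (T (evec h X)) (evec h X) - cip (T' (evec h X)) (evec h X) = 0" for X
  proof -
    define e where "e = complex_of_real (exp (- (norm X)\<^sup>2 / (2 * h)))"
    have "e \<noteq> 0" by (simp add: e_def)
    moreover have "e * cip (T (evec h X)) (evec h X) = e * cip (T' (evec h X)) (evec h X)"
      using wick_symbol_fk[where T = T and B = B and X = X, OF h T(2,3)]
        wick_symbol_fk[where T = T' and B = B' and X = X, OF h T'(2,3)] fun_cong[OF eq, of X]
      by (simp only: e_def)
    ultimately show ?thesis by simp
  qed
  ultimately have z: "cip (T x) y - cip (T' x) y = 0" for x y
    by (rule form_determined_by_diagonal[where b = "\<lambda>x y. cip (T x) y - cip (T' x) y", OF _ add_nonneg_nonneg[OF T(1) T'(1)] h])
  have TT: "T x = T' x" for x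
  proof (rule cip_extensionality)
    show "cip z (T x) = cip z (T' x)" for z
      using z[of x z] by (simp add: cip_commute[of z])
  qed
  have "B \<Psi> = B' \<Psi>" if "\<Psi> \<in> fock" for \<Psi>
    using T(2)[of "Fk \<Psi>"] T'(2)[of "Fk \<Psi>"] TT[of "Fk \<Psi>"] fv_Fk[OF that] by simp
  then show ?thesis
    using B by (intro extensionalityI[of _ fock]) (auto simp: bounded_operator_def)
qed

lemma form_operator:
  fixes b :: "'a::{real_inner, second_countable_topology} fk \<Rightarrow> 'a fk \<Rightarrow> complex"
  assumes h: "h > 0" and S: "sesquilinear_bounded K b" and K: "K \<ge> 0"
  shows "\<exists>B. bounded_operator B \<and> operator_norm B \<le> K \<and>
    (\<forall>X. wick_symbol h B X = of_real (exp (- (norm X)\<^sup>2 / (2 * h))) * b (evec h X) (evec h X))"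
proof -
  have "\<exists>T. \<forall>x z. cip (T x) z = b x z"
    using form_representation[OF S K] by (intro choice) blast
  then obtain T where T: "\<And>x z. cip (T x) z = b x z" by blast
  have S': "sesquilinear_bounded K (\<lambda>x y. cip (T x) y)" unfolding T by (rule S)
  have Tl: "T (cmul c x + y) = cmul c (T x) + T y" for c x y
  proof (rule cip_extensionality)
    fix z
    have "cip (T (cmul c x + y)) z = cip (cmul c (T x) + T y) z"
      by (simp add: T cip_add_left cip_cmul_left sesquilinear_boundedD[OF S])
    then show "cip z (T (cmul c x + y)) = cip z (cmul c (T x) + T y)"
      using cip_commute[of z "T (cmul c x + y)"] cip_commute[of z "cmul c (T x) + T y"] by simp
  qed
  have nT: "norm (T x) \<le> K * norm x" for x
  proof -
    have "norm (T x) * norm (T x) = cmod (cip (T x) (T x))"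
      by (simp add: cip_self norm_power power2_eq_square norm_mult)
    also have "\<dots> \<le> K * norm x * norm (T x)" by (rule sesquilinear_boundedD(5)[OF S'])
    finally have le: "norm (T x) * norm (T x) \<le> K * norm x * norm (T x)" .
    show ?thesis
    proof (cases "T x = 0")
      case False
      then have "norm (T x) > 0" by simp
      with le show ?thesis by (rule mult_right_le_imp_le)
    qed (simp add: K)
  qed
  define B where "B = restrict (\<lambda>\<Psi>. fv (T (Fk \<Psi>))) fock"
  have BT: "fv (T x) = B (fv x)" for x by (simp add: B_def fv_inverse)
  have nB: "fock_norm (B \<Psi>) \<le> K * fock_norm \<Psi>" if "\<Psi> \<in> fock" for \<Psi>
    using nT[of "Fk \<Psi>"] that by (simp add: B_def fock_norm_fv[symmetric] fv_Fk)
  have "linear_operator_on fock B"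
    unfolding linear_operator_on_def
  proof (intro conjI ballI allI)
    show "(\<lambda>_. 0) \<in> (fock :: 'a fvec set)" using zero_in_weighted_dom[where 'a = 'a, of 0] by (simp add: weighted_dom_0)
    show "B ` fock \<subseteq> fock" by (auto simp: B_def)
    fix \<Phi> \<Psi> :: "'a fvec" and c :: complex assume f: "\<Phi> \<in> fock" "\<Psi> \<in> fock"
    show f': "(\<lambda>w. c * \<Phi> w + \<Psi> w) \<in> fock" using fock_lincomb[OF f, of c 1] by simp
    have "Fk (\<lambda>w. c * \<Phi> w + \<Psi> w) = cmul c (Fk \<Phi>) + Fk \<Psi>"
      by (simp add: fv_inject[symmetric] fv_plus fv_cmul fv_Fk f f')
    then show "B (\<lambda>w. c * \<Phi> w + \<Psi> w) = (\<lambda>w. c * B \<Phi> w + B \<Psi> w)"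
      using f f' by (simp add: B_def Tl fv_plus fv_cmul)
  qed simp
  then have bo: "bounded_operator B"
    unfolding bounded_operator_def using nB by (auto simp: B_def)
  have "operator_norm B \<le> K"
    unfolding operator_norm_def
  proof (rule cSUP_least)
    show "(fock :: 'a fvec set) \<noteq> {}" using fv_fock by blast
    fix \<Psi> :: "'a fvec" assume "\<Psi> \<in> fock"
    have nn: "fock_norm \<Psi> \<ge> 0" using fock_norm_fv[of "Fk \<Psi>"] \<open>\<Psi> \<in> fock\<close> by (simp add: fv_Fk)
    show "fock_norm (B \<Psi>) / fock_norm \<Psi> \<le> K"
    \<comment> \<open>At the zero vector the quotient has the value 0 by the convention for
      division.\<close>
    proof (cases "fock_norm \<Psi> = 0")
      case False
      then show ?thesis using nB[OF \<open>\<Psi> \<in> fock\<close>] nn by (simp add: divide_le_eq)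
    qed (simp add: K)
  qed
  moreover have "wick_symbol h B X = of_real (exp (- (norm X)\<^sup>2 / (2 * h))) * b (evec h X) (evec h X)" for X
    unfolding wick_symbol_fk[OF h BT S'] T ..
  ultimately show ?thesis using bo by blast
qed

lemma wick_operator_exists:
  fixes A :: "'a::{real_inner, second_countable_topology} \<times> 'a \<Rightarrow> 'a \<times> 'a"
  assumes h: "h > 0" and A: "selfadjoint_op A" "nonneg_op A" "trace_class A"
    and F: "smooth F" "S_bound (\<lambda>X. A X \<bullet> X) F C" and C: "C > 0"
  shows "\<exists>B. bounded_operator B \<and> has_wick_symbol h fock B F \<and> operator_norm B \<le> exp ((h / 2) * trace_op A) * C"
proof -
  obtain b where b: "sesquilinear_bounded (exp ((h / 2) * trace_op A) * C) b"
    "\<And>X. b (evec h X) (evec h X) = of_real (exp ((norm X)\<^sup>2 / (2 * h))) * F X"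
    using wick_form_exists[OF h A F] by blast
  obtain B where B: "bounded_operator B" "operator_norm B \<le> exp ((h / 2) * trace_op A) * C"
    "\<And>X. wick_symbol h B X = of_real (exp (- (norm X)\<^sup>2 / (2 * h))) * b (evec h X) (evec h X)"
    using form_operator[OF h b(1)] C by auto
  have "wick_symbol h B X = F X" for X
    unfolding B(3) b(2) mult.assoc[symmetric] of_real_mult[symmetric] mult_exp_exp by simp
  then have "has_wick_symbol h fock B F"
    by (auto simp: has_wick_symbol_def coherent_fock[OF h])
  then show ?thesis using B by blast
qed

lemma wick_quantization_bounded:
  fixes A :: "'a::{real_inner, second_countable_topology} \<times> 'a \<Rightarrow> 'a \<times> 'a"
  assumes h: "h > 0" and A: "selfadjoint_op A" "nonneg_op A" "trace_class A"
    and F: "F \<in> S_class (\<lambda>X. A X \<bullet> X)"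
  shows "\<exists>!B. bounded_operator B \<and> has_wick_symbol h fock B F"
    "operator_norm (op_wick h F) \<le> exp ((h / 2) * trace_op A) * S_norm (\<lambda>X. A X \<bullet> X) F"
proof -
  define Cs where "Cs = {C. C > 0 \<and> S_bound (\<lambda>X. A X \<bullet> X) F C}"
  have sm: "smooth F" and ne: "Cs \<noteq> {}" using F by (auto simp: S_class_def Cs_def)
  have ex: "\<exists>B. bounded_operator B \<and> has_wick_symbol h fock B F \<and> operator_norm B \<le> exp ((h / 2) * trace_op A) * C"
    if "C \<in> Cs" for C
    using wick_operator_exists[OF h A sm, of C] that by (simp add: Cs_def)
  show ex1: "\<exists>!B. bounded_operator B \<and> has_wick_symbol h fock B F"
  proof (rule ex_ex1I)
    show "\<exists>B. bounded_operator B \<and> has_wick_symbol h fock B F" using ex ne by blast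
    fix B B' assume "bounded_operator B \<and> has_wick_symbol h fock B F" "bounded_operator B' \<and> has_wick_symbol h fock B' F"
    then show "B = B'" by (intro bounded_operator_wick_unique[OF h]) (auto simp: has_wick_symbol_def)
  qed
  \<comment> \<open>The estimate is available for each admissible constant \<open>C\<close>, and by
    uniqueness always for the same operator; hence it passes to the infimum, which is the norm of
    \<open>F\<close>.\<close>
  have le: "operator_norm (op_wick h F) / exp ((h / 2) * trace_op A) \<le> C" if "C \<in> Cs" for C
  proof -
    obtain B where B: "bounded_operator B \<and> has_wick_symbol h fock B F" "operator_norm B \<le> exp ((h / 2) * trace_op A) * C"
      using ex[OF \<open>C \<in> Cs\<close>] by blast
    have "op_wick h F = B"
      unfolding op_wick_def
    proof (rule the_equality)
      show "bounded_operator B \<and> has_wick_symbol h fock B F" by (rule B(1))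
      show "B' = B" if "bounded_operator B' \<and> has_wick_symbol h fock B' F" for B'
        using ex1 that B(1) by blast
    qed
    then show ?thesis using B(2) by (simp add: divide_le_eq mult.commute)
  qed
  have "operator_norm (op_wick h F) / exp ((h / 2) * trace_op A) \<le> Inf Cs"
    by (rule cInf_greatest[OF ne le])
  then show "operator_norm (op_wick h F) \<le> exp ((h / 2) * trace_op A) * S_norm (\<lambda>X. A X \<bullet> X) F"
    unfolding S_norm_def Cs_def[symmetric] by (simp add: divide_le_eq mult.commute)
qed

section \<open>Polynomial symbols\<close>

lemma coherent_weighted_dom:
  "h > 0 \<Longrightarrow> coherent h X \<in> (weighted_dom p :: 'a::{real_inner, second_countable_topology} fvec set)"
  unfolding coherent_eq by (intro weighted_dom_cmult coherent_vec_weighted_dom)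

lemma fock_inner_coherent_self:
  fixes X :: "'a::{real_inner, second_countable_topology} \<times> 'a"
  assumes h: "h > 0"
  shows "fock_inner (coherent h X) (coherent h X) = 1"
proof -
  define e where "e = exp (- (norm X)\<^sup>2 / (4 * h))"
  have "fock_inner (coherent h X) (coherent h X) = of_real ((norm (cmul (of_real e) (evec h X)))\<^sup>2)"
    unfolding cip_self[symmetric] cip_def coherent_fk[OF h] e_def ..
  also have "norm (cmul (of_real e) (evec h X)) = 1"
    unfolding norm_cmul norm_evec[OF h] e_def by (simp add: mult_exp_exp)
  finally show ?thesis by simp
qed

lemma annihilation_coherent:
  assumes h: "h > 0"
  shows "annihilation V (coherent h X) = (\<lambda>w. cinner X V / of_real (sqrt (2 * h)) * coherent h X w)"
proof
  fix w
  have "annihilation V (coherent h X) w = of_real (exp (- (norm X)\<^sup>2 / (4 * h))) * annihilation V (coherent_vec h X) w"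
    unfolding coherent_eq[OF h] annihilation_def by (rule mult.left_commute)
  then show "annihilation V (coherent h X) w = cinner X V / of_real (sqrt (2 * h)) * coherent h X w"
    unfolding annihilation_coherent_vec coherent_eq[OF h] by (simp only: mult.left_commute)
qed

lemma fock_inner_cmult_right:
  fixes \<Phi> \<Psi> :: "'a::{real_inner, second_countable_topology} fvec"
  assumes "\<Phi> \<in> fock" "\<Psi> \<in> fock"
  shows "fock_inner \<Phi> (\<lambda>w. c * \<Psi> w) = cnj c * fock_inner \<Phi> \<Psi>"
  using cip_cmul_right[of "Fk \<Phi>" c "Fk \<Psi>"] assms by (simp add: cip_def fv_cmul fv_Fk)

lemma fock_inner_creation_coherent:
  fixes \<Phi> :: "'a::{real_inner, second_countable_topology} fvec"
  assumes h: "h > 0" and \<Phi>: "\<Phi> \<in> weighted_dom 1"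
  shows "fock_inner (creation V \<Phi>) (coherent h X) = cinner V X / of_real (sqrt (2 * h)) * fock_inner \<Phi> (coherent h X)"
proof -
  have "fock_inner (creation V \<Phi>) (coherent h X) = fock_inner \<Phi> (annihilation V (coherent h X))"
    by (rule fock_inner_creation[OF \<Phi> coherent_weighted_dom[OF h]])
  also have "\<dots> = cnj (cinner X V / of_real (sqrt (2 * h))) * fock_inner \<Phi> (coherent h X)"
    unfolding annihilation_coherent[OF h]
    by (rule fock_inner_cmult_right) (use \<Phi> weighted_dom_subset_fock in \<open>auto simp: coherent_fock[OF h]\<close>)
  finally show ?thesis by (simp add: cinner_commute[of V X])
qed

section \<open>Wick ordered products\<close>

lemma creation_lincomb: "creation V (\<lambda>w. c * \<Phi> w + \<Psi> w) = (\<lambda>w. c * creation V \<Phi> w + creation V \<Psi> w)"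
proof
  fix w
  have "(\<Sum>j<length w. cinner V (w ! j) * (c * \<Phi> (remove_nth j w) + \<Psi> (remove_nth j w))) =
      c * (\<Sum>j<length w. cinner V (w ! j) * \<Phi> (remove_nth j w)) + (\<Sum>j<length w. cinner V (w ! j) * \<Psi> (remove_nth j w))"
    by (simp add: distrib_left sum.distrib sum_distrib_left mult.left_commute)
  then show "creation V (\<lambda>w. c * \<Phi> w + \<Psi> w) w = c * creation V \<Phi> w + creation V \<Psi> w"
    unfolding creation_def by (simp only: distrib_left mult.left_commute)
qed

lemma annihilation_lincomb:
  "annihilation V (\<lambda>w. c * \<Phi> w + \<Psi> w) = (\<lambda>w. c * annihilation V \<Phi> w + annihilation V \<Psi> w)"
  unfolding annihilation_def by (rule ext) (simp only: distrib_left mult.left_commute)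

text \<open>The Wick ordered product of the fields with symbols \<open>X \<mapsto> V \<bullet> X\<close>, for \<open>V\<close> in the list.\<close>

primrec wick_product :: "real \<Rightarrow> ('a::real_inner \<times> 'a) list \<Rightarrow> 'a fvec \<Rightarrow> 'a fvec" where
  "wick_product h [] = (\<lambda>\<Phi>. \<Phi>)"
| "wick_product h (V # Vs) = (\<lambda>\<Phi> w. of_real (sqrt (2 * h) / 2) *
     (creation V (wick_product h Vs \<Phi>) w + wick_product h Vs (annihilation V \<Phi>) w))"

lemma wick_product_lincomb:
  "wick_product h Vs (\<lambda>w. c * \<Phi> w + \<Psi> w) = (\<lambda>w. c * wick_product h Vs \<Phi> w + wick_product h Vs \<Psi> w)"
proof (induction Vs arbitrary: \<Phi> \<Psi>)
  case (Cons V Vs)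
  show ?case
    unfolding wick_product.simps annihilation_lincomb Cons.IH creation_lincomb
    by (rule ext) (simp add: algebra_simps)
qed simp

lemma wick_product_cmult: "wick_product h Vs (\<lambda>w. c * \<Phi> w) = (\<lambda>w. c * wick_product h Vs \<Phi> w)"
  using wick_product_lincomb[of h Vs "c - 1" \<Phi> \<Phi>] by (simp add: algebra_simps)

lemma wick_product_weighted_dom:
  fixes \<Phi> :: "'a::{real_inner, second_countable_topology} fvec"
  shows "\<Phi> \<in> weighted_dom (length Vs + p) \<Longrightarrow> wick_product h Vs \<Phi> \<in> weighted_dom p"
proof (induction Vs arbitrary: \<Phi> p)
  case (Cons V Vs)
  have "creation V (wick_product h Vs \<Phi>) \<in> weighted_dom p"
    by (rule creation_weighted_dom) (rule Cons.IH, use Cons.prems in simp)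
  moreover have "wick_product h Vs (annihilation V \<Phi>) \<in> weighted_dom p"
    by (rule Cons.IH) (rule annihilation_weighted_dom, use Cons.prems in simp)
  ultimately have "(\<lambda>w. of_real (sqrt (2 * h) / 2) * creation V (wick_product h Vs \<Phi>) w +
      of_real (sqrt (2 * h) / 2) * wick_product h Vs (annihilation V \<Phi>) w) \<in> weighted_dom p"
    by (rule weighted_dom_lincomb)
  then show ?case by (simp only: wick_product.simps distrib_left)
qed simp

text \<open>At a fixed list, creation and annihilation are finite combinations of values of the form
  at other lists. Pointwise convergence therefore survives these operators although they are
  unbounded; closability rests on this.\<close>

lemma wick_product_pointwise:
  assumes "\<And>w. (\<lambda>k. u k w) \<longlonglongrightarrow> 0"
  shows "(\<lambda>k. wick_product h Vs (u k) w) \<longlonglongrightarrow> 0"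
  using assms
proof (induction Vs arbitrary: u w)
  case (Cons V Vs)
  have "(\<lambda>k. annihilation V (u k) w) \<longlonglongrightarrow> 0" for w
    unfolding annihilation_def by (rule tendsto_mult_right_zero) (rule Cons.prems)
  then have "(\<lambda>k. wick_product h Vs (annihilation V (u k)) w) \<longlonglongrightarrow> 0" by (rule Cons.IH)
  moreover have "(\<lambda>k. creation V (wick_product h Vs (u k)) w) \<longlonglongrightarrow> 0"
    unfolding creation_def
    by (intro tendsto_mult_right_zero tendsto_null_sum) (rule Cons.IH[OF Cons.prems])
  ultimately have "(\<lambda>k. creation V (wick_product h Vs (u k)) w + wick_product h Vs (annihilation V (u k)) w) \<longlonglongrightarrow> 0"
    by (intro tendsto_add_zero)
  then show ?case unfolding wick_product.simps by (rule tendsto_mult_right_zero)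
qed simp

text \<open>Creation acts on the coherent state to the right as its adjoint, annihilation on the one
  to the left; each yields an eigenvalue, and the two are conjugate. Their sum is
  \<open>2 (V \<bullet> X) / sqrt (2 h)\<close>, which the factor \<open>sqrt (2 h) / 2\<close>
  normalizes.\<close>

lemma wick_product_symbol:
  fixes X :: "'a::{real_inner, second_countable_topology} \<times> 'a"
  assumes h: "h > 0"
  shows "fock_inner (wick_product h Vs (coherent h X)) (coherent h X) = of_real (\<Prod>V\<leftarrow>Vs. V \<bullet> X)"
proof (induction Vs)
  case Nil
  show ?case by (simp add: fock_inner_coherent_self[OF h])
next
  case (Cons V Vs)
  define s where "s = sqrt (2 * h)"
  have s: "s > 0" using h by (simp add: s_def)
  define \<Theta> where "\<Theta> = wick_product h Vs (coherent h X)"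
  have T1: "\<Theta> \<in> weighted_dom 1"
    unfolding \<Theta>_def by (rule wick_product_weighted_dom[OF coherent_weighted_dom[OF h]])
  have "creation V \<Theta> \<in> weighted_dom 0" by (rule creation_weighted_dom) (use T1 in simp)
  then have f: "\<Theta> \<in> fock" "creation V \<Theta> \<in> fock" "coherent h X \<in> fock"
    unfolding weighted_dom_0 using T1 weighted_dom_subset_fock coherent_fock[OF h, of X] by blast+
  have "wick_product h (V # Vs) (coherent h X) =
      (\<lambda>w. of_real (s / 2) * creation V \<Theta> w + of_real (s / 2) * (cinner X V / of_real s) * \<Theta> w)"
    unfolding wick_product.simps annihilation_coherent[OF h] wick_product_cmult \<Theta>_def[symmetric] s_def[symmetric]
    by (simp only: distrib_left mult.assoc)
  then have "fock_inner (wick_product h (V # Vs) (coherent h X)) (coherent h X) =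
      of_real (s / 2) * (cinner V X / of_real s * fock_inner \<Theta> (coherent h X)) +
      of_real (s / 2) * (cinner X V / of_real s) * fock_inner \<Theta> (coherent h X)"
    by (simp only: fock_inner_lincomb[OF f(2,1,3)] fock_inner_creation_coherent[OF h T1] s_def)
  also have "\<dots> = (cinner V X + cinner X V) / 2 * fock_inner \<Theta> (coherent h X)"
    using s by (simp add: field_simps)
  also have "(cinner V X + cinner X V) / 2 = of_real (V \<bullet> X)"
    unfolding cinner_commute[of X V] complex_add_cnj Re_cinner by simp
  finally show ?case unfolding \<Theta>_def Cons.IH by simp
qed

section \<open>Domains of the powers of the number operator\<close>

lemma number_op_power: "(number_op ^^ k) \<Psi> = (\<lambda>w. of_nat (length w) ^ k * \<Psi> w)"
proof (induction k)
  case (Suc k)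
  have "adjoint (\<lambda>x. x) = (\<lambda>x :: 'a. x)" by (rule adjoint_unique) simp
  then have "number_op \<Phi> w = of_nat (length w) * \<Phi> w" for \<Phi> :: "'a fvec" and w
    by (simp add: number_op_def dGamma_def cextend_def)
  then show ?case using Suc by (simp add: fun_eq_iff mult.assoc)
qed simp

lemma level_length_weight: "level (\<lambda>w. a (length w) * \<Psi> w) n = (cmod (a n))\<^sup>2 * level \<Psi> n"
proof -
  have "level (\<lambda>w. a (length w) * \<Psi> w) n = (\<Sum>\<^sub>\<infinity>w\<in>words n. (cmod (a n))\<^sup>2 * (cmod (\<Psi> w))\<^sup>2)"
    unfolding level_def by (rule infsum_cong) (simp add: words_def norm_mult power_mult_distrib)
  then show ?thesis by (simp add: level_def infsum_cmult_right')
qed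

lemma fock_form_length_weight:
  assumes F: "fock_form \<Psi>" shows "fock_form (\<lambda>w. a (length w) * \<Psi> w)"
  unfolding fock_form_def
proof (intro conjI)
  show "\<forall>V W ws. a (length ((V + W) # ws)) * \<Psi> ((V + W) # ws) =
      a (length (V # ws)) * \<Psi> (V # ws) + a (length (W # ws)) * \<Psi> (W # ws)"
    by (simp add: fock_form_add[OF F] distrib_left)
  show "\<forall>c V ws. a (length (cscale c V # ws)) * \<Psi> (cscale c V # ws) = cnj c * (a (length (V # ws)) * \<Psi> (V # ws))"
    by (simp add: fock_form_cscale[OF F])
  show "\<forall>n. \<exists>C. \<forall>Vs. length Vs = n \<longrightarrow> cmod (a (length Vs) * \<Psi> Vs) \<le> C * prod_list (map norm Vs)"
  proof
    fix n
    obtain C where C: "\<And>Vs. length Vs = n \<Longrightarrow> cmod (\<Psi> Vs) \<le> C * prod_list (map norm Vs)"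
      using fock_form_bound[OF F, of n] by blast
    have "cmod (a (length Vs) * \<Psi> Vs) \<le> (cmod (a n) * C) * prod_list (map norm Vs)" if l: "length Vs = n" for Vs
      unfolding norm_mult l mult.assoc by (intro mult_left_mono C l norm_ge_zero)
    then show "\<exists>C. \<forall>Vs. length Vs = n \<longrightarrow> cmod (a (length Vs) * \<Psi> Vs) \<le> C * prod_list (map norm Vs)" by blast
  qed
  show "\<forall>Vs Ws. mset Vs = mset Ws \<longrightarrow> a (length Vs) * \<Psi> Vs = a (length Ws) * \<Psi> Ws"
  proof (intro allI impI)
    fix Vs Ws :: "('a \<times> 'a) list" assume m: "mset Vs = mset Ws"
    show "a (length Vs) * \<Psi> Vs = a (length Ws) * \<Psi> Ws"
      unfolding mset_eq_length[OF m] fock_form_sym[OF F m] ..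
  qed
  show "\<forall>n. (\<lambda>w. (cmod (a (length w) * \<Psi> w))\<^sup>2) summable_on words n"
  proof
    fix n
    have "(\<lambda>w. (cmod (a n))\<^sup>2 * (cmod (\<Psi> w))\<^sup>2) summable_on words n"
      by (intro summable_on_cmult_right fock_form_summable F)
    then show "(\<lambda>w. (cmod (a (length w) * \<Psi> w))\<^sup>2) summable_on words n"
      by (rule summable_on_cong[THEN iffD1, rotated]) (simp add: words_def norm_mult power_mult_distrib)
  qed
qed

lemma number_power_dom_iff:
  "\<Psi> \<in> number_power_dom m \<longleftrightarrow> (\<forall>k\<le>m. (\<lambda>w. of_nat (length w) ^ k * \<Psi> w) \<in> fock)"
  by (simp add: number_power_dom_def number_op_power)

text \<open>The m-th power of N controls the weight \<open>n ^ (2 m)\<close>, which for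
  \<open>n \<ge> 1\<close> dominates \<open>(n + 1) ^ m\<close> up to \<open>2 ^ m\<close>; the
  level 0 is controlled by the vector itself.\<close>

lemma number_power_dom_subset_weighted: "number_power_dom m \<subseteq> weighted_dom m"
proof
  fix \<Psi> :: "'a fvec" assume "\<Psi> \<in> number_power_dom m"
  then have f: "(\<lambda>w. of_nat (length w) ^ k * \<Psi> w) \<in> fock" if "k \<le> m" for k
    using that by (simp add: number_power_dom_iff)
  have F: "fock_form \<Psi>" "summable (level \<Psi>)" using f[of 0] by (simp_all add: fock_iff)
  have "summable (level (\<lambda>w. of_nat (length w) ^ m * \<Psi> w))" using f[of m] by (simp add: fock_iff)
  moreover have "level (\<lambda>w. of_nat (length w) ^ m * \<Psi> w) = (\<lambda>n. (real n ^ m)\<^sup>2 * level \<Psi> n)"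
    by (rule ext, subst level_length_weight[of "\<lambda>n. of_nat n ^ m" \<Psi>]) (simp add: norm_power)
  ultimately have s: "summable (\<lambda>n. (real n ^ m)\<^sup>2 * level \<Psi> n)" by simp
  have "summable (\<lambda>n. (real n + 1) ^ m * level \<Psi> n)"
  proof (rule summable_comparison_test_ev[OF _ summable_mult[OF summable_add[OF F(2) s], of "2 ^ m"]],
      intro always_eventually allI)
    fix n
    have "(real n + 1) ^ m \<le> 2 ^ m * (1 + (real n ^ m)\<^sup>2)"
    proof (cases "n = 0")
      case False
      then have n1: "real n \<ge> 1" by simp
      have "(real n + 1) ^ m \<le> (2 * real n) ^ m" by (rule power_mono) (use n1 in simp_all)
      also have "\<dots> = 2 ^ m * (real n ^ m * 1)" by (simp add: power_mult_distrib)
      also have "\<dots> \<le> 2 ^ m * (real n ^ m * real n ^ m)"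
        by (intro mult_left_mono one_le_power n1) auto
      also have "\<dots> \<le> 2 ^ m * (1 + (real n ^ m)\<^sup>2)" by (simp add: power2_eq_square)
      finally show ?thesis .
    next
      case True
      have "1 * 1 \<le> (2 :: real) ^ m * (1 + (real n ^ m)\<^sup>2)" by (rule mult_mono) auto
      then show ?thesis by (simp add: True)
    qed
    then have "(real n + 1) ^ m * level \<Psi> n \<le> 2 ^ m * (1 + (real n ^ m)\<^sup>2) * level \<Psi> n"
      by (rule mult_right_mono) (rule level_nonneg)
    then show "norm ((real n + 1) ^ m * level \<Psi> n) \<le> 2 ^ m * (level \<Psi> n + (real n ^ m)\<^sup>2 * level \<Psi> n)"
      by (simp add: abs_mult level_nonneg algebra_simps)
  qed
  then show "\<Psi> \<in> weighted_dom m" using F by (simp add: weighted_dom_def)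
qed

text \<open>Coherent states lie in every weighted domain, so this puts them into the domains of all
  powers of N.\<close>

lemma weighted_dom_subset_number_power: "weighted_dom (2 * m) \<subseteq> number_power_dom m"
proof
  fix \<Psi> :: "'a fvec" assume P: "\<Psi> \<in> weighted_dom (2 * m)"
  show "\<Psi> \<in> number_power_dom m"
    unfolding number_power_dom_iff
  proof (intro allI impI)
    fix k assume k: "k \<le> m"
    have F: "fock_form \<Psi>" and s: "summable (\<lambda>n. (real n + 1) ^ (2 * m) * level \<Psi> n)"
      using P by (simp_all add: weighted_dom_def)
    have "summable (level (\<lambda>w. of_nat (length w) ^ k * \<Psi> w))"
    proof (rule summable_comparison_test_ev[OF _ s], intro always_eventually allI)
      fix n
      have "(real n) ^ (2 * k) \<le> (real n + 1) ^ (2 * k)" by (rule power_mono) auto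
      also have "\<dots> \<le> (real n + 1) ^ (2 * m)" by (rule power_increasing) (use k in auto)
      finally have "(real n ^ k)\<^sup>2 * level \<Psi> n \<le> (real n + 1) ^ (2 * m) * level \<Psi> n"
        by (intro mult_right_mono level_nonneg) (simp add: power_mult[symmetric] mult.commute)
      then show "norm (level (\<lambda>w. of_nat (length w) ^ k * \<Psi> w) n) \<le> (real n + 1) ^ (2 * m) * level \<Psi> n"
        using level_length_weight[of "\<lambda>n. of_nat n ^ k" \<Psi> n] by (simp add: level_nonneg norm_power)
    qed
    then show "(\<lambda>w. of_nat (length w) ^ k * \<Psi> w) \<in> fock"
      using fock_form_length_weight[OF F, of "\<lambda>n. of_nat n ^ k"] by (simp add: fock_iff)
  qed
qed

lemma number_power_dom_lincomb:
  assumes "\<Phi> \<in> number_power_dom m" "\<Psi> \<in> number_power_dom m"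
  shows "(\<lambda>w. c * \<Phi> w + \<Psi> w) \<in> number_power_dom m"
  unfolding number_power_dom_iff
proof (intro allI impI)
  fix k assume "k \<le> m"
  then have "(\<lambda>w. c * (of_nat (length w) ^ k * \<Phi> w) + 1 * (of_nat (length w) ^ k * \<Psi> w)) \<in> fock"
    using assms by (intro fock_lincomb) (simp_all add: number_power_dom_iff)
  then show "(\<lambda>w. of_nat (length w) ^ k * (c * \<Phi> w + \<Psi> w)) \<in> fock"
    by (simp add: algebra_simps)
qed

lemma fock_pointwise_bound:
  fixes \<Psi> :: "'a::{real_inner, second_countable_topology} fvec"
  shows "\<Psi> \<in> fock \<Longrightarrow> cmod (\<Psi> Vs) \<le> fock_norm \<Psi> * prod_list (map norm Vs)"
  using fv_bound[of "Fk \<Psi>" Vs] fock_norm_fv[of "Fk \<Psi>"] by (simp add: fv_Fk)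

section \<open>Operators with polynomial Wick symbol\<close>

definition wick_polynomial ::
  "real \<Rightarrow> (complex \<times> ('a::real_inner \<times> 'a) list) list \<Rightarrow> 'a fvec \<Rightarrow> 'a fvec" where
  "wick_polynomial h ts \<Phi> = (\<lambda>w. \<Sum>(c, Vs)\<leftarrow>ts. c * wick_product h Vs \<Phi> w)"

lemma wick_polynomial_simps:
  "wick_polynomial h [] \<Phi> = (\<lambda>w. 0)"
  "wick_polynomial h ((c, Vs) # ts) \<Phi> = (\<lambda>w. c * wick_product h Vs \<Phi> w + 1 * wick_polynomial h ts \<Phi> w)"
  by (simp_all add: wick_polynomial_def)

lemma wick_polynomial_lincomb:
  "wick_polynomial h ts (\<lambda>w. c * \<Phi> w + \<Psi> w) = (\<lambda>w. c * wick_polynomial h ts \<Phi> w + wick_polynomial h ts \<Psi> w)"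
proof (induction ts)
  case (Cons t ts)
  obtain d Vs where t: "t = (d, Vs)" by fastforce
  show ?case
    unfolding t wick_polynomial_simps wick_product_lincomb Cons.IH by (rule ext) (simp add: algebra_simps)
qed (simp add: wick_polynomial_simps)

lemma wick_polynomial_fock:
  fixes \<Phi> :: "'a::{real_inner, second_countable_topology} fvec"
  assumes "\<Phi> \<in> weighted_dom m" "\<forall>(c, Vs)\<in>set ts. length Vs \<le> m"
  shows "wick_polynomial h ts \<Phi> \<in> fock"
  using assms(2)
proof (induction ts)
  case Nil
  then show ?case using zero_in_weighted_dom[where 'a = 'a, of 0] by (simp add: wick_polynomial_simps weighted_dom_0)
next
  case (Cons t ts)
  obtain d Vs where t: "t = (d, Vs)" by fastforce
  have "\<Phi> \<in> weighted_dom (length Vs + 0)"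
    using assms(1) weighted_dom_antimono[of "length Vs" m] Cons.prems by (auto simp: t)
  then have "wick_product h Vs \<Phi> \<in> weighted_dom 0" by (rule wick_product_weighted_dom)
  then have "wick_product h Vs \<Phi> \<in> fock" by (simp add: weighted_dom_0)
  moreover have "wick_polynomial h ts \<Phi> \<in> fock" by (rule Cons.IH) (use Cons.prems in simp)
  ultimately show ?case unfolding t wick_polynomial_simps by (rule fock_lincomb)
qed

lemma wick_polynomial_symbol:
  fixes X :: "'a::{real_inner, second_countable_topology} \<times> 'a"
  assumes h: "h > 0"
  shows "wick_symbol h (wick_polynomial h ts) X = (\<Sum>(c, Vs)\<leftarrow>ts. c * of_real (\<Prod>V\<leftarrow>Vs. V \<bullet> X))"
  unfolding wick_symbol_def
proof (induction ts)
  case Nil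
  show ?case by (simp add: wick_polynomial_simps fock_inner_def)
next
  case (Cons t ts)
  obtain d Vs where t: "t = (d, Vs)" by fastforce
  have "wick_product h Vs (coherent h X) \<in> weighted_dom 0"
    by (rule wick_product_weighted_dom[OF coherent_weighted_dom[OF h]])
  then have f: "wick_product h Vs (coherent h X) \<in> fock" by (simp add: weighted_dom_0)
  define m where "m = Max (insert 0 ((\<lambda>(c, Vs). length Vs) ` set ts))"
  have "wick_polynomial h ts (coherent h X) \<in> fock"
  proof (rule wick_polynomial_fock[OF coherent_weighted_dom[OF h, of X m]])
    show "\<forall>(c, Vs)\<in>set ts. length Vs \<le> m"
      unfolding m_def by (auto intro!: Max_ge)
  qed
  from fock_inner_lincomb[OF f this coherent_fock[OF h], of d 1 X] show ?case
    unfolding t wick_polynomial_simps by (simp add: wick_product_symbol[OF h] Cons.IH)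
qed

lemma wick_polynomial_closable:
  fixes ts :: "(complex \<times> ('a::{real_inner, second_countable_topology} \<times> 'a) list) list"
  assumes ts: "\<forall>(c, Vs)\<in>set ts. length Vs \<le> m"
  shows "closable (number_power_dom m) (wick_polynomial h ts)"
  unfolding closable_def
proof (intro allI impI, elim conjE)
  fix u :: "nat \<Rightarrow> 'a fvec" and \<Phi> :: "'a fvec"
  assume u: "\<forall>k. u k \<in> number_power_dom m" and \<Phi>: "\<Phi> \<in> fock"
    and u0: "(\<lambda>k. fock_norm (u k)) \<longlonglongrightarrow> 0"
    and B: "(\<lambda>k. fock_norm (\<lambda>w. wick_polynomial h ts (u k) w - \<Phi> w)) \<longlonglongrightarrow> 0"
  have wd: "u k \<in> weighted_dom m" for k using u number_power_dom_subset_weighted by blast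
  have uf: "u k \<in> fock" for k using wd weighted_dom_subset_fock by blast
  have up: "(\<lambda>k. u k w) \<longlonglongrightarrow> 0" for w
    by (rule Lim_null_comparison[OF always_eventually[OF allI[OF fock_pointwise_bound[OF uf]]] tendsto_mult_left_zero[OF u0]])
  have Bp: "(\<lambda>k. wick_polynomial h ts (u k) w) \<longlonglongrightarrow> 0" for w
  proof (induction ts)
    case (Cons t ts)
    obtain d Vs where t: "t = (d, Vs)" by fastforce
    show ?case
      unfolding t wick_polynomial_simps
      by (intro tendsto_add_zero tendsto_mult_right_zero Cons wick_product_pointwise up)
  qed (simp add: wick_polynomial_simps)
  show "\<Phi> = (\<lambda>_. 0)"
  proof
    fix w
    have df: "(\<lambda>w. wick_polynomial h ts (u k) w - \<Phi> w) \<in> fock" for k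
      using fock_lincomb[OF wick_polynomial_fock[OF wd ts] \<Phi>, where a = 1 and b = "-1"] by simp
    have "(\<lambda>k. wick_polynomial h ts (u k) w - \<Phi> w) \<longlonglongrightarrow> 0"
      by (rule Lim_null_comparison[OF always_eventually[OF allI[OF fock_pointwise_bound[OF df]]] tendsto_mult_left_zero[OF B]])
    moreover have "(\<lambda>k. wick_polynomial h ts (u k) w - \<Phi> w) \<longlonglongrightarrow> 0 - \<Phi> w"
      by (intro tendsto_diff Bp tendsto_const)
    ultimately have "0 - \<Phi> w = 0" using LIMSEQ_unique by blast
    then show "\<Phi> w = 0" by simp
  qed
qed

lemma coord_fun_inner:
  assumes "l \<in> coord_funs E" shows "\<exists>V. l = (\<lambda>X. V \<bullet> X)"
proof -
  obtain e where "l = (\<lambda>(q, p). e \<bullet> q) \<or> l = (\<lambda>(q, p). e \<bullet> p)"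
    using assms by (auto simp: coord_funs_def)
  then have "l = (\<lambda>X. (e, 0) \<bullet> X) \<or> l = (\<lambda>X. (0, e) \<bullet> X)" by (auto simp: inner_prod_def fun_eq_iff)
  then show ?thesis by blast
qed

lemma wick_quantization_polynomial:
  fixes E :: "'a::{real_inner, second_countable_topology} set"
  assumes h: "h > 0" and F: "F \<in> polys_upto E m"
  shows "\<exists>B. linear_operator_on (number_power_dom m) B \<and> closable (number_power_dom m) B \<and>
    has_wick_symbol h (number_power_dom m) B F"
proof -
  obtain ts :: "(complex \<times> ('a \<times> 'a \<Rightarrow> real) list) list" where
    ts: "\<forall>(c, ls)\<in>set ts. set ls \<subseteq> coord_funs E \<and> length ls \<le> m"
    "F = (\<lambda>X. \<Sum>(c, ls)\<leftarrow>ts. c * of_real (\<Prod>l\<leftarrow>ls. l X))"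
    using F unfolding polys_upto_def by blast
  \<comment> \<open>Coordinate functions are real inner products with vectors \<open>(e, 0)\<close>
    or \<open>(0, e)\<close>; these vectors index the factors of the Wick products.\<close>
  define v where "v l = (SOME V. l = (\<lambda>X. V \<bullet> X))" for l :: "'a \<times> 'a \<Rightarrow> real"
  have v: "v l \<bullet> X = l X" if "l \<in> coord_funs E" for l X
    using someI_ex[OF coord_fun_inner[OF that]] unfolding v_def by metis
  define us where "us = map (\<lambda>(c, ls). (c, map v ls)) ts"
  have us: "\<forall>(c, Vs)\<in>set us. length Vs \<le> m" using ts(1) by (auto simp: us_def)
  have sym: "wick_symbol h (wick_polynomial h us) X = F X" for X
  proof -
    have "(\<Sum>(c, Vs)\<leftarrow>us. c * of_real (\<Prod>V\<leftarrow>Vs. V \<bullet> X)) = (\<Sum>(c, ls)\<leftarrow>ts. c * of_real (\<Prod>l\<leftarrow>ls. l X))"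
      unfolding us_def map_map o_def
    proof (rule arg_cong[of _ _ sum_list], rule map_cong[OF refl])
      fix t assume "t \<in> set ts"
      moreover obtain c ls where t: "t = (c, ls)" by fastforce
      ultimately have "set ls \<subseteq> coord_funs E" using ts(1) by auto
      then have "map (\<lambda>l. v l \<bullet> X) ls = map (\<lambda>l. l X) ls"
        by (intro map_cong[OF refl]) (rule v[of _ X], blast)
      then show "(case case t of (c, ls) \<Rightarrow> (c, map v ls) of (c, Vs) \<Rightarrow> c * of_real (\<Prod>V\<leftarrow>Vs. V \<bullet> X)) =
          (case t of (c, ls) \<Rightarrow> c * of_real (\<Prod>l\<leftarrow>ls. l X))"
        by (simp only: t prod.case map_map o_def)
    qed
    then show ?thesis unfolding wick_polynomial_symbol[OF h] ts(2) .
  qed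
  have "linear_operator_on (number_power_dom m) (wick_polynomial h us)"
    unfolding linear_operator_on_def wick_polynomial_lincomb
  proof (intro conjI ballI allI refl)
    show "(number_power_dom m :: 'a fvec set) \<subseteq> fock"
      using number_power_dom_subset_weighted weighted_dom_subset_fock by blast
    show "(\<lambda>_. 0) \<in> (number_power_dom m :: 'a fvec set)"
      using weighted_dom_subset_number_power zero_in_weighted_dom by blast
    show "wick_polynomial h us ` number_power_dom m \<subseteq> fock"
      using wick_polynomial_fock[OF _ us] number_power_dom_subset_weighted by blast
  qed (rule number_power_dom_lincomb)
  moreover have "closable (number_power_dom m) (wick_polynomial h us)"
    by (rule wick_polynomial_closable[OF us])
  moreover have "has_wick_symbol h (number_power_dom m) (wick_polynomial h us) F"
    unfolding has_wick_symbol_def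
    using sym coherent_weighted_dom[OF h] weighted_dom_subset_number_power by blast
  ultimately show ?thesis by blast
qed

section \<open>The Segal field and second quantization\<close>

text \<open>The annihilation and creation parts contribute the conjugate numbers
  \<open>cinner X A\<close> and \<open>cinner A X\<close> over \<open>sqrt (2 h)\<close>. The sum of
  the two numerators is \<open>2 (A \<bullet> X)\<close>, and
  \<open>sqrt 2 * sqrt (2 * h) = 2 * sqrt h\<close> explains the power of \<open>h\<close>.\<close>

lemma segal_wick_symbol:
  fixes A :: "'a::{real_inner, second_countable_topology} \<times> 'a"
  assumes h: "h > 0"
  shows "has_wick_symbol h (segal_dom A) (segal A) (\<lambda>X. of_real (h powr (- 1 / 2) * (A \<bullet> X)))"
proof -
  have c1: "coherent h X \<in> weighted_dom (Suc 0)" for X :: "'a \<times> 'a" by (rule coherent_weighted_dom[OF h])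
  note f = coherent_fock[OF h, where 'a = 'a] annihilation_weighted_dom[OF c1, of A, unfolded weighted_dom_0]
    creation_weighted_dom[OF c1, of A, unfolded weighted_dom_0]
  have "wick_symbol h (segal A) X = of_real (h powr (- 1 / 2) * (A \<bullet> X))" for X
  proof -
    have "segal A (coherent h X) =
        (\<lambda>w. (1 / of_real (sqrt 2)) * annihilation A (coherent h X) w + (1 / of_real (sqrt 2)) * creation A (coherent h X) w)"
      unfolding segal_def by (rule ext) (simp add: add_divide_distrib)
    then have "wick_symbol h (segal A) X =
        (1 / of_real (sqrt 2)) * fock_inner (annihilation A (coherent h X)) (coherent h X) +
        (1 / of_real (sqrt 2)) * fock_inner (creation A (coherent h X)) (coherent h X)"
      unfolding wick_symbol_def by (simp only: fock_inner_lincomb[OF f(2,3,1)])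
    also have "fock_inner (annihilation A (coherent h X)) (coherent h X) = cinner X A / of_real (sqrt (2 * h))"
      using fock_inner_lincomb[OF f(1)[of X] f(1)[of X] f(1)[of X], of "cinner X A / of_real (sqrt (2 * h))" 0]
      unfolding annihilation_coherent[OF h] by (simp add: fock_inner_coherent_self[OF h])
    also have "fock_inner (creation A (coherent h X)) (coherent h X) = cinner A X / of_real (sqrt (2 * h))"
      using fock_inner_creation_coherent[OF h coherent_weighted_dom[OF h], of A X X]
      by (simp add: fock_inner_coherent_self[OF h])
    also have "(1 / of_real (sqrt 2)) * (cinner X A / of_real (sqrt (2 * h))) + (1 / of_real (sqrt 2)) * (cinner A X / of_real (sqrt (2 * h))) =
        (cinner A X + cinner X A) / of_real (sqrt 2 * sqrt (2 * h))"
      by (simp add: add_divide_distrib)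
    also have "cinner A X + cinner X A = of_real (2 * (A \<bullet> X))"
      unfolding cinner_commute[of X A] complex_add_cnj Re_cinner ..
    also have "sqrt 2 * sqrt (2 * h) = 2 * sqrt h" by (simp add: real_sqrt_mult)
    also have "complex_of_real (2 * (A \<bullet> X)) / of_real (2 * sqrt h) = of_real (h powr (- 1 / 2) * (A \<bullet> X))"
    proof -
      have "h powr (- 1 / 2) = 1 / sqrt h"
        using h powr_minus_divide[of h "1 / 2"] powr_half_sqrt[of h] by simp
      then have "2 * (A \<bullet> X) / (2 * sqrt h) = h powr (- 1 / 2) * (A \<bullet> X)" by simp
      then show ?thesis by (simp only: of_real_divide[symmetric])
    qed
    finally show ?thesis .
  qed
  then show ?thesis unfolding has_wick_symbol_def segal_dom_def using f by blast
qed

text \<open>In the j-th summand \<open>A\<close> acts on a single factor of the product and moves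
  over to \<open>X\<close> by selfadjointness. The sum over positions then has the shape of a
  creation operator for \<open>A X\<close>.\<close>

lemma dGamma_coherent:
  assumes h: "h > 0" and A: "selfadjoint_op A"
  shows "dGamma A (coherent h X) = (\<lambda>w. 1 / of_real (sqrt (2 * h)) * creation (cextend A X) (coherent h X) w)"
proof
  fix w :: "('a \<times> 'a) list"
  have adj: "adjoint A = A" using A by (intro adjoint_unique) (simp add: selfadjoint_op_def)
  have cA: "cinner X (cextend A W) = cinner (cextend A X) W" for W
    using A by (simp add: selfadjoint_op_def cinner_def cextend_def)
  define e where "e = exp (- (norm X)\<^sup>2 / (4 * h))"
  define \<alpha> where "\<alpha> n = 1 / (sqrt (2 * h) ^ n * sqrt (fact n))" for n
  have co: "coherent h X Ws = of_real (e * \<alpha> (length Ws)) * (\<Prod>V\<leftarrow>Ws. cinner X V)" for Ws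
    by (simp add: coherent_eq[OF h] coherent_vec_def e_def \<alpha>_def)
  have t: "coherent h X (w[j := cextend A (w ! j)]) =
      1 / of_real (sqrt (2 * h)) * (of_real (1 / sqrt (real (length w))) * (cinner (cextend A X) (w ! j) * coherent h X (remove_nth j w)))"
    if j: "j < length w" for j
  proof -
    obtain k where k: "length w = Suc k" using j by (cases "length w") auto
    have a: "\<alpha> (Suc k) = 1 / sqrt (2 * h) * (1 / sqrt (real (Suc k))) * \<alpha> k"
      by (simp add: \<alpha>_def real_sqrt_mult)
    have l: "length (remove_nth j w) = k" using j k by simp
    have "(\<Prod>V\<leftarrow>w[j := cextend A (w ! j)]. cinner X V) = cinner (cextend A X) (w ! j) * (\<Prod>V\<leftarrow>remove_nth j w. cinner X V)"
      unfolding upd_conv_take_nth_drop[OF j] cA[symmetric] by (simp add: mult.left_commute)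
    then show ?thesis
      unfolding co length_list_update l k a by (simp add: mult_ac)
  qed
  have "dGamma A (coherent h X) w = (\<Sum>j<length w. coherent h X (w[j := cextend A (w ! j)]))"
    unfolding dGamma_def adj ..
  also have "\<dots> = (\<Sum>j<length w. 1 / of_real (sqrt (2 * h)) * (of_real (1 / sqrt (real (length w))) *
      (cinner (cextend A X) (w ! j) * coherent h X (remove_nth j w))))"
    by (rule sum.cong[OF refl]) (use t in simp)
  also have "\<dots> = 1 / of_real (sqrt (2 * h)) * creation (cextend A X) (coherent h X) w"
    unfolding creation_def sum_distrib_left ..
  finally show "dGamma A (coherent h X) w = 1 / of_real (sqrt (2 * h)) * creation (cextend A X) (coherent h X) w" .
qed

lemma dGamma_wick_symbol:
  fixes A :: "'a::{real_inner, second_countable_topology} \<Rightarrow> 'a"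
  assumes h: "h > 0" and A: "selfadjoint_op A"
  shows "has_wick_symbol h (dGamma_dom A) (\<lambda>\<Psi> w. of_real (2 * h) * dGamma A \<Psi> w)
    (\<lambda>(q, p). of_real (A q \<bullet> q + A p \<bullet> p))"
proof -
  have c1: "coherent h X \<in> weighted_dom (Suc 0)" for X :: "'a \<times> 'a" by (rule coherent_weighted_dom[OF h])
  note f = coherent_fock[OF h, where 'a = 'a] creation_weighted_dom[OF c1, unfolded weighted_dom_0]
  have dom: "coherent h X \<in> dGamma_dom A" for X
    using f(1) fock_lincomb[OF f(2)[of "cextend A X" X] f(1), of "1 / of_real (sqrt (2 * h))" 0]
    by (simp add: dGamma_dom_def dGamma_coherent[OF h A])
  have "wick_symbol h (\<lambda>\<Psi> w. of_real (2 * h) * dGamma A \<Psi> w) X = of_real (A (fst X) \<bullet> fst X + A (snd X) \<bullet> snd X)" for X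
  proof -
    \<comment> \<open>Of the factor \<open>2 h\<close>, one root cancels the denominator in
      \<open>dGamma_coherent\<close>, the other the denominator of the eigenvalue of the adjoint
      annihilation operator.\<close>
    define s where "s = complex_of_real (sqrt (2 * h))"
    have s: "s * s = of_real (2 * h)" "s \<noteq> 0" using h by (simp_all add: s_def flip: of_real_mult)
    have "(\<lambda>w. of_real (2 * h) * dGamma A (coherent h X) w) =
        (\<lambda>w. s * creation (cextend A X) (coherent h X) w + 0 * coherent h X w)"
      unfolding dGamma_coherent[OF h A] s_def[symmetric] s(1)[symmetric] using s(2) by simp
    then have "wick_symbol h (\<lambda>\<Psi> w. of_real (2 * h) * dGamma A \<Psi> w) X =
        s * fock_inner (creation (cextend A X) (coherent h X)) (coherent h X)"
      unfolding wick_symbol_def by (simp only: fock_inner_lincomb[OF f(2,1,1)]) simp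
    also have "\<dots> = cinner (cextend A X) X"
      using fock_inner_creation_coherent[OF h coherent_weighted_dom[OF h], of "cextend A X" X X] s(2)
      by (simp add: fock_inner_coherent_self[OF h] s_def)
    also have "\<dots> = of_real (A (fst X) \<bullet> fst X + A (snd X) \<bullet> snd X)"
      using A by (simp add: cinner_def cextend_def complex_eq_iff selfadjoint_op_def inner_commute)
    finally show ?thesis .
  qed
  then have "wick_symbol h (\<lambda>\<Psi> w. of_real (2 * h) * dGamma A \<Psi> w) = (\<lambda>(q, p). of_real (A q \<bullet> q + A p \<bullet> p))"
    by (intro ext) (simp only: case_prod_beta')
  then show ?thesis unfolding has_wick_symbol_def using dom by blast
qed

section \<open>Wick quantization\<close>

theorem theorem2p2:
  assumes infinite_dim: "\<not> (\<exists>S :: 'a::{real_inner, polish_space} set. finite S \<and> span S = UNIV)"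
  shows "(\<forall>(AQ :: 'a \<times> 'a \<Rightarrow> 'a \<times> 'a) Q.
            selfadjoint_op AQ \<and> nonneg_op AQ \<and> trace_class AQ \<and> Q = (\<lambda>X. AQ X \<bullet> X) \<longrightarrow>
            (\<forall>F \<in> S_class Q. \<forall>h>0.
               (\<exists>!B. bounded_operator B \<and> has_wick_symbol h fock B F) \<and>
               operator_norm (op_wick h F) \<le> exp ((h / 2) * trace_op AQ) * S_norm Q F))
       \<and> (\<forall>(E :: 'a set) F m. hilbert_basis E \<and> polynomial_fun E F \<and> poly_fun_degree E F = m \<longrightarrow>
            (\<forall>h>0. \<exists>B. linear_operator_on (number_power_dom m) B \<and>
               closable (number_power_dom m) B \<and>
               has_wick_symbol h (number_power_dom m) B F))
       \<and> (\<forall>(A :: 'a \<times> 'a). \<forall>h>0.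
            has_wick_symbol h (segal_dom A) (segal A)
              (\<lambda>X. of_real (h powr (- 1 / 2) * (A \<bullet> X))))
       \<and> (\<forall>(A :: 'a \<Rightarrow> 'a) F. selfadjoint_op A \<and>
              F = (\<lambda>(q, p). of_real (A q \<bullet> q + A p \<bullet> p)) \<longrightarrow>
            (\<forall>h>0. has_wick_symbol h (dGamma_dom A)
               (\<lambda>\<Psi> w. of_real (2 * h) * dGamma A \<Psi> w) F))"
proof (intro conjI)
  show "\<forall>(AQ :: 'a \<times> 'a \<Rightarrow> 'a \<times> 'a) Q.
            selfadjoint_op AQ \<and> nonneg_op AQ \<and> trace_class AQ \<and> Q = (\<lambda>X. AQ X \<bullet> X) \<longrightarrow>
            (\<forall>F \<in> S_class Q. \<forall>h>0.
               (\<exists>!B. bounded_operator B \<and> has_wick_symbol h fock B F) \<and>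
               operator_norm (op_wick h F) \<le> exp ((h / 2) * trace_op AQ) * S_norm Q F)"
  proof (intro allI impI ballI, elim conjE)
    fix AQ :: "'a \<times> 'a \<Rightarrow> 'a \<times> 'a" and Q F and h :: real
    assume A: "selfadjoint_op AQ" "nonneg_op AQ" "trace_class AQ" and Q: "Q = (\<lambda>X. AQ X \<bullet> X)"
      and F: "F \<in> S_class Q" and h: "h > 0"
    show "(\<exists>!B. bounded_operator B \<and> has_wick_symbol h fock B F) \<and>
        operator_norm (op_wick h F) \<le> exp ((h / 2) * trace_op AQ) * S_norm Q F"
      unfolding Q by (intro conjI wick_quantization_bounded[OF h A F[unfolded Q]])
  qed
  show "\<forall>(E :: 'a set) F m. hilbert_basis E \<and> polynomial_fun E F \<and> poly_fun_degree E F = m \<longrightarrow>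
            (\<forall>h>0. \<exists>B. linear_operator_on (number_power_dom m) B \<and>
               closable (number_power_dom m) B \<and>
               has_wick_symbol h (number_power_dom m) B F)"
  proof (intro allI impI, elim conjE)
    fix E :: "'a set" and F :: "'a \<times> 'a \<Rightarrow> complex" and m and h :: real
    assume F: "polynomial_fun E F" and m: "poly_fun_degree E F = m" and h: "h > 0"
    obtain k where "F \<in> polys_upto E k" using F unfolding polynomial_fun_def by blast
    \<comment> \<open>The least bound is attained, so all products have at most \<open>m\<close>
      factors, matching the domain of the m-th power of N.\<close>
    then have "F \<in> polys_upto E m"
      unfolding m[symmetric] poly_fun_degree_def by (rule LeastI)
    then show "\<exists>B. linear_operator_on (number_power_dom m) B \<and> closable (number_power_dom m) B \<and>
        has_wick_symbol h (number_power_dom m) B F"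
      by (rule wick_quantization_polynomial[OF h])
  qed
  show "\<forall>(A :: 'a \<times> 'a). \<forall>h>0.
            has_wick_symbol h (segal_dom A) (segal A)
              (\<lambda>X. of_real (h powr (- 1 / 2) * (A \<bullet> X)))"
    by (intro allI impI segal_wick_symbol)
  show "\<forall>(A :: 'a \<Rightarrow> 'a) F. selfadjoint_op A \<and>
              F = (\<lambda>(q, p). of_real (A q \<bullet> q + A p \<bullet> p)) \<longrightarrow>
            (\<forall>h>0. has_wick_symbol h (dGamma_dom A)
               (\<lambda>\<Psi> w. of_real (2 * h) * dGamma A \<Psi> w) F)"
  proof (intro allI impI, elim conjE)
    fix A :: "'a \<Rightarrow> 'a" and F and h :: real
    assume A: "selfadjoint_op A" and F: "F = (\<lambda>(q, p). complex_of_real (A q \<bullet> q + A p \<bullet> p))" and h: "h > 0"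
    show "has_wick_symbol h (dGamma_dom A) (\<lambda>\<Psi> w. of_real (2 * h) * dGamma A \<Psi> w) F"
      unfolding F by (rule dGamma_wick_symbol[OF h A])
  qed
qed

end
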